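(* Let $d\ge1$ and let $(\mathbf X,Y)$ be jointly Gaussian, with $Y\sim\mathcal N(0,1)$ and $\mathbf X\sim\mathcal N(\mathbf 0,\Sigma_{\mathbf X})$ a $d$-dimensional column vector, where $\Sigma_{\mathbf X}$ is a known invertible matrix with all-ones diagonal. Let $\boldsymbol\rho=\mathbb E\,Y\mathbf X^T=[\rho_1,\dots,\rho_d]$ (a row vector). Let $\hat{\boldsymbol\rho}=Y_{\mathbf J}\hat{\mathbf W}_{\mathbf J}^{-1}\Sigma_{\mathbf X}^{1/2}$ be the stopping-set estimator defined in the context, with the parameters given there as functions of $k$. Then $$\mathbb E\|\hat{\boldsymbol\rho}-\boldsymbol\rho\|^2\le\frac1k\left(\frac{d^2}{2\ln2}\min_{1\le\ell\le d}\{1-\rho_\ell^2\}+o(1)\right),\qquad k\to\infty,$$ where $k$ is the expected number of transmitted bits. Furthermore, if $\sigma^2:=1-\boldsymbol\rho\Sigma_{\mathbf X}^{-1}\boldsymbol\rho^T>0$, then $\hat{\boldsymbol\rho}$ is asymptotically efficient given $(\mathbf W_{\mathbf J},Y_{\mathbf J})$.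
   Context: Notation: $Q(x)=\int_x^\infty \frac1{\sqrt{2\pi}}e^{-u^2/2}du$; $h(p)=-p\log_2p-(1-p)\log_2(1-p)$, $h_g(p)=h(p)/p$ for $p\in(0,1)$ (entropy of a geometric variable), with inverse $h_g^{-1}$ on $(0,\infty)$. $\|\cdot\|$ is the Euclidean norm. Samples: $(\mathbf X_i,Y_i)_{i\ge1}$ are i.i.d. copies of $(\mathbf X,Y)$; $\mathbf W_i=\Sigma_{\mathbf X}^{-1/2}\mathbf X_i\sim\mathcal N(\mathbf 0,\mathbf I_d)$. Equivalently $Y_i=\boldsymbol\rho\Sigma_{\mathbf X}^{-1/2}\mathbf W_i+\sigma Z_i$ with $Z_i\sim\mathcal N(0,1)$ independent of $\mathbf W_i$. Stopping sets: for $a,b>0$ and $\ell=1,\dots,d$, $A_\ell^w=\{\mathbf w\in\mathbb R^d:|w_\ell|>a,\ |w_j|<b\ \forall j\ne\ell\}$. Put $J_0^w=0$, $J_\ell^w=\min\{i>J_{\ell-1}^w:\mathbf W_i\in A_\ell^w\}$; $\mathbf W_{\mathbf J}=[\mathbf W_{J_1^w},\dots,\mathbf W_{J_d^w}]\in\mathbb R^{d\times d}$ (columns), $Y_{\mathbf J}=[Y_{J_1^w},\dots,Y_{J_d^w}]$ (row). Quantization: $\hat{\mathbf W}_{\mathbf J}$ is obtained entrywise from $\mathbf W_{\mathbf J}$ using $k_q$ bits per entry. Diagonal entries are truncated to absolute value at most $c=\sqrt3\,a$ (a value $w$ with $|w|>c$ is mapped to $\operatorname{sign}(w)c$), and $[-c,-a]\cup[a,c]$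 is divided into $2^{k_q}$ intervals of equal length, each value being represented by a fixed point (e.g. the midpoint) of its interval. Off-diagonal entries lie in $[-b,b]$, which is divided into $2^{k_q}$ intervals of equal length, each value being again represented by a fixed point of its interval. Parameters: $k_l=\frac1d(\sqrt{k+1}-1)^2$, $k_q=\sqrt{4k_l/d^3}$, $b=b_0$ for a fixed constant $b_0>0$ (small), and $a=Q^{-1}\!\left(\frac{h_g^{-1}(k_l)}{2(1-2Q(b_0))^{d-1}}\right)$ (defined for large $k$). Rounding is neglected; for definiteness $k$ ranges over the positive reals for which $k_q$ is a positive integer. The expected number of bits used is $d\,k_l+d^2k_q=k$, where $k_l=h_g(2Q(a)(1-2Q(b))^{d-1})$ is the cost of describing each index (the excess of at most one bit of an optimal code is neglected). Asymptotic efficiency: let $\mathrm I_T(\boldsymbol\rho)=\mathbb E[(\partial_{\boldsymbol\rho}\ln f(T\mid\boldsymbol\rho))^T(\partial_{\boldsymbol\rho}\ln f(T\mid\boldsymbol\rho))]$ be the Fisher information matrix of the statistic $T$. $\hat{\boldsymbol\rho}$ is asymptotically efficient given $T$ if $\mathbb E\hat{\boldsymbol\rho}\to\boldsymbol\rho$ and, for every nonzero $\mathbf v\in\mathbb R^d$, $(\mathbf v^T\operatorname{Cov}(\hat{\boldsymbol\rho})\mathbf v)/(\mathbf v^T\mathrm I_T(\boldsymbol\rho)^{-1}\mathbf v)\to1$ as $k\to\infty$. The $o(1)$ term is for fixed $d,\Sigma_{\mathbf X},\boldsymbol\rho,b_0$. *)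

theory Defs
  imports "HOL-Probability.Probability"
begin

definition gaussian_vector :: "'w measure \<Rightarrow> ('w \<Rightarrow> 'a::euclidean_space) \<Rightarrow> bool" where
  "gaussian_vector M Z \<longleftrightarrow> Z \<in> borel_measurable M \<and>
     (\<forall>u. \<exists>m s. 0 \<le> s \<and>
        distr M borel (\<lambda>\<omega>. u \<bullet> Z \<omega>) =
          (if s = 0 then return borel m else density lborel (\<lambda>x. ennreal (normal_density m s x))))"

definition covariance_matrix :: "'w measure \<Rightarrow> ('w \<Rightarrow> real^'n) \<Rightarrow> real^'n^'n" where
  "covariance_matrix M Z = (\<chi> i j.
     \<integral>\<omega>. (Z \<omega> $ i - (\<integral>\<omega>. Z \<omega> $ i \<partial>M)) * (Z \<omega> $ j - (\<integral>\<omega>. Z \<omega> $ j \<partial>M)) \<partial>M)"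

definition multivariate_normal ::
    "'w measure \<Rightarrow> ('w \<Rightarrow> real^'n) \<Rightarrow> real^'n \<Rightarrow> real^'n^'n \<Rightarrow> bool" where
  "multivariate_normal M Z m S \<longleftrightarrow>
     gaussian_vector M Z \<and> (\<integral>\<omega>. Z \<omega> \<partial>M) = m \<and> covariance_matrix M Z = S"

text \<open>The positive semidefinite square root; its inverse is the matrix written with exponent
  minus one half.\<close>

definition matrix_sqrt :: "real^'n^'n \<Rightarrow> real^'n^'n" where
  "matrix_sqrt S = (THE R. transpose R = R \<and> (\<forall>v. 0 \<le> v \<bullet> (R *v v)) \<and> R ** R = S)"

definition whiten :: "real^'n^'n \<Rightarrow> real^'n \<Rightarrow> real^'n" where
  "whiten S x = matrix_inv (matrix_sqrt S) *v x"

definition Q :: "real \<Rightarrow> real" where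
  "Q x = (LBINT u:{x..}. std_normal_density u)"

definition Q_inv :: "real \<Rightarrow> real" where
  "Q_inv = inv_into UNIV Q"

definition binary_entropy :: "real \<Rightarrow> real" where
  "binary_entropy p = - p * log 2 p - (1 - p) * log 2 (1 - p)"

definition geom_entropy :: "real \<Rightarrow> real" where
  "geom_entropy p = binary_entropy p / p"

definition geom_entropy_inv :: "real \<Rightarrow> real" where
  "geom_entropy_inv = inv_into {0<..<1} geom_entropy"

definition index_bits :: "nat \<Rightarrow> real \<Rightarrow> real" where
  "index_bits d k = (1 / real d) * (sqrt (k + 1) - 1)\<^sup>2"

definition entry_bits :: "nat \<Rightarrow> real \<Rightarrow> real" where
  "entry_bits d k = sqrt (4 * index_bits d k / real d ^ 3)"

text \<open>Budgets for which the number of bits per matrix entry is a positive integer;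
  limits as the budget grows are taken along these.\<close>

definition budgets :: "nat \<Rightarrow> real set" where
  "budgets d = {k. 0 < k \<and> (\<exists>n::nat. 1 \<le> n \<and> entry_bits d k = real n)}"

definition large_budgets :: "nat \<Rightarrow> real filter" where
  "large_budgets d = inf at_top (principal (budgets d))"

definition entry_bits_nat :: "nat \<Rightarrow> real \<Rightarrow> nat" where
  "entry_bits_nat d k = nat \<lfloor>entry_bits d k\<rfloor>"

definition threshold :: "nat \<Rightarrow> real \<Rightarrow> real \<Rightarrow> real" where
  "threshold d b k =
     Q_inv (geom_entropy_inv (index_bits d k) / (2 * (1 - 2 * Q b) ^ (d - 1)))"

text \<open>Each index increment is geometric with success probability
  \<open>2 * Q a * (1 - 2 * Q b) ^ (d - 1)\<close> and is charged its entropy;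
  each of the \<open>d\<^sup>2\<close> matrix entries is charged \<open>n\<close> bits.\<close>

definition expected_bits :: "nat \<Rightarrow> real \<Rightarrow> real \<Rightarrow> nat \<Rightarrow> real" where
  "expected_bits d a b n =
     real d * geom_entropy (2 * Q a * (1 - 2 * Q b) ^ (d - 1)) + (real d)\<^sup>2 * real n"

definition stop_set :: "real \<Rightarrow> real \<Rightarrow> 'n \<Rightarrow> (real^'n) set" where
  "stop_set a b l = {w. \<bar>w $ l\<bar> > a \<and> (\<forall>j. j \<noteq> l \<longrightarrow> \<bar>w $ j\<bar> < b)}"

text \<open>The coordinates are labelled by a bijection \<open>e\<close> from \<open>{1..d}\<close> to the index type, which
  fixes the order in which the stopping sets are visited.  If a stopping set is never hit (a null
  event for the sequences considered), the stopping time is set to the arbitrary index \<open>1\<close>.\<close>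

primrec stop_time :: "(nat \<Rightarrow> 'n) \<Rightarrow> real \<Rightarrow> real \<Rightarrow> (nat \<Rightarrow> real^'n) \<Rightarrow> nat \<Rightarrow> nat" where
  "stop_time e a b w 0 = 0"
| "stop_time e a b w (Suc l) =
     (if \<exists>i > stop_time e a b w l. w i \<in> stop_set a b (e (Suc l))
      then LEAST i. i > stop_time e a b w l \<and> w i \<in> stop_set a b (e (Suc l))
      else 1)"

definition stop_index ::
    "(nat \<Rightarrow> 'n::finite) \<Rightarrow> real \<Rightarrow> real \<Rightarrow> (nat \<Rightarrow> real^'n) \<Rightarrow> 'n \<Rightarrow> nat" where
  "stop_index e a b w l = stop_time e a b w (inv_into {1..CARD('n)} e l)"

definition stopped_matrix ::
    "(nat \<Rightarrow> 'n::finite) \<Rightarrow> real \<Rightarrow> real \<Rightarrow> (nat \<Rightarrow> real^'n) \<Rightarrow> real^'n^'n" where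
  "stopped_matrix e a b w = (\<chi> i l. w (stop_index e a b w l) $ i)"

definition stopped_row ::
    "(nat \<Rightarrow> 'n::finite) \<Rightarrow> real \<Rightarrow> real \<Rightarrow> (nat \<Rightarrow> real^'n) \<Rightarrow> (nat \<Rightarrow> real) \<Rightarrow> real^'n" where
  "stopped_row e a b w y = (\<chi> l. y (stop_index e a b w l))"

text \<open>The interval \<open>[lo, hi]\<close> is cut into \<open>N\<close> cells of equal length, and cell number \<open>j\<close>
  is represented by its point at relative position \<open>\<theta> j \<in> [0, 1]\<close>; the value \<open>1/2\<close> is the midpoint.\<close>

definition cell_index :: "real \<Rightarrow> real \<Rightarrow> nat \<Rightarrow> real \<Rightarrow> nat" where
  "cell_index lo hi N w = min (N - 1) (nat \<lfloor>(w - lo) * real N / (hi - lo)\<rfloor>)"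

definition cell_quantize :: "real \<Rightarrow> real \<Rightarrow> nat \<Rightarrow> (nat \<Rightarrow> real) \<Rightarrow> real \<Rightarrow> real" where
  "cell_quantize lo hi N \<theta> w =
     (let j = cell_index lo hi N w in lo + (real j + \<theta> j) * (hi - lo) / real N)"

definition offdiag_quantize :: "real \<Rightarrow> nat \<Rightarrow> (nat \<Rightarrow> real) \<Rightarrow> real \<Rightarrow> real" where
  "offdiag_quantize b n \<theta> w = cell_quantize (- b) b (2 ^ n) \<theta> w"

text \<open>Of the \<open>2 ^ n\<close> cells, half lie in \<open>[-c, -a]\<close> and are numbered first; the others lie in
  \<open>[a, c]\<close>.\<close>

definition diag_quantize :: "real \<Rightarrow> nat \<Rightarrow> (nat \<Rightarrow> real) \<Rightarrow> real \<Rightarrow> real" where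
  "diag_quantize a n \<theta> w =
     (let c = sqrt 3 * a;
          v = (if \<bar>w\<bar> > c then sgn w * c else w);
          N = 2 ^ (n - 1)
      in if v < 0 then cell_quantize (- c) (- a) N \<theta> v
         else cell_quantize a c N (\<lambda>j. \<theta> (N + j)) v)"

definition quantize_matrix ::
    "real \<Rightarrow> real \<Rightarrow> nat \<Rightarrow> ('n \<Rightarrow> 'n \<Rightarrow> nat \<Rightarrow> real) \<Rightarrow> real^'n^'n \<Rightarrow> real^'n^'n" where
  "quantize_matrix a b n \<theta> A = (\<chi> i j.
     if i = j then diag_quantize a n (\<theta> i j) (A $ i $ j)
     else offdiag_quantize b n (\<theta> i j) (A $ i $ j))"

definition stopping_statistic ::
    "real^'n^'n \<Rightarrow> (nat \<Rightarrow> 'n::finite) \<Rightarrow> real \<Rightarrow> real \<Rightarrow>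
     (nat \<Rightarrow> real^'n) \<Rightarrow> (nat \<Rightarrow> real) \<Rightarrow> (real^'n^'n) \<times> (real^'n)" where
  "stopping_statistic S e a b x y =
     (let w = (\<lambda>i. whiten S (x i)) in (stopped_matrix e a b w, stopped_row e a b w y))"

definition stopping_estimator ::
    "real^'n^'n \<Rightarrow> (nat \<Rightarrow> 'n::finite) \<Rightarrow> real \<Rightarrow> real \<Rightarrow> nat \<Rightarrow> ('n \<Rightarrow> 'n \<Rightarrow> nat \<Rightarrow> real) \<Rightarrow>
     (nat \<Rightarrow> real^'n) \<Rightarrow> (nat \<Rightarrow> real) \<Rightarrow> real^'n" where
  "stopping_estimator S e a b n \<theta> x y =
     (case stopping_statistic S e a b x y of (WJ, YJ) \<Rightarrow>
        (YJ v* matrix_inv (quantize_matrix a b n \<theta> WJ)) v* matrix_sqrt S)"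

definition std_gaussian :: "'a::euclidean_space measure" where
  "std_gaussian = density lborel (\<lambda>z. ennreal (\<Prod>b\<in>Basis. std_normal_density (z \<bullet> b)))"

definition noise_variance :: "real^'n^'n \<Rightarrow> real^'n \<Rightarrow> real" where
  "noise_variance S r = 1 - (r v* matrix_inv S) \<bullet> r"

text \<open>Law of \<open>(X, Y)\<close> when the correlation vector is \<open>r\<close>: with \<open>(W, Z)\<close> standard Gaussian and
  \<open>R\<close> the square root of \<open>S\<close>, it is the law of \<open>(R W, r R\<^sup>-\<^sup>1 W + \<sigma> Z)\<close>.\<close>

definition pair_law :: "real^'n^'n \<Rightarrow> real^'n \<Rightarrow> ((real^'n) \<times> real) measure" where
  "pair_law S r = distr std_gaussian borel
     (\<lambda>(w, z). (matrix_sqrt S *v w,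
               (r v* matrix_inv (matrix_sqrt S)) \<bullet> w + sqrt (noise_variance S r) * z))"

definition statistic_law ::
    "real^'n^'n \<Rightarrow> (nat \<Rightarrow> 'n::finite) \<Rightarrow> real \<Rightarrow> real \<Rightarrow> real^'n \<Rightarrow>
     ((real^'n^'n) \<times> (real^'n)) measure" where
  "statistic_law S e a b r = distr (PiM {1..} (\<lambda>_::nat. pair_law S r)) borel
     (\<lambda>s. stopping_statistic S e a b (\<lambda>i. fst (s i)) (\<lambda>i. snd (s i)))"

text \<open>\<open>P\<close> is a family of laws over the parameter set \<open>\<Theta>\<close>, \<open>f s\<close> a Lebesgue density of \<open>P s\<close>, and
  \<open>g t\<close> the score at \<open>r\<close>.  Densities are determined only up to null sets, so the version \<open>f\<close> is
  required to make the log-likelihood differentiable at \<open>r\<close>; for \<open>r\<close> interior to \<open>\<Theta>\<close> the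
  matrix \<open>I\<close> does not depend on the choice of such a version.\<close>

definition has_fisher_information ::
    "(real^'n) set \<Rightarrow> (real^'n \<Rightarrow> 't::euclidean_space measure) \<Rightarrow> real^'n \<Rightarrow> real^'n^'n \<Rightarrow> bool"
  where
  "has_fisher_information \<Theta> P r I \<longleftrightarrow> (\<exists>f g.
     (\<forall>s\<in>\<Theta>. f s \<in> borel_measurable borel \<and> (\<forall>t. 0 \<le> f s t) \<and>
            P s = density lborel (\<lambda>t. ennreal (f s t))) \<and>
     (AE t in P r. ((\<lambda>s. ln (f s t)) has_derivative (\<lambda>h. g t \<bullet> h)) (at r)) \<and>
     (\<forall>i j. integrable (P r) (\<lambda>t. g t $ i * g t $ j) \<and>
            I $ i $ j = (\<integral>t. g t $ i * g t $ j \<partial>P r)))"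

text \<open>The estimators \<open>est k\<close> live on \<open>M\<close>; \<open>P k s\<close> is the law under parameter \<open>s\<close> of the statistic
  available at budget \<open>k\<close>.\<close>

definition asymptotically_efficient ::
    "real filter \<Rightarrow> 'w measure \<Rightarrow> (real^'n) set \<Rightarrow>
     (real \<Rightarrow> real^'n \<Rightarrow> 't::euclidean_space measure) \<Rightarrow> (real \<Rightarrow> 'w \<Rightarrow> real^'n) \<Rightarrow>
     real^'n \<Rightarrow> bool" where
  "asymptotically_efficient F M \<Theta> P est r \<longleftrightarrow>
     (\<forall>\<^sub>F k in F. est k \<in> borel_measurable M \<and> integrable M (\<lambda>\<omega>. (norm (est k \<omega>))\<^sup>2)) \<and>
     ((\<lambda>k. \<integral>\<omega>. est k \<omega> \<partial>M) \<longlongrightarrow> r) F \<and>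
     (\<exists>I. (\<forall>\<^sub>F k in F. has_fisher_information \<Theta> (P k) r (I k) \<and> invertible (I k)) \<and>
          (\<forall>v. v \<noteq> 0 \<longrightarrow>
             ((\<lambda>k. (v \<bullet> (covariance_matrix M (est k) *v v)) /
                   (v \<bullet> (matrix_inv (I k) *v v))) \<longlongrightarrow> 1) F))"

end

theory Submission
  imports Defs "HOL-Real_Asymp.Real_Asymp"
begin

text \<open>Conditionally on hitting \<open>A\<^sub>1, \<dots>, A\<^sub>d\<close> successively, the selected observations are independent
  and follow the Gaussian law restricted to the stopping sets; these are rectangles, so all entries of
  the stopped matrix \<open>W\<close> are independent, and the noise vector \<open>Z\<close> stays standard Gaussian and
  independent of \<open>W\<close>.  With \<open>A\<close> the quantized matrix, \<open>R\<close> the square root of the covariance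
  matrix, \<open>u = R\<^sup>-\<^sup>1 \<rho>\<close> and \<open>\<zeta> = A\<^sup>-\<^sup>1 R v\<close>, the error in direction \<open>v\<close> is
  \<open>u \<bullet> (W - A) \<zeta> + \<sigma> Z \<bullet> \<zeta>\<close>.  The first term is a quantization error, negligible
  because \<open>2\<^sup>n\<close> outgrows \<open>a\<close> and overshooting \<open>\<surd>3 a\<close> is rare; as \<open>A\<close> is close to
  \<open>a\<close> times a diagonal sign matrix, the second has variance about
  \<open>\<sigma>\<^sup>2 |R v|\<^sup>2 / a\<^sup>2\<close>.  Since \<open>a\<^sup>2 \<sim> 2 (ln 2) k / d\<close>, this gives the error bound, and the Fisher
  information is \<open>S\<^sup>-\<^sup>1 a\<^sup>2 / \<sigma>\<^sup>2\<close> up to bounded terms, which gives efficiency.\<close>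

section \<open>Square roots of symmetric matrices\<close>

text \<open>Two orders of magnitude fix the parameters. A waiting time with success probability p
  costs about -ln p / ln 2 bits, and p is exp (-a^2 / 2) up to powers of a, so each index costs
  about a^2 / (2 ln 2) bits. The matrix entries together cost only the order of sqrt k bits, yet
  with that many bits 2^n dominates a, which is itself of order sqrt k. Summing \<sigma>^2 / a^2
  over d coordinates of unit variance and inserting the size of a gives the factor d^2 / (2 ln 2).
  The minimum appears because \<sigma>^2, the variance left after regression on all of X, is at most
  1 - \<rho>_l^2 for every l. Moments of the inverse of a random matrix are available because the
  stopping sets make the matrix nearly diagonal, and the quantizer keeps this for every input:
  diagonal at least a, off-diagonal at most b in absolute value. The inverse is thus bounded by a
  constant. Efficiency is a squeeze: multiplied by a^2, the covariance form and the inverse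
  information form both tend to \<sigma>^2 |R v|^2.\<close>

lemma self_adjoint_eigenvector:
  fixes f :: "'a::euclidean_space \<Rightarrow> 'a"
  assumes f: "linear f" and adj: "\<And>x y. x \<bullet> f y = f x \<bullet> y"
    and U: "subspace U" and inv: "\<And>x. x \<in> U \<Longrightarrow> f x \<in> U" and nz: "z \<in> U" "z \<noteq> 0"
  obtains x c where "x \<in> U" "norm x = 1" "f x = c *\<^sub>R x"
proof -
  interpret linear f by fact
  let ?K = "U \<inter> sphere 0 1"
  have "compact ?K"
    using closed_subspace[OF U] by (intro closed_Int_compact) auto
  moreover have "(1 / norm z) *\<^sub>R z \<in> ?K"
    using nz U by (auto simp: subspace_scale)
  moreover have "continuous_on ?K (\<lambda>x. x \<bullet> f x)"
    by (intro continuous_intros linear_continuous_on linear_conv_bounded_linear[THEN iffD1] f)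
  ultimately obtain x where x: "x \<in> ?K" and max: "\<And>y. y \<in> ?K \<Longrightarrow> y \<bullet> f y \<le> x \<bullet> f x"
    using continuous_attains_sup[of ?K "\<lambda>x. x \<bullet> f x"] by blast
  \<comment> \<open>The maximum of the Rayleigh quotient on \<open>U\<close>; the maximiser x will
    turn out to be an eigenvector with this eigenvalue.\<close>
  define m where "m = x \<bullet> f x"
  have xU: "x \<in> U" and nx: "x \<bullet> x = 1"
    using x by (auto simp: norm_eq_1)
  have bound: "y \<bullet> f y \<le> m * (y \<bullet> y)" if "y \<in> U" for y
  proof (cases "y = 0")
    case False
    have "(1 / norm y) *\<^sub>R y \<in> ?K"
      using that False U by (auto simp: subspace_scale)
    from max[OF this] show ?thesis
      using False unfolding m_def
      by (simp add: scale dot_square_norm field_simps power2_eq_square)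
  qed (simp add: zero)
  define v where "v = m *\<^sub>R x - f x"
  have vU: "v \<in> U"
    unfolding v_def using U xU inv by (intro subspace_diff subspace_scale) auto
  have "v \<bullet> v \<le> 0"
  proof (rule ccontr)
    assume "\<not> v \<bullet> v \<le> 0"
    then have pos: "0 < v \<bullet> v" by linarith
    define g where "g = m * (v \<bullet> v) - v \<bullet> f v"
    have g: "0 \<le> g" unfolding g_def using bound[OF vU] by simp
    \<comment> \<open>Moving from x along f x - m x, that is by a negative multiple of v, would
      raise the quotient to first order unless v = 0. The \<open>+ 1\<close> keeps the denominator
      positive and makes the second-order term too small to compensate.\<close>
    define t where "t = - (v \<bullet> v) / (g + 1)"
    have "x + t *\<^sub>R v \<in> U"
      using U xU vU by (intro subspace_add subspace_scale) auto
    from bound[OF this] have "0 \<le> m * ((x + t *\<^sub>R v) \<bullet> (x + t *\<^sub>R v)) - (x + t *\<^sub>R v) \<bullet> f (x + t *\<^sub>R v)"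
      by simp
    also have "\<dots> = 2 * t * (m * (x \<bullet> v) - f x \<bullet> v) + t\<^sup>2 * g"
    proof -
      have "v \<bullet> x = x \<bullet> v" "v \<bullet> f x = f x \<bullet> v" "x \<bullet> f v = f x \<bullet> v" "x \<bullet> f x = m"
        using adj[of x v] by (auto simp: inner_commute m_def)
      then show ?thesis
        unfolding g_def add scale inner_add_left inner_add_right inner_scaleR_left inner_scaleR_right nx
        by (simp add: algebra_simps power2_eq_square)
    qed
    also have "m * (x \<bullet> v) - f x \<bullet> v = v \<bullet> v"
      by (simp add: v_def inner_diff_left)
    finally have "0 \<le> t * (2 * (v \<bullet> v) + t * g)"
      by (simp add: algebra_simps power2_eq_square)
    moreover have "t < 0" using pos g by (simp add: t_def field_simps)
    ultimately have "2 * (v \<bullet> v) + t * g \<le> 0"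
      by (simp add: zero_le_mult_iff)
    moreover have "t * g \<ge> - (v \<bullet> v)"
      using pos g by (simp add: t_def field_simps)
    ultimately show False using pos by linarith
  qed
  then have "v = 0" using inner_gt_zero_iff[of v] by linarith
  then have "f x = m *\<^sub>R x" by (simp add: v_def)
  with xU x show thesis by (intro that) auto
qed

text \<open>Take an orthonormal family of eigenvectors of maximal size. Were its span proper, the
  orthogonal complement would be a nonzero invariant subspace and supply one more
  eigenvector.\<close>

lemma self_adjoint_eigenbasis:
  fixes f :: "'a::euclidean_space \<Rightarrow> 'a"
  assumes f: "linear f" and adj: "\<And>x y. x \<bullet> f y = f x \<bullet> y"
  obtains B c where "finite B" "pairwise orthogonal B" "\<And>b. b \<in> B \<Longrightarrow> norm b = 1" "span B = UNIV"
    "\<And>b. b \<in> B \<Longrightarrow> f b = c b *\<^sub>R b"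
proof -
  let ?P = "\<lambda>B. pairwise orthogonal B \<and> (\<forall>b\<in>B. norm b = 1 \<and> (\<exists>c. f b = c *\<^sub>R b))"
  have ind: "independent B" if "?P B" for B
    using that by (intro pairwise_orthogonal_independent) force+
  have "\<exists>B. ?P B \<and> (\<forall>C. ?P C \<longrightarrow> card C \<le> card B)"
    using independent_bound[OF ind]
    by (intro ex_has_greatest_nat[where k="{}" and b="Suc DIM('a)"]) (auto simp: less_Suc_eq_le)
  then obtain B where B: "?P B" and max: "\<And>C. ?P C \<Longrightarrow> card C \<le> card B" by blast
  have fin: "finite B" using independent_bound[OF ind[OF B]] by simp
  have "span B = UNIV"
  proof (rule ccontr)
    assume "span B \<noteq> UNIV"
    then obtain z where z: "z \<noteq> 0" "\<forall>x\<in>span B. z \<bullet> x = 0"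
      using span_not_UNIV_orthogonal by blast
    define U where "U = {y. \<forall>x\<in>B. x \<bullet> y = 0}"
    have "subspace U" by (auto simp: U_def subspace_def inner_add_right)
    moreover have "f y \<in> U" if "y \<in> U" for y
    proof -
      have "x \<bullet> f y = 0" if "x \<in> B" for x
        using B that \<open>y \<in> U\<close> adj[of x y] by (auto simp: U_def)
      then show ?thesis by (simp add: U_def)
    qed
    moreover have "z \<in> U" using z by (auto simp: U_def inner_commute span_base)
    ultimately obtain x c where x: "x \<in> U" "norm x = 1" "f x = c *\<^sub>R x"
      using self_adjoint_eigenvector[OF f adj] z by metis
    then have "x \<notin> B" by (auto simp: U_def norm_eq_1)
    have "?P (insert x B)"
      using B x by (auto simp: pairwise_insert orthogonal_def U_def inner_commute)
    from max[OF this] \<open>x \<notin> B\<close> fin show False by simp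
  qed
  moreover obtain c where "\<forall>b\<in>B. f b = c b *\<^sub>R b" using B by metis
  ultimately show thesis using that[of B c] B fin by blast
qed

lemma symmetric_matrix_iff_self_adjoint:
  fixes A :: "real^'n^'n"
  shows "transpose A = A \<longleftrightarrow> (\<forall>x y. x \<bullet> (A *v y) = (A *v x) \<bullet> y)"
proof
  assume "transpose A = A"
  then show "\<forall>x y. x \<bullet> (A *v y) = (A *v x) \<bullet> y"
    by (metis dot_lmul_matrix transpose_matrix_vector)
next
  assume *: "\<forall>x y. x \<bullet> (A *v y) = (A *v x) \<bullet> y"
  show "transpose A = A"
  proof (intro vec_eq_iff[THEN iffD2] allI)
    fix i j
    have "axis i 1 \<bullet> (A *v axis j 1) = (A *v axis i 1) \<bullet> axis j 1"
      using * by blast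
    then show "transpose A $ i $ j = A $ i $ j"
      by (simp add: transpose_def inner_axis' inner_axis matrix_vector_mult_basis column_def)
  qed
qed

lemma linear_eq_on_spanning:
  assumes "linear f" "linear g" "span B = UNIV" "\<And>b. b \<in> B \<Longrightarrow> f b = g b"
  shows "f = g"
proof
  fix x show "f x = g x"
    using linear_eq_on_span[OF assms(1,2,4)] assms(3) by blast
qed

text \<open>This justifies the definite description in \<open>matrix_sqrt\<close>. Existence takes
  roots of the eigenvalues in an eigenbasis of S; uniqueness shows that any other root acts the same
  way on that basis.\<close>

lemma matrix_sqrt_unique_exists:
  fixes S :: "real^'n^'n"
  assumes sym: "transpose S = S" and psd: "\<And>v. 0 \<le> v \<bullet> (S *v v)" and inv: "invertible S"
  shows "\<exists>!R. transpose R = R \<and> (\<forall>v. 0 \<le> v \<bullet> (R *v v)) \<and> R ** R = S"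
proof -
  have adj: "x \<bullet> (S *v y) = (S *v x) \<bullet> y" for x y
    using sym symmetric_matrix_iff_self_adjoint by blast
  obtain B c where B: "finite B" "pairwise orthogonal B" "\<And>b. b \<in> B \<Longrightarrow> norm b = 1" "span B = UNIV"
    and c: "\<And>b. b \<in> B \<Longrightarrow> S *v b = c b *\<^sub>R b"
    using self_adjoint_eigenbasis[OF matrix_vector_mul_linear adj] by metis
  have pos: "0 < c b" if "b \<in> B" for b
  proof -
    have "0 \<le> c b" using psd[of b] c[OF that] B(3)[OF that] by (simp add: norm_eq_1)
    moreover have "c b \<noteq> 0"
    proof
      assume "c b = 0"
      then have "S *v b = 0" using c[OF that] by simp
      then have "b = 0" using inv
        by (metis invertible_def matrix_left_invertible_ker)
      then show False using B(3)[OF that] by simp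
    qed
    ultimately show ?thesis by simp
  qed
  define r where "r v = (\<Sum>b\<in>B. (sqrt (c b) * (b \<bullet> v)) *\<^sub>R b)" for v
  have lr: "linear r"
    unfolding r_def
    by (intro linearI) (simp_all add: inner_add_right distrib_left scaleR_left_distrib sum.distrib scaleR_sum_right ac_simps)
  have rb: "r b = sqrt (c b) *\<^sub>R b" if "b \<in> B" for b
  proof -
    have "r b = (\<Sum>b'\<in>B. if b' = b then sqrt (c b) *\<^sub>R b else 0)"
      unfolding r_def using B(2,3) that
      by (intro sum.cong) (auto simp: pairwise_def orthogonal_def norm_eq_1)
    then show ?thesis using B(1) that by simp
  qed
  define R where "R = matrix r"
  have Rv: "R *v v = r v" for v unfolding R_def using lr by (simp add: matrix_works)
  have "transpose R = R"
    unfolding symmetric_matrix_iff_self_adjoint Rv r_def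
    by (auto simp: inner_sum_left inner_sum_right inner_commute intro!: sum.cong)
  moreover have "0 \<le> v \<bullet> (R *v v)" for v
    unfolding Rv r_def using pos
    by (auto simp: inner_sum_right inner_commute[of v] less_imp_le power2_eq_square[symmetric] mult.assoc intro!: sum_nonneg)
  moreover have "R ** R = S"
  proof -
    have "(*v) (R ** R) = (*v) S"
    proof (rule linear_eq_on_spanning[OF _ _ B(4)])
      fix b assume "b \<in> B"
      then have "(R ** R) *v b = sqrt (c b) *\<^sub>R sqrt (c b) *\<^sub>R b"
        by (simp add: matrix_vector_mul_assoc[symmetric] Rv rb linear_scale[OF lr])
      then show "(R ** R) *v b = S *v b"
        using pos[OF \<open>b \<in> B\<close>] c[OF \<open>b \<in> B\<close>] by simp
    qed auto
    then show ?thesis by (metis matrix_eq)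
  qed
  moreover have "R' = R" if R': "transpose R' = R'" "\<forall>v. 0 \<le> v \<bullet> (R' *v v)" "R' ** R' = S" for R'
  proof -
    have "(*v) R' = (*v) R"
    proof (rule linear_eq_on_spanning[OF _ _ B(4)])
      fix b assume b: "b \<in> B"
      define s where "s = sqrt (c b)"
      have s: "0 < s" "s * s = c b" using pos[OF b] by (auto simp: s_def)
      \<comment> \<open>From R'^2 b = s^2 b one gets (R' + s) (R' - s) b = 0, so w would be an
        eigenvector of R' with the negative eigenvalue -s. Semidefiniteness forces w = 0.\<close>
      define w where "w = R' *v b - s *\<^sub>R b"
      have "R' *v w = - s *\<^sub>R w"
        using c[OF b] s R'(3)
        by (simp add: w_def matrix_vector_mult_diff_distrib matrix_vector_mul_assoc matrix_vector_mult_scaleR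
             algebra_simps)
      then have "0 \<le> - s * (w \<bullet> w)"
        using R'(2)[rule_format, of w] by simp
      then have "w \<bullet> w \<le> 0" using s by (simp add: mult_le_0_iff zero_le_mult_iff)
      then have "w = 0" using inner_gt_zero_iff[of w] by linarith
      then show "R' *v b = R *v b"
        using rb[OF b] Rv by (simp add: w_def s_def)
    qed auto
    then show ?thesis by (metis matrix_eq)
  qed
  ultimately show ?thesis by blast
qed

lemma
  fixes S :: "real^'n^'n"
  assumes "transpose S = S" "\<And>v. 0 \<le> v \<bullet> (S *v v)" "invertible S"
  shows transpose_matrix_sqrt: "transpose (matrix_sqrt S) = matrix_sqrt S"
    and matrix_sqrt_mult_self: "matrix_sqrt S ** matrix_sqrt S = S"
    and invertible_matrix_sqrt: "invertible (matrix_sqrt S)"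
proof -
  have *: "transpose (matrix_sqrt S) = matrix_sqrt S \<and> (\<forall>v. 0 \<le> v \<bullet> (matrix_sqrt S *v v)) \<and> matrix_sqrt S ** matrix_sqrt S = S"
    unfolding matrix_sqrt_def by (rule theI'[OF matrix_sqrt_unique_exists[OF assms]])
  then show "transpose (matrix_sqrt S) = matrix_sqrt S" and sq: "matrix_sqrt S ** matrix_sqrt S = S" by auto
  have "det (matrix_sqrt S) * det (matrix_sqrt S) = det S"
    using sq by (metis det_mul)
  then show "invertible (matrix_sqrt S)"
    using assms(3) by (auto simp: invertible_det_nz)
qed

section \<open>Measures determined by trigonometric integrals\<close>

lemma measure_eq_on_boxes:
  fixes M N :: "'a::euclidean_space measure"
  assumes [measurable_cong]: "sets M = sets borel" "sets N = sets borel" and "finite_measure M"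
    and eq: "\<And>a b. emeasure M (box a b) = emeasure N (box a b)"
  shows "M = N"
proof (rule measure_eqI_generator_eq)
  interpret finite_measure M by fact
  let ?E = "range (\<lambda>(a, b). box a b :: 'a set)"
  let ?A = "\<lambda>n::nat. box (- (real n *\<^sub>R One)) (real n *\<^sub>R One) :: 'a set"
  show "Int_stable ?E"
    by (auto simp: Int_stable_def box_Int_box)
  show "?E \<subseteq> Pow UNIV" "sets M = sigma_sets UNIV ?E" "sets N = sigma_sets UNIV ?E"
    using assms(1,2) by (simp_all add: borel_eq_box)
  show "range ?A \<subseteq> ?E" by auto
  show "(\<Union>i. ?A i) = UNIV" by (rule UN_box_eq_UNIV)
  show "emeasure M (?A i) \<noteq> \<infinity>" for i by simp
  show "\<And>X. X \<in> ?E \<Longrightarrow> emeasure M X = emeasure N X" using eq by auto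
qed

text \<open>Uniqueness of characteristic functions concerns probability measures. The total masses
  agree by the case t = 0, so both measures can be divided by the common mass; mass zero is treated
  apart. The unnormalised form is what weighted measures require.\<close>

lemma finite_real_measure_eq_if_char_eq:
  fixes M N :: "real measure"
  assumes M: "finite_measure M" "sets M = sets borel" and N: "finite_measure N" "sets N = sets borel"
    and eq: "\<And>t. (\<integral>x. iexp (t * x) \<partial>M) = (\<integral>x. iexp (t * x) \<partial>N)"
  shows "M = N"
proof -
  note [measurable_cong] = M(2) N(2)
  interpret M: finite_measure M by fact
  interpret N: finite_measure N by fact
  have sp: "space M = UNIV" "space N = UNIV"
    using M N by (auto dest!: sets_eq_imp_space_eq)
  define m where "m = measure M UNIV"
  have mN: "measure N UNIV = m"
    using eq[of 0] by (simp add: m_def sp)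
  show ?thesis
  proof (cases "m = 0")
    case True
    show ?thesis
    proof (rule measure_eqI)
      fix A assume "A \<in> sets M"
      have "measure M A \<le> measure M UNIV" "measure N A \<le> measure N UNIV"
        using M.bounded_measure[of A] N.bounded_measure[of A] sp by auto
      then have "measure M A = 0" "measure N A = 0"
        using True m_def mN by (simp_all add: measure_le_0_iff)
      then show "emeasure M A = emeasure N A"
        by (simp add: M.emeasure_eq_measure N.emeasure_eq_measure)
    qed (simp add: M N)
  next
    case False
    then have m: "0 < m" by (simp add: m_def zero_less_measure_iff)
    let ?M = "density M (\<lambda>_. ennreal (1 / m))" and ?N = "density N (\<lambda>_. ennreal (1 / m))"
    have "emeasure (density P (\<lambda>_. c)) (space P) = c * emeasure P (space P)" for P :: "real measure" and c
      by (simp add: emeasure_density nn_integral_cmult_indicator)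
    from this[of M] this[of N] have "emeasure ?M UNIV = 1" "emeasure ?N UNIV = 1"
      using m mN by (simp_all add: sp M.emeasure_eq_measure N.emeasure_eq_measure
          m_def[symmetric] ennreal_mult[symmetric])
    then have pM: "prob_space ?M" and pN: "prob_space ?N"
      by (auto intro!: prob_spaceI simp: sp)
    have "real_distribution ?M" "real_distribution ?N"
      using pM pN by (auto simp: real_distribution_def real_distribution_axioms_def M N sp)
    moreover have "char ?M = char ?N"
      using m eq by (auto simp: char_def integral_density)
    ultimately have eq': "?M = ?N" by (rule Levy_uniqueness)
    show ?thesis
    proof (rule measure_eqI)
      fix A assume A: "A \<in> sets M"
      have "emeasure ?M A = emeasure ?N A" by (simp only: eq')
      then show "emeasure M A = emeasure N A"
        using m A M N by (simp add: emeasure_density ennreal_mult_cancel_left nn_integral_cmult_indicator)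
    qed (simp add: M N)
  qed
qed

text \<open>The phases c = 0 and c = -pi/2 recover real and imaginary part. Shifted cosines are the
  convenient test functions because products of them are again sums of them, and 1 plus a cosine is
  a nonnegative weight.\<close>

lemma finite_real_measure_eq_if_cos_eq:
  fixes M N :: "real measure"
  assumes M: "finite_measure M" "sets M = sets borel" and N: "finite_measure N" "sets N = sets borel"
    and eq: "\<And>t c. (\<integral>x. cos (t * x + c) \<partial>M) = (\<integral>x. cos (t * x + c) \<partial>N)"
  shows "M = N"
proof (rule finite_real_measure_eq_if_char_eq[OF M N])
  note [measurable_cong] = M(2) N(2)
  interpret M: finite_measure M by fact
  interpret N: finite_measure N by fact
  fix t :: real
  have sin: "sin y = cos (y + - (pi/2))" for y :: real by (simp add: cos_sin_eq minus_diff_commute flip: sin_cos_eq)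
  have iM: "integrable M (\<lambda>x. iexp (t * x))"
    by (rule M.integrable_const_bound[where B=1]) auto
  have iN: "integrable N (\<lambda>x. iexp (t * x))"
    by (rule N.integrable_const_bound[where B=1]) auto
  have re: "Re (iexp (t * x)) = cos (t * x + 0)" and im: "Im (iexp (t * x)) = cos (t * x + - (pi/2))" for x
    using sin[of "t * x"] by (simp_all add: Re_exp Im_exp)
  have "Re (\<integral>x. iexp (t * x) \<partial>M) = (\<integral>x. cos (t * x + 0) \<partial>M)"
    "Im (\<integral>x. iexp (t * x) \<partial>M) = (\<integral>x. cos (t * x + - (pi/2)) \<partial>M)"
    using integral_Re[OF iM] integral_Im[OF iM] unfolding re im by simp_all
  moreover have "Re (\<integral>x. iexp (t * x) \<partial>N) = (\<integral>x. cos (t * x + 0) \<partial>N)"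
    "Im (\<integral>x. iexp (t * x) \<partial>N) = (\<integral>x. cos (t * x + - (pi/2)) \<partial>N)"
    using integral_Re[OF iN] integral_Im[OF iN] unfolding re im by simp_all
  ultimately show "(\<integral>x. iexp (t * x) \<partial>M) = (\<integral>x. iexp (t * x) \<partial>N)"
    by (intro complex_eqI) (simp_all only: eq)
qed

text \<open>Fixing one coordinate after the other: the weight \<open>1 + cos (u \<bullet> x + c)\<close> is nonnegative, so
  the one-dimensional uniqueness theorem applies to the weighted measures.\<close>

lemma measure_eq_if_cos_eq:
  fixes M N :: "'a::euclidean_space measure"
  assumes M: "finite_measure M" "sets M = sets borel" and N: "finite_measure N" "sets N = sets borel"
    and eq: "\<And>u c. (\<integral>x. cos (u \<bullet> x + c) \<partial>M) = (\<integral>x. cos (u \<bullet> x + c) \<partial>N)"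
  shows "M = N"
proof -
  note [measurable_cong] = M(2) N(2)
  interpret M: finite_measure M by fact
  interpret N: finite_measure N by fact
  have sp: "space M = UNIV" "space N = UNIV"
    using M N by (auto dest!: sets_eq_imp_space_eq)
  \<comment> \<open>Coordinates in \<open>K\<close> are already tested by indicators, the remaining
    ones still by a cosine; the induction moves one coordinate at a time from the second kind to the
    first.\<close>
  have main: "(\<integral>x. (\<Prod>b\<in>K. indicator (A b) (x \<bullet> b)) * cos (u \<bullet> x + c) \<partial>M) =
      (\<integral>x. (\<Prod>b\<in>K. indicator (A b) (x \<bullet> b)) * cos (u \<bullet> x + c) \<partial>N)"
    if "finite K" "\<And>b. A b \<in> sets borel" for K :: "'a set" and A :: "'a \<Rightarrow> real set" and u c
    using that
  proof (induction K arbitrary: u c)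
    case empty
    then show ?case using eq by simp
  next
    case (insert j K)
    note [measurable] = insert.prems
    define I :: "'a \<Rightarrow> real" where "I x = (\<Prod>b\<in>K. indicator (A b) (x \<bullet> b))" for x
    have I[measurable]: "I \<in> borel_measurable borel" unfolding I_def by measurable
    have I01: "0 \<le> I x" "I x \<le> 1" for x
      unfolding I_def by (auto intro!: prod_nonneg prod_le_1)
    have IH: "(\<integral>x. I x * cos (u \<bullet> x + c) \<partial>M) = (\<integral>x. I x * cos (u \<bullet> x + c) \<partial>N)" for u c
      unfolding I_def by (rule insert.IH) (rule insert.prems)
    have intM: "integrable M (\<lambda>x. I x * cos (u \<bullet> x + c))" and intN: "integrable N (\<lambda>x. I x * cos (u \<bullet> x + c))" for u c
      using I01 by (auto intro!: M.integrable_const_bound[where B=1] N.integrable_const_bound[where B=1] AE_I2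
            mult_le_one simp: abs_mult)
    have step: "(\<integral>x. I x * (1 + cos (u \<bullet> x + c)) * indicator (A j) (x \<bullet> j) \<partial>M) =
          (\<integral>x. I x * (1 + cos (u \<bullet> x + c)) * indicator (A j) (x \<bullet> j) \<partial>N)" for u c
    proof -
      define w where "w x = I x * (1 + cos (u \<bullet> x + c))" for x
      have w[measurable]: "w \<in> borel_measurable borel" unfolding w_def by measurable
      have w0: "0 \<le> w x" "w x \<le> 2" for x
      proof -
        have "0 \<le> 1 + cos (u \<bullet> x + c)" "1 + cos (u \<bullet> x + c) \<le> 2"
          using cos_ge_minus_one[of "u \<bullet> x + c"] cos_le_one[of "u \<bullet> x + c"] by linarith+
        then show "0 \<le> w x" "w x \<le> 2" using I01[of x] mult_mono[of "I x" 1 "1 + cos (u \<bullet> x + c)" 2]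
          by (auto simp: w_def)
      qed
      \<comment> \<open>The product-to-sum formula turns the transform of the weighted measure along
        j into integrals covered by the induction hypothesis.\<close>
      have expand: "w x * cos (t * (x \<bullet> j) + c') =
          I x * cos ((t *\<^sub>R j) \<bullet> x + c') + (I x * cos ((u + t *\<^sub>R j) \<bullet> x + (c + c')) +
          I x * cos ((u - t *\<^sub>R j) \<bullet> x + (c - c'))) / 2" for t c' x
      proof -
        have "cos (u \<bullet> x + c) * cos (t * (x \<bullet> j) + c') =
           (cos (u \<bullet> x + c - (t * (x \<bullet> j) + c')) + cos (u \<bullet> x + c + (t * (x \<bullet> j) + c'))) / 2"
          by (rule cos_times_cos)
        moreover have "u \<bullet> x + c - (t * (x \<bullet> j) + c') = (u - t *\<^sub>R j) \<bullet> x + (c - c')"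
            "u \<bullet> x + c + (t * (x \<bullet> j) + c') = (u + t *\<^sub>R j) \<bullet> x + (c + c')"
            "t * (x \<bullet> j) + c' = (t *\<^sub>R j) \<bullet> x + c'"
          by (simp_all add: inner_add_left inner_diff_left inner_commute[of x j])
        ultimately show ?thesis by (simp add: w_def algebra_simps add_divide_distrib inner_commute[of j x])
      qed
      have wM: "finite_measure (density M w)" and wN: "finite_measure (density N w)"
      proof -
        have "(\<integral>\<^sup>+x. ennreal (w x) \<partial>M) \<le> (\<integral>\<^sup>+x. ennreal 2 \<partial>M)"
          "(\<integral>\<^sup>+x. ennreal (w x) \<partial>N) \<le> (\<integral>\<^sup>+x. ennreal 2 \<partial>N)"
          using w0 by (intro nn_integral_mono ennreal_leI; simp)+
        moreover have "(\<integral>\<^sup>+x. ennreal 2 \<partial>M) < \<infinity>" "(\<integral>\<^sup>+x. ennreal 2 \<partial>N) < \<infinity>"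
          by (simp_all add: ennreal_mult_eq_top_iff less_top[symmetric])
        ultimately show "finite_measure (density M w)" "finite_measure (density N w)"
          by (auto intro!: finite_measureI simp: emeasure_density sp cong: nn_integral_cong)
      qed
      have "distr (density M w) borel (\<lambda>x. x \<bullet> j) = distr (density N w) borel (\<lambda>x. x \<bullet> j)"
      proof (rule finite_real_measure_eq_if_cos_eq)
        show "finite_measure (distr (density M w) borel (\<lambda>x. x \<bullet> j))"
          by (rule finite_measure.finite_measure_distr[OF wM]) simp
        show "finite_measure (distr (density N w) borel (\<lambda>x. x \<bullet> j))"
          by (rule finite_measure.finite_measure_distr[OF wN]) simp
        fix t c'
        have "(\<integral>x. cos (t * x + c') \<partial>distr (density M w) borel (\<lambda>x. x \<bullet> j)) = (\<integral>x. w x * cos (t * (x \<bullet> j) + c') \<partial>M)"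
          using w0 by (simp add: integral_distr integral_density)
        also have "\<dots> = (\<integral>x. w x * cos (t * (x \<bullet> j) + c') \<partial>N)"
          unfolding expand by (simp add: intM intN IH del: inner_scaleR_left)
        also have "\<dots> = (\<integral>x. cos (t * x + c') \<partial>distr (density N w) borel (\<lambda>x. x \<bullet> j))"
          using w0 by (simp add: integral_distr integral_density)
        finally show "(\<integral>x. cos (t * x + c') \<partial>distr (density M w) borel (\<lambda>x. x \<bullet> j)) =
           (\<integral>x. cos (t * x + c') \<partial>distr (density N w) borel (\<lambda>x. x \<bullet> j))" .
      qed simp_all
      moreover have "(\<integral>x. indicator (A j) x \<partial>distr (density P w) borel (\<lambda>x. x \<bullet> j)) =
         (\<integral>x. w x * indicator (A j) (x \<bullet> j) \<partial>P)" if [measurable_cong]: "sets P = sets borel" for P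
        using w0 by (subst integral_distr) (auto simp add: integral_density)
      ultimately show ?thesis
        using M(2) N(2) by (metis (no_types, lifting) w_def Bochner_Integration.integral_cong)
    qed
    have iM: "integrable M (\<lambda>x. I x * cos (u \<bullet> x + c) * indicator (A j) (x \<bullet> j))"
      and iN: "integrable N (\<lambda>x. I x * cos (u \<bullet> x + c) * indicator (A j) (x \<bullet> j))"
      and iM0: "integrable M (\<lambda>x. I x * indicator (A j) (x \<bullet> j))"
      and iN0: "integrable N (\<lambda>x. I x * indicator (A j) (x \<bullet> j))"
      using I01 by (auto intro!: M.integrable_const_bound[where B=1] N.integrable_const_bound[where B=1] AE_I2
            mult_le_one simp: abs_mult indicator_def)
    have "(\<integral>x. I x * cos (u \<bullet> x + c) * indicator (A j) (x \<bullet> j) \<partial>M) =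
      (\<integral>x. I x * cos (u \<bullet> x + c) * indicator (A j) (x \<bullet> j) \<partial>N)"
      \<comment> \<open>The second instance has weight 1, as cos (pi/2) = 0; subtracting it from the
        first leaves the cosine alone.\<close>
      using step[of u c] step[of 0 "pi/2"] iM iN iM0 iN0
      by (simp add: distrib_left distrib_right)
    then show ?case
      using insert.hyps by (simp add: I_def mult_ac)
  qed
  show ?thesis
  proof (rule measure_eq_on_boxes[OF M(2) N(2) M(1)])
    fix a b :: 'a
    define A where "A i = {a \<bullet> i <..< b \<bullet> i}" for i
    have ind: "indicator (box a b) x = (\<Prod>i\<in>Basis. indicator (A i) (x \<bullet> i) :: real)" for x
      by (auto simp: A_def box_def indicator_def prod_zero_iff)
    have "(\<integral>x. indicator (box a b) x \<partial>M) = (\<integral>x. (indicator (box a b) x :: real) \<partial>N)"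
      unfolding ind using main[of Basis A 0 0] by (simp add: A_def)
    then show "emeasure M (box a b) = emeasure N (box a b)"
      by (simp add: M.emeasure_eq_measure N.emeasure_eq_measure sp)
  qed
qed

section \<open>Gaussian vectors\<close>

lemma integral_lborel_prod:
  fixes f :: "'a::euclidean_space \<Rightarrow> real \<Rightarrow> 'c::{real_normed_field,banach,second_countable_topology}"
  assumes int: "\<And>b. b \<in> Basis \<Longrightarrow> integrable lborel (f b)"
  shows "integrable lborel (\<lambda>x::'a. \<Prod>b\<in>Basis. f b (x \<bullet> b))"
    and "(\<integral>x. (\<Prod>b\<in>Basis. f b (x \<bullet> b)) \<partial>(lborel :: 'a measure)) = (\<Prod>b\<in>Basis. (\<integral>x. f b x \<partial>lborel))"
proof -
  interpret product_sigma_finite "\<lambda>_::'a. lborel :: real measure" by standard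
  have [measurable]: "f b \<in> borel_measurable borel" if "b \<in> Basis" for b
    using int[OF that] by simp
  have eq: "(\<Prod>b\<in>Basis. f b ((\<Sum>i\<in>Basis. g i *\<^sub>R i) \<bullet> b)) = (\<Prod>b\<in>Basis. f b (g b))" for g :: "'a \<Rightarrow> real"
    by (intro prod.cong) simp_all
  show "integrable lborel (\<lambda>x::'a. \<Prod>b\<in>Basis. f b (x \<bullet> b))"
    by (subst lborel_eq) (simp add: integrable_distr_eq eq product_integrable_prod int)
  show "(\<integral>x. (\<Prod>b\<in>Basis. f b (x \<bullet> b)) \<partial>(lborel :: 'a measure)) = (\<Prod>b\<in>Basis. (\<integral>x. f b x \<partial>lborel))"
    by (subst lborel_eq) (simp add: integral_distr eq product_integral_prod int)
qed

abbreviation gaussian_density :: "'a::euclidean_space \<Rightarrow> real" where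
  "gaussian_density z \<equiv> (\<Prod>b\<in>Basis. std_normal_density (z \<bullet> b))"

lemma sets_std_gaussian[simp, measurable_cong]: "sets std_gaussian = sets borel"
  and space_std_gaussian[simp]: "space std_gaussian = UNIV"
  by (simp_all add: std_gaussian_def)

lemma prob_space_std_gaussian: "prob_space (std_gaussian :: 'a::euclidean_space measure)"
proof
  have "emeasure (std_gaussian :: 'a measure) UNIV = (\<integral>\<^sup>+z. (\<Prod>b\<in>Basis. ennreal (std_normal_density (z \<bullet> b))) \<partial>(lborel :: 'a measure))"
    by (simp add: std_gaussian_def emeasure_density prod_ennreal)
  also have "\<dots> = (\<Prod>b\<in>(Basis::'a set). (\<integral>\<^sup>+x. ennreal (std_normal_density x) \<partial>lborel))"
    by (rule nn_integral_lborel_prod) auto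
  also have "\<dots> = 1" by (simp add: nn_integral_eq_integral)
  finally show "emeasure (std_gaussian :: 'a measure) (space std_gaussian) = 1" by simp
qed

lemma integral_iexp_std_normal: "(\<integral>x. std_normal_density x *\<^sub>R iexp (t * x) \<partial>lborel) = exp (- (t\<^sup>2) / 2)"
proof -
  have "char std_normal_distribution t = (\<integral>x. std_normal_density x *\<^sub>R iexp (t * x) \<partial>lborel)"
    by (simp add: char_def integral_density)
  then show ?thesis by (simp add: char_std_normal_distribution)
qed

lemma integrable_iexp_std_normal: "integrable lborel (\<lambda>x. std_normal_density x *\<^sub>R iexp (t * x))"
  by (rule Bochner_Integration.integrable_bound[of _ "std_normal_density"]) (auto simp: norm_mult)

lemma integral_iexp_std_gaussian:
  "(\<integral>z. iexp (u \<bullet> z) \<partial>(std_gaussian :: 'a::euclidean_space measure)) = exp (- (norm u)\<^sup>2 / 2)"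
proof -
  have "(\<integral>z. iexp (u \<bullet> z) \<partial>(std_gaussian :: 'a measure)) = (\<integral>z. gaussian_density z *\<^sub>R iexp (u \<bullet> z) \<partial>lborel)"
    unfolding std_gaussian_def by (rule integral_density) (auto intro!: prod_nonneg)
  also have "\<dots> = (\<integral>z. (\<Prod>b\<in>Basis. std_normal_density (z \<bullet> b) *\<^sub>R iexp ((u \<bullet> b) * (z \<bullet> b))) \<partial>(lborel :: 'a measure))"
  proof (rule Bochner_Integration.integral_cong)
    fix z :: 'a
    have "u \<bullet> z = (\<Sum>b\<in>Basis. (u \<bullet> b) * (z \<bullet> b))" by (rule euclidean_inner)
    then have "iexp (u \<bullet> z) = (\<Prod>b\<in>Basis. iexp ((u \<bullet> b) * (z \<bullet> b)))"
      by (simp add: exp_sum sum_distrib_left)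
    then show "gaussian_density z *\<^sub>R iexp (u \<bullet> z) = (\<Prod>b\<in>Basis. std_normal_density (z \<bullet> b) *\<^sub>R iexp ((u \<bullet> b) * (z \<bullet> b)))"
      by (simp add: scaleR_conv_of_real prod.distrib)
  qed simp
  also have "\<dots> = (\<Prod>b\<in>Basis. complex_of_real (exp (- ((u \<bullet> b)\<^sup>2) / 2)))"
    using integral_lborel_prod(2)[of "\<lambda>b x. std_normal_density x *\<^sub>R iexp ((u \<bullet> b) * x)"]
    by (simp only: integral_iexp_std_normal integrable_iexp_std_normal)
  also have "\<dots> = exp (\<Sum>b\<in>Basis. - ((u \<bullet> b)\<^sup>2) / 2)"
    by (simp add: exp_sum)
  also have "(\<Sum>b\<in>Basis. - ((u \<bullet> b)\<^sup>2) / 2) = - (norm u)\<^sup>2 / 2"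
    using euclidean_inner[of u u]
    by (simp add: dot_square_norm power2_eq_square sum_negf flip: sum_divide_distrib)
  finally show ?thesis .
qed

lemma cos_eq_Re_iexp: "cos (x + c) = Re (iexp c * iexp x)"
  by (simp add: exp_add[symmetric] Re_exp distrib_left[symmetric] add.commute flip: of_real_add)

lemma integral_cos_shift:
  assumes "finite_measure M" and [measurable]: "f \<in> borel_measurable M"
  shows "(\<integral>x. cos (f x + c) \<partial>M) = Re (iexp c * (\<integral>x. iexp (f x) \<partial>M))"
proof -
  interpret finite_measure M by fact
  have i: "integrable M (\<lambda>x. iexp c * iexp (f x))"
    by (rule integrable_const_bound[where B=1]) (auto simp: norm_mult)
  have "(\<integral>x. cos (f x + c) \<partial>M) = Re (\<integral>x. iexp c * iexp (f x) \<partial>M)"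
    unfolding cos_eq_Re_iexp by (rule integral_Re[OF i])
  then show ?thesis by simp
qed

lemma integral_cos_std_gaussian:
  "(\<integral>z. cos (u \<bullet> z + c) \<partial>(std_gaussian :: 'a::euclidean_space measure)) = exp (- (norm u)\<^sup>2 / 2) * cos c"
proof -
  interpret prob_space "std_gaussian :: 'a measure" by (rule prob_space_std_gaussian)
  show ?thesis
    by (subst integral_cos_shift)
       (auto simp: integral_iexp_std_gaussian finite_measure_axioms Re_exp simp del: of_real_exp)
qed

lemma normal_density_cos:
  assumes "0 < s"
  shows "(\<integral>x. normal_density m s x * cos (x + c) \<partial>lborel) = exp (- s\<^sup>2 / 2) * cos (m + c)"
proof -
  have "(\<integral>x. normal_density m s x * cos (x + c) \<partial>lborel) =
     \<bar>s\<bar> *\<^sub>R (\<integral>x. normal_density m s (m + s * x) * cos ((m + s * x) + c) \<partial>lborel)"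
    using assms by (intro lborel_integral_real_affine) simp
  also have "\<dots> = (\<integral>x. std_normal_density x * cos (s * x + (m + c)) \<partial>lborel)"
  proof -
    have "s * normal_density m s (m + s * x) = std_normal_density x" for x
      using assms by (simp add: normal_density_def real_sqrt_mult power_mult_distrib)
    then have "s * (normal_density m s (m + s * x) * cos ((m + s * x) + c)) = std_normal_density x * cos (s * x + (m + c))" for x
      by (metis add.commute add.left_commute mult.assoc)
    then show ?thesis using assms by (simp flip: integral_mult_right_zero)
  qed
  also have "\<dots> = (\<integral>x. cos (s * x + (m + c)) \<partial>std_normal_distribution)"
    by (simp add: integral_density)
  also have "\<dots> = exp (- s\<^sup>2 / 2) * cos (m + c)"
  proof -
    interpret real_distribution std_normal_distribution by (rule real_dist_normal_dist)
    have "(\<integral>x. iexp (s * x) \<partial>std_normal_distribution) = char std_normal_distribution s" by (simp add: char_def)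
    then show ?thesis
      by (subst integral_cos_shift)
         (auto simp: finite_measure_axioms char_std_normal_distribution Re_exp simp del: of_real_exp)
  qed
  finally show ?thesis .
qed

text \<open>All three claims are read off the one-dimensional law of the projection, a point mass or
  a normal density. The last one says that a centred Gaussian projection has a cosine transform
  fixed by its second moment, which is how joint laws are identified later.\<close>

lemma gaussian_vector_projection:
  fixes Z :: "'w \<Rightarrow> 'a::euclidean_space"
  assumes "prob_space M" and "gaussian_vector M Z"
  shows "integrable M (\<lambda>\<omega>. u \<bullet> Z \<omega>)" "integrable M (\<lambda>\<omega>. (u \<bullet> Z \<omega>)\<^sup>2)"
    and "(\<integral>\<omega>. u \<bullet> Z \<omega> \<partial>M) = 0 \<Longrightarrow> (\<integral>\<omega>. cos (u \<bullet> Z \<omega> + c) \<partial>M) = exp (- (\<integral>\<omega>. (u \<bullet> Z \<omega>)\<^sup>2 \<partial>M) / 2) * cos c"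
proof -
  interpret prob_space M by fact
  have [measurable]: "Z \<in> borel_measurable M" using assms(2) by (simp add: gaussian_vector_def)
  define D where "D = distr M borel (\<lambda>\<omega>. u \<bullet> Z \<omega>)"
  obtain m s where s: "0 \<le> s" and D: "D = (if s = 0 then return borel m else density lborel (\<lambda>x. ennreal (normal_density m s x)))"
    using assms(2) unfolding gaussian_vector_def D_def by blast
  have tr: "integrable M (\<lambda>\<omega>. f (u \<bullet> Z \<omega>)) \<longleftrightarrow> integrable D f" "(\<integral>\<omega>. f (u \<bullet> Z \<omega>) \<partial>M) = (\<integral>x. f x \<partial>D)"
    if [measurable]: "f \<in> borel_measurable borel" for f :: "real \<Rightarrow> real"
    by (simp_all add: D_def integrable_distr_eq integral_distr)
  have *: "integrable D (\<lambda>x. x) \<and> integrable D (\<lambda>x. x\<^sup>2) \<and> (\<integral>x. x \<partial>D) = m \<and>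
     (m = 0 \<longrightarrow> (\<integral>x. x\<^sup>2 \<partial>D) = s\<^sup>2) \<and> (\<integral>x. cos (x + c) \<partial>D) = exp (- s\<^sup>2 / 2) * cos (m + c)"
  proof (cases "s = 0")
    case True
    then show ?thesis by (simp add: D integrable_iff_bounded nn_integral_return integral_return)
  next
    case False
    then have s: "0 < s" using s by simp
    have sq: "normal_density m s x * x\<^sup>2 = normal_density m s x * (x - m)^2 + 2 * m * (normal_density m s x * x) - m\<^sup>2 * normal_density m s x" for x
      by (simp add: power2_eq_square algebra_simps)
    have D: "D = density lborel (\<lambda>x. ennreal (normal_density m s x))" using D False by simp
    show ?thesis unfolding D using s integrable_normal_moment[of s m 2] integrable_normal_moment_nz_1[of s m]
        normal_moment_even[of s m 1]
      by (auto simp: integrable_density integral_density integral_normal_moment_nz_1 normal_density_cos sq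
          simp: has_bochner_integral_iff)
  qed
  then show "integrable M (\<lambda>\<omega>. u \<bullet> Z \<omega>)" "integrable M (\<lambda>\<omega>. (u \<bullet> Z \<omega>)\<^sup>2)"
    using tr(1)[of "\<lambda>x. x"] tr(1)[of "\<lambda>x. x\<^sup>2"] by auto
  show "(\<integral>\<omega>. cos (u \<bullet> Z \<omega> + c) \<partial>M) = exp (- (\<integral>\<omega>. (u \<bullet> Z \<omega>)\<^sup>2 \<partial>M) / 2) * cos c"
    if "(\<integral>\<omega>. u \<bullet> Z \<omega> \<partial>M) = 0"
    using that * tr(2)[of "\<lambda>x. x"] tr(2)[of "\<lambda>x. x\<^sup>2"] tr(2)[of "\<lambda>x. cos (x + c)"] by auto
qed


section \<open>Positive definite matrices, their roots and the noise variance\<close>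

definition positive_definite :: "real^'n^'n \<Rightarrow> bool" where
  "positive_definite S \<longleftrightarrow> transpose S = S \<and> (\<forall>v. 0 \<le> v \<bullet> (S *v v)) \<and> invertible S"

lemma matrix_inv_mult:
  fixes A :: "real^'n^'n"
  assumes "invertible A"
  shows "A ** matrix_inv A = mat 1" "matrix_inv A ** A = mat 1"
    "A *v (matrix_inv A *v x) = x" "matrix_inv A *v (A *v x) = x"
proof -
  have "A ** matrix_inv A = mat 1 \<and> matrix_inv A ** A = mat 1"
    unfolding matrix_inv_def using assms unfolding invertible_def by (rule someI_ex)
  then show *: "A ** matrix_inv A = mat 1" "matrix_inv A ** A = mat 1" by auto
  show "A *v (matrix_inv A *v x) = x" "matrix_inv A *v (A *v x) = x"
    by (simp_all add: matrix_vector_mul_assoc *)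
qed

lemma matrix_inv_left_unique:
  fixes A :: "real^'n^'n"
  assumes "B ** A = mat 1"
  shows "matrix_inv A = B"
proof -
  have "invertible A" using assms by (auto simp: invertible_left_inverse)
  then have "B ** (A ** matrix_inv A) = B" by (simp add: matrix_inv_mult)
  then show ?thesis using assms by (simp add: matrix_mul_assoc)
qed

context
  fixes S :: "real^'n^'n"
  assumes S: "positive_definite S"
begin

lemmas sqrt_props =
  transpose_matrix_sqrt[of S] matrix_sqrt_mult_self[of S] invertible_matrix_sqrt[of S]

lemma matrix_sqrt_self_adjoint: "x \<bullet> (matrix_sqrt S *v y) = (matrix_sqrt S *v x) \<bullet> y"
  and matrix_sqrt_twice: "matrix_sqrt S *v (matrix_sqrt S *v x) = S *v x"
  and matrix_sqrt_inv: "matrix_sqrt S *v (matrix_inv (matrix_sqrt S) *v x) = x"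
    "matrix_inv (matrix_sqrt S) *v (matrix_sqrt S *v x) = x"
proof -
  have *: "transpose (matrix_sqrt S) = matrix_sqrt S" "matrix_sqrt S ** matrix_sqrt S = S"
     "invertible (matrix_sqrt S)"
    using S by (simp_all add: sqrt_props positive_definite_def)
  show "x \<bullet> (matrix_sqrt S *v y) = (matrix_sqrt S *v x) \<bullet> y"
    using *(1) symmetric_matrix_iff_self_adjoint by blast
  show "matrix_sqrt S *v (matrix_sqrt S *v x) = S *v x"
    by (simp add: matrix_vector_mul_assoc *)
  show "matrix_sqrt S *v (matrix_inv (matrix_sqrt S) *v x) = x"
    "matrix_inv (matrix_sqrt S) *v (matrix_sqrt S *v x) = x"
    using *(3) by (simp_all add: matrix_inv_mult)
qed

lemma matrix_sqrt_inv_self_adjoint: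
  "x \<bullet> (matrix_inv (matrix_sqrt S) *v y) = (matrix_inv (matrix_sqrt S) *v x) \<bullet> y"
  using matrix_sqrt_self_adjoint[of "matrix_inv (matrix_sqrt S) *v x" "matrix_inv (matrix_sqrt S) *v y"]
  by (simp add: matrix_sqrt_inv)

lemma vector_matrix_sqrt_inv: "x v* matrix_inv (matrix_sqrt S) = matrix_inv (matrix_sqrt S) *v x"
  using matrix_sqrt_inv_self_adjoint
  by (metis symmetric_matrix_iff_self_adjoint transpose_matrix_vector)

lemma matrix_inv_eq_sqrt: "matrix_inv S *v x = matrix_inv (matrix_sqrt S) *v (matrix_inv (matrix_sqrt S) *v x)"
proof -
  have "S *v (matrix_inv (matrix_sqrt S) *v (matrix_inv (matrix_sqrt S) *v x)) = x"
    by (simp flip: matrix_sqrt_twice add: matrix_sqrt_inv)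
  then show ?thesis
    using S matrix_inv_mult(4)[of S] by (metis positive_definite_def)
qed

lemma matrix_inv_self_adjoint: "x \<bullet> (matrix_inv S *v y) = (matrix_inv S *v x) \<bullet> y"
  by (simp add: matrix_inv_eq_sqrt matrix_sqrt_inv_self_adjoint)

lemma vector_matrix_inv: "x v* matrix_inv S = matrix_inv S *v x"
  using matrix_inv_self_adjoint by (metis symmetric_matrix_iff_self_adjoint transpose_matrix_vector)

lemma noise_variance_eq: "noise_variance S r = 1 - r \<bullet> (matrix_inv S *v r)"
  by (simp add: noise_variance_def vector_matrix_inv inner_commute)

lemma noise_variance_eq_norm: "noise_variance S r = 1 - (norm (matrix_inv (matrix_sqrt S) *v r))\<^sup>2"
  by (simp add: noise_variance_eq matrix_inv_eq_sqrt matrix_sqrt_inv_self_adjoint dot_square_norm)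

lemma norm_matrix_sqrt: "(norm (matrix_sqrt S *v x))\<^sup>2 = x \<bullet> (S *v x)"
  by (simp add: dot_square_norm[symmetric] matrix_sqrt_twice[symmetric] matrix_sqrt_self_adjoint)

text \<open>Regressing on all coordinates leaves no more variance than regressing on coordinate l
  alone. With y = S^-1 r, semidefiniteness of S at y - r_l e_l reads y . r - r_l^2 \<ge> 0.\<close>

lemma noise_variance_le:
  assumes "S $ l $ l = 1"
  shows "noise_variance S r \<le> 1 - (r $ l)\<^sup>2"
proof -
  define y where "y = matrix_inv S *v r"
  have Sy: "S *v y = r" using S by (simp add: y_def matrix_inv_mult positive_definite_def)
  have "0 \<le> (y - (r $ l) *\<^sub>R axis l 1) \<bullet> (S *v (y - (r $ l) *\<^sub>R axis l 1))"
    using S by (simp add: positive_definite_def)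
  moreover have "axis l 1 \<bullet> (S *v axis l 1) = 1"
    using assms by (simp add: inner_axis' matrix_vector_mult_basis column_def)
  moreover have "y \<bullet> (S *v axis l 1) = r $ l"
    using Sy S unfolding positive_definite_def symmetric_matrix_iff_self_adjoint
    by (simp add: inner_axis)
  moreover have "axis l 1 \<bullet> (S *v y) = r $ l"
    using Sy by (simp add: inner_axis')
  ultimately have "0 \<le> y \<bullet> r - (r $ l)\<^sup>2"
    by (simp add: matrix_vector_mult_diff_distrib matrix_vector_mult_scaleR inner_diff_left inner_diff_right Sy power2_eq_square)
  then show ?thesis by (simp add: noise_variance_eq y_def inner_commute)
qed

end

section \<open>The law of one observation\<close>

definition pair_map :: "real^'n^'n \<Rightarrow> real^'n \<Rightarrow> (real^'n) \<times> real \<Rightarrow> (real^'n) \<times> real" where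
  "pair_map S r = (\<lambda>(w, z). (matrix_sqrt S *v w,
               (r v* matrix_inv (matrix_sqrt S)) \<bullet> w + sqrt (noise_variance S r) * z))"

lemma measurable_pair_map[measurable]:
  fixes S :: "real^'n^'n"
  shows "pair_map S r \<in> borel_measurable borel"
proof -
  have "continuous_on UNIV (\<lambda>x::(real^'n) \<times> real. matrix_sqrt S *v fst x)"
    by (intro linear_continuous_on bounded_linear_compose[OF matrix_vector_mul_bounded_linear bounded_linear_fst])
  then have "continuous_on UNIV (pair_map S r)"
    unfolding pair_map_def case_prod_beta by (intro continuous_intros)
  then show ?thesis by (rule borel_measurable_continuous_onI)
qed

lemma pair_law_eq: "pair_law S r = distr std_gaussian borel (pair_map S r)"
  by (simp add: pair_law_def pair_map_def)

lemma prob_space_pair_law: "prob_space (pair_law S r)"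
  unfolding pair_law_eq by (intro prob_space.prob_space_distr prob_space_std_gaussian) simp

lemma sets_pair_law[simp, measurable_cong]: "sets (pair_law S r) = sets borel"
  and space_pair_law[simp]: "space (pair_law S r) = UNIV"
  by (simp_all add: pair_law_eq)

lemma integral_cos_pair_law:
  assumes S: "positive_definite S" and v: "0 \<le> noise_variance S r"
  shows "(\<integral>x. cos ((p, q) \<bullet> x + c) \<partial>pair_law S r) = exp (- (p \<bullet> (S *v p) + 2 * q * (p \<bullet> r) + q\<^sup>2) / 2) * cos c"
proof -
  let ?R = "matrix_sqrt S"
  \<comment> \<open>The adjoint of the linear map \<open>pair_map\<close> applied to (p, q); its
    squared length is the variance of p . X + q Y.\<close>
  define u where "u = (?R *v p + q *\<^sub>R (matrix_inv ?R *v r), q * sqrt (noise_variance S r))"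
  have "(p, q) \<bullet> pair_map S r x = u \<bullet> x" for x
    by (cases x) (simp add: pair_map_def u_def vector_matrix_sqrt_inv[OF S] matrix_sqrt_self_adjoint[OF S] inner_add_left algebra_simps)
  then have "(\<integral>x. cos ((p, q) \<bullet> x + c) \<partial>pair_law S r) = (\<integral>x. cos (u \<bullet> x + c) \<partial>std_gaussian)"
    by (simp add: pair_law_eq integral_distr)
  also have "\<dots> = exp (- (norm u)\<^sup>2 / 2) * cos c" by (rule integral_cos_std_gaussian)
  also have "(norm u)\<^sup>2 = p \<bullet> (S *v p) + 2 * q * (p \<bullet> r) + q\<^sup>2"
  proof -
    have "(norm u)\<^sup>2 = (norm (?R *v p + q *\<^sub>R (matrix_inv ?R *v r)))\<^sup>2 + q\<^sup>2 * noise_variance S r"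
      using v by (simp add: u_def norm_Pair power_mult_distrib)
    also have "(norm (?R *v p + q *\<^sub>R (matrix_inv ?R *v r)))\<^sup>2 =
       (norm (?R *v p))\<^sup>2 + 2 * q * (p \<bullet> r) + q\<^sup>2 * (norm (matrix_inv ?R *v r))\<^sup>2"
    proof -
      have "(?R *v p) \<bullet> (matrix_inv ?R *v r) = p \<bullet> r"
        by (simp add: matrix_sqrt_self_adjoint[OF S, symmetric] matrix_sqrt_inv[OF S])
      then show ?thesis
        using inner_commute[of "matrix_inv ?R *v r" "?R *v p"]
        unfolding dot_square_norm[symmetric] inner_add_left inner_add_right inner_scaleR_left inner_scaleR_right
        by (simp add: power2_eq_square distrib_left)
    qed
    finally show ?thesis
      by (simp add: norm_matrix_sqrt[OF S] noise_variance_eq_norm[OF S] algebra_simps)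
  qed
  finally show ?thesis .
qed

lemma integral_vec_nth:
  fixes f :: "'a \<Rightarrow> real^'n"
  assumes "\<And>i. integrable M (\<lambda>x. f x $ i)"
  shows "integrable M f" "(\<integral>x. f x \<partial>M) $ i = (\<integral>x. f x $ i \<partial>M)"
proof -
  have "integrable M (\<lambda>x. \<Sum>i\<in>UNIV. (f x $ i) *\<^sub>R axis i (1::real))"
    using assms by (intro Bochner_Integration.integrable_sum integrable_scaleR_left) simp
  moreover have "(\<Sum>i\<in>UNIV. (f x $ i) *\<^sub>R axis i (1::real)) = f x" for x
    by (simp add: vec_eq_iff axis_def if_distrib cong: if_cong)
  ultimately show "integrable M f" by simp
  then show "(\<integral>x. f x \<partial>M) $ i = (\<integral>x. f x $ i \<partial>M)"
    by (simp add: integral_bounded_linear[OF bounded_linear_vec_nth])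
qed

text \<open>A centred Gaussian vector is determined by its second moments. The quadratic form
  computed in \<open>quad\<close> is the exponent in the cosine transform of
  \<open>pair_law\<close>, so the two laws coincide.\<close>

lemma joint_gaussian_law:
  fixes X :: "'w \<Rightarrow> real^'n" and Y :: "'w \<Rightarrow> real" and S :: "real^'n^'n"
  assumes "prob_space M" and gauss: "gaussian_vector M (\<lambda>\<omega>. (X \<omega>, Y \<omega>))"
    and Y: "distributed M lborel Y std_normal_density"
    and X: "multivariate_normal M X 0 S" and inv: "invertible S"
    and r: "\<rho> = (\<chi> l. \<integral>\<omega>. Y \<omega> * X \<omega> $ l \<partial>M)"
  shows "positive_definite S" "0 \<le> noise_variance S \<rho>"
    "distr M borel (\<lambda>\<omega>. (X \<omega>, Y \<omega>)) = pair_law S \<rho>"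
proof -
  interpret prob_space M by fact
  note proj = gaussian_vector_projection[OF \<open>prob_space M\<close> gauss]
  have meas[measurable]: "(\<lambda>\<omega>. (X \<omega>, Y \<omega>)) \<in> borel_measurable M"
    using gauss by (simp add: gaussian_vector_def)
  have iX: "integrable M (\<lambda>\<omega>. v \<bullet> X \<omega>)" "integrable M (\<lambda>\<omega>. (v \<bullet> X \<omega>)\<^sup>2)" for v
    using proj(1,2)[of "(v, 0)"] by simp_all
  have iY: "integrable M Y" "integrable M (\<lambda>\<omega>. (Y \<omega>)\<^sup>2)"
    using proj(1,2)[of "(0, 1)"] by simp_all
  have iXc: "integrable M (\<lambda>\<omega>. X \<omega> $ i)" for i
    using iX(1)[of "axis i 1"] by (simp add: inner_axis')
  have iXX: "integrable M (\<lambda>\<omega>. X \<omega> $ i * X \<omega> $ j)" for i j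
  proof -
    \<comment> \<open>Polarisation: only squares of projections are known to be integrable so
      far.\<close>
    have "integrable M (\<lambda>\<omega>. (((axis i 1 + axis j 1) \<bullet> X \<omega>)\<^sup>2 - (axis i 1 \<bullet> X \<omega>)\<^sup>2 - (axis j 1 \<bullet> X \<omega>)\<^sup>2) / 2)"
      by (intro integrable_divide Bochner_Integration.integrable_diff iX)
    moreover have "(((axis i 1 + axis j 1) \<bullet> x)\<^sup>2 - (axis i 1 \<bullet> x)\<^sup>2 - (axis j 1 \<bullet> x)\<^sup>2) / 2 = x $ i * x $ j" for x :: "real^'n"
      by (simp add: inner_add_left inner_axis' power2_eq_square algebra_simps)
    ultimately show ?thesis by simp
  qed
  have iYX: "integrable M (\<lambda>\<omega>. Y \<omega> * X \<omega> $ i)" for i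
  proof -
    have "integrable M (\<lambda>\<omega>. (((axis i 1, 1) \<bullet> (X \<omega>, Y \<omega>))\<^sup>2 - (axis i 1 \<bullet> X \<omega>)\<^sup>2 - (Y \<omega>)\<^sup>2) / 2)"
      by (intro integrable_divide Bochner_Integration.integrable_diff iX proj iY)
    moreover have "(((axis i 1, 1) \<bullet> (x, y))\<^sup>2 - (axis i 1 \<bullet> x)\<^sup>2 - y\<^sup>2) / 2 = y * x $ i" for x :: "real^'n" and y :: real
      by (simp add: inner_axis' power2_eq_square algebra_simps)
    ultimately show ?thesis by simp
  qed
  have EX: "(\<integral>\<omega>. X \<omega> $ i \<partial>M) = 0" for i
    using X integral_vec_nth(2)[where f=X and M=M, OF iXc, of i] by (simp add: multivariate_normal_def)
  have EXX: "(\<integral>\<omega>. X \<omega> $ i * X \<omega> $ j \<partial>M) = S $ i $ j" for i j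
    using X EX by (auto simp: multivariate_normal_def covariance_matrix_def)
  have EY: "(\<integral>\<omega>. Y \<omega> \<partial>M) = 0" "(\<integral>\<omega>. (Y \<omega>)\<^sup>2 \<partial>M) = 1"
    using standard_normal_distributed_expectation[OF Y] standard_normal_distributed_variance[OF Y] by simp_all
  have EYX: "(\<integral>\<omega>. Y \<omega> * X \<omega> $ i \<partial>M) = \<rho> $ i" for i by (simp add: r)
  have E0: "(\<integral>\<omega>. (p, q) \<bullet> (X \<omega>, Y \<omega>) \<partial>M) = 0" for p q
    using iY iXc by (simp add: inner_vec_def EX EY)
  have quad: "(\<integral>\<omega>. ((p, q) \<bullet> (X \<omega>, Y \<omega>))\<^sup>2 \<partial>M) = p \<bullet> (S *v p) + 2 * q * (p \<bullet> \<rho>) + q\<^sup>2" for p q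
  proof -
    have "((p, q) \<bullet> (x, y))\<^sup>2 = (\<Sum>i\<in>UNIV. \<Sum>j\<in>UNIV. p $ i * p $ j * (x $ i * x $ j)) +
        2 * q * (\<Sum>i\<in>UNIV. p $ i * (y * x $ i)) + q\<^sup>2 * y\<^sup>2" for x :: "real^'n" and y
    proof -
      have "((p, q) \<bullet> (x, y))\<^sup>2 = (p \<bullet> x) * (p \<bullet> x) + 2 * q * (y * (p \<bullet> x)) + q\<^sup>2 * y\<^sup>2"
        by (simp add: power2_eq_square algebra_simps)
      also have "(p \<bullet> x) * (p \<bullet> x) = (\<Sum>i\<in>UNIV. \<Sum>j\<in>UNIV. p $ i * p $ j * (x $ i * x $ j))"
        by (simp add: inner_vec_def sum_product mult_ac)
      also have "y * (p \<bullet> x) = (\<Sum>i\<in>UNIV. p $ i * (y * x $ i))"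
        by (simp add: inner_vec_def sum_distrib_left mult_ac)
      finally show ?thesis .
    qed
    then have "(\<integral>\<omega>. ((p, q) \<bullet> (X \<omega>, Y \<omega>))\<^sup>2 \<partial>M) =
       (\<Sum>i\<in>UNIV. \<Sum>j\<in>UNIV. p $ i * p $ j * S $ i $ j) + 2 * q * (\<Sum>i\<in>UNIV. p $ i * \<rho> $ i) + q\<^sup>2"
      using iXX iYX iY by (simp add: EXX EYX EY)
    then show ?thesis
      by (simp add: inner_vec_def matrix_vector_mult_def sum_distrib_left mult_ac)
  qed
  have "transpose S = S"
    by (simp add: vec_eq_iff transpose_def flip: EXX) (simp add: mult.commute)
  moreover have "0 \<le> v \<bullet> (S *v v)" for v
  proof -
    have "0 \<le> (\<integral>\<omega>. ((v, 0) \<bullet> (X \<omega>, Y \<omega>))\<^sup>2 \<partial>M)" by (rule integral_nonneg_AE) simp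
    then show ?thesis unfolding quad by simp
  qed
  ultimately show S: "positive_definite S" using inv by (simp add: positive_definite_def)
  \<comment> \<open>The regression coefficients of Y on X. The direction (-y, 1) picks the residual
    Y - y . X, whose second moment is the noise variance; hence that number is nonnegative.\<close>
  define y where "y = matrix_inv S *v \<rho>"
  have Sy: "S *v y = \<rho>" by (simp add: y_def matrix_inv_mult[OF inv])
  have "S *v (- y) = - \<rho>"
    using matrix_vector_mult_scaleR[of S "-1" y] Sy by simp
  moreover have "0 \<le> (\<integral>\<omega>. ((- y, 1) \<bullet> (X \<omega>, Y \<omega>))\<^sup>2 \<partial>M)"
    by (rule integral_nonneg_AE) simp
  ultimately show v: "0 \<le> noise_variance S \<rho>"
    unfolding quad by (simp add: noise_variance_eq[OF S] flip: y_def) (simp add: inner_commute)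
  show "distr M borel (\<lambda>\<omega>. (X \<omega>, Y \<omega>)) = pair_law S \<rho>"
  proof (rule measure_eq_if_cos_eq)
    fix u :: "(real^'n) \<times> real" and c
    obtain p q where u: "u = (p, q)" by (cases u)
    show "(\<integral>x. cos (u \<bullet> x + c) \<partial>distr M borel (\<lambda>\<omega>. (X \<omega>, Y \<omega>))) = (\<integral>x. cos (u \<bullet> x + c) \<partial>pair_law S \<rho>)"
      unfolding u integral_cos_pair_law[OF S v] quad[symmetric]
      using proj(3)[OF E0, of p q c] by (subst integral_distr) (simp_all del: inner_Pair)
  qed (auto intro!: prob_space.finite_measure prob_space_distr prob_space_pair_law)
qed

section \<open>Successive stopping times\<close>

text \<open>The recursion of \<open>stop_time\<close> for arbitrary sets in an arbitrary space.
  Keeping the whole sequence of sets as an argument allows a restart with the shifted sequence after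
  the first hit.\<close>

primrec hit_time :: "(nat \<Rightarrow> 'a set) \<Rightarrow> (nat \<Rightarrow> 'a) \<Rightarrow> nat \<Rightarrow> nat" where
  "hit_time A w 0 = 0"
| "hit_time A w (Suc l) =
     (if \<exists>i > hit_time A w l. w i \<in> A (Suc l)
      then LEAST i. i > hit_time A w l \<and> w i \<in> A (Suc l) else 1)"

lemma stop_time_eq_hit_time: "stop_time e a b w l = hit_time (\<lambda>l. stop_set a b (e l)) w l"
  by (induction l) auto

lemma hit_time_comp: "hit_time A (\<lambda>i. f (w i)) l = hit_time (\<lambda>l. f -` A l) w l"
  by (induction l) auto

text \<open>Candidates lie strictly above the previous time, hence above 0, so position 0 is never
  inspected.\<close>

lemma hit_time_cong:
  assumes "\<And>i. 1 \<le> i \<Longrightarrow> w i = v i"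
  shows "hit_time A w l = hit_time A v l"
proof (induction l)
  case (Suc l)
  have "i > hit_time A v l \<and> w i \<in> A (Suc l) \<longleftrightarrow> i > hit_time A v l \<and> v i \<in> A (Suc l)" for i
    using assms[of i] by (cases i) auto
  then show ?case by (simp only: hit_time.simps Suc)
qed simp

text \<open>The default value 1 guarantees this even after a failed search, so a selected index
  always points to a genuine observation.\<close>

lemma hit_time_ge_1: "1 \<le> hit_time A w (Suc l)"
proof (cases "\<exists>i > hit_time A w l. w i \<in> A (Suc l)")
  case True
  then have "(LEAST i. i > hit_time A w l \<and> w i \<in> A (Suc l)) > hit_time A w l"
    by (metis (mono_tags, lifting) LeastI_ex)
  then show ?thesis using True by simp
next
  case False
  then show ?thesis unfolding hit_time.simps by (subst if_not_P) auto
qed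

declare hit_time.simps(2)[simp del]

lemma Least_shift:
  assumes "\<exists>i > n. w (Suc i) \<in> B"
  shows "(LEAST i. i > Suc n \<and> w i \<in> B) = Suc (LEAST i. i > n \<and> w (Suc i) \<in> (B::'a set))"
proof -
  obtain i where "i > n" "w (Suc i) \<in> B" using assms by blast
  then show ?thesis by (subst Least_Suc[of _ "Suc i"]) auto
qed

text \<open>The two cases of the renewal argument: the first observation is either discarded or it ends the
  first waiting time.\<close>

lemma hit_time_shift:
  fixes w :: "nat \<Rightarrow> 'a"
  assumes io: "\<And>l n. \<exists>i > n. w (Suc i) \<in> A (Suc l)"
  shows hit_time_shift_miss: "w 1 \<notin> A 1 \<Longrightarrow> hit_time A w (Suc l) = Suc (hit_time A (\<lambda>i. w (Suc i)) (Suc l))"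
    and hit_time_shift_hit: "w 1 \<in> A 1 \<Longrightarrow> hit_time A w (Suc l) = Suc (hit_time (\<lambda>i. A (Suc i)) (\<lambda>i. w (Suc i)) l)"
proof -
  have io': "\<exists>i > n. w i \<in> A (Suc l)" for n l
    using io[of n l] by (metis less_Suc_eq)
  have H: "hit_time A w (Suc l) = (LEAST i. i > hit_time A w l \<and> w i \<in> A (Suc l))" for l
    using io' by (simp add: hit_time.simps(2))
  have H': "hit_time A (\<lambda>i. w (Suc i)) (Suc l) = (LEAST i. i > hit_time A (\<lambda>i. w (Suc i)) l \<and> w (Suc i) \<in> A (Suc l))" for l
    using io by (simp add: hit_time.simps(2))
  have H'': "hit_time (\<lambda>i. A (Suc i)) (\<lambda>i. w (Suc i)) (Suc l) =
     (LEAST i. i > hit_time (\<lambda>i. A (Suc i)) (\<lambda>i. w (Suc i)) l \<and> w (Suc i) \<in> A (Suc (Suc l)))" for l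
    using io by (simp add: hit_time.simps(2))
  show "hit_time A w (Suc l) = Suc (hit_time A (\<lambda>i. w (Suc i)) (Suc l))" if "w 1 \<notin> A 1" for l
  proof (induction l)
    case 0
    obtain i where i: "i > 0" "w (Suc i) \<in> A (Suc 0)" using io by blast
    have "(LEAST i. i > 0 \<and> w i \<in> A (Suc 0)) = Suc (LEAST i. Suc i > 0 \<and> w (Suc i) \<in> A (Suc 0))"
      using i by (intro Least_Suc[of _ "Suc i"]) auto
    \<comment> \<open>The two predicates could differ only at i = 0, where both fail because
      observation 1 misses \<open>A 1\<close>.\<close>
    also have "(\<lambda>i. Suc i > 0 \<and> w (Suc i) \<in> A (Suc 0)) = (\<lambda>i. i > 0 \<and> w (Suc i) \<in> A (Suc 0))"
    proof
      fix i show "(Suc i > 0 \<and> w (Suc i) \<in> A (Suc 0)) = (i > 0 \<and> w (Suc i) \<in> A (Suc 0))"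
        using that by (cases i) auto
    qed
    finally show ?case unfolding H H' hit_time.simps(1) .
  next
    case (Suc l)
    show ?case unfolding H[of "Suc l"] Suc Least_shift[where w=w, OF io] H'[of "Suc l"] ..
  qed
  show "hit_time A w (Suc l) = Suc (hit_time (\<lambda>i. A (Suc i)) (\<lambda>i. w (Suc i)) l)" if "w 1 \<in> A 1" for l
  proof (induction l)
    case 0
    have "(LEAST i. i > 0 \<and> w i \<in> A (Suc 0)) = 1"
      using that by (intro Least_equality) auto
    then show ?case unfolding H hit_time.simps(1) by simp
  next
    case (Suc l)
    show ?case unfolding H[of "Suc l"] Suc Least_shift[where w=w, OF io] H''[of l] ..
  qed
qed

text \<open>The selected observations lie in prescribed targets. The probabilities of these events
  determine the joint law of the selection.\<close>

definition hits_in :: "(nat \<Rightarrow> 'a set) \<Rightarrow> (nat \<Rightarrow> 'a set) \<Rightarrow> nat \<Rightarrow> (nat \<Rightarrow> 'a) \<Rightarrow> bool" where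
  "hits_in A B d w \<longleftrightarrow> (\<forall>l<d. w (hit_time A w (Suc l)) \<in> B (Suc l))"

lemma hits_in_shift:
  assumes "\<And>l n. \<exists>i > n. w (Suc i) \<in> A (Suc l)"
  shows "w 1 \<notin> A 1 \<Longrightarrow> hits_in A B d w \<longleftrightarrow> hits_in A B d (\<lambda>i. w (Suc i))"
    and "w 1 \<in> A 1 \<Longrightarrow> hits_in A B (Suc d) w \<longleftrightarrow> w 1 \<in> B 1 \<and> hits_in (\<lambda>i. A (Suc i)) (\<lambda>i. B (Suc i)) d (\<lambda>i. w (Suc i))"
proof -
  show "hits_in A B d w \<longleftrightarrow> hits_in A B d (\<lambda>i. w (Suc i))" if "w 1 \<notin> A 1"
    unfolding hits_in_def hit_time_shift_miss[of w A, OF assms that] ..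
  show "hits_in A B (Suc d) w \<longleftrightarrow> w 1 \<in> B 1 \<and> hits_in (\<lambda>i. A (Suc i)) (\<lambda>i. B (Suc i)) d (\<lambda>i. w (Suc i))"
    if "w 1 \<in> A 1"
    unfolding hits_in_def All_less_Suc2 hit_time_shift_hit[of w A, OF assms that] by simp
qed
    
lemma hits_in_cong:
  assumes "\<And>i. 1 \<le> i \<Longrightarrow> w i = v i"
  shows "hits_in A B d w \<longleftrightarrow> hits_in A B d v"
proof -
  have "w (hit_time A w (Suc l)) = v (hit_time A v (Suc l))" for l
    using hit_time_cong[of w v A "Suc l", OF assms] assms[OF hit_time_ge_1] by simp
  then show ?thesis by (simp only: hits_in_def)
qed

lemma measurable_hit_time:
  assumes [measurable]: "\<And>l. A l \<in> sets M" "\<And>i. (\<lambda>x. w x i) \<in> measurable N M"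
  shows "(\<lambda>x. hit_time A (w x) l) \<in> measurable N (count_space UNIV)"
proof (induction l)
  case (Suc l)
  note [measurable] = this
  show ?case unfolding hit_time.simps by measurable
qed simp

lemma measurable_at_hit_time:
  assumes "\<And>l. A l \<in> sets M" "\<And>i. (\<lambda>x. w x i) \<in> measurable N M"
  shows "(\<lambda>x. w x (hit_time A (w x) l)) \<in> measurable N M"
  by (rule measurable_compose_countable[OF assms(2) measurable_hit_time[OF assms]])

context sequence_space
begin

text \<open>Missing the set at the m indices after n has probability (1 - measure M A)^m, which
  vanishes as m grows.\<close>

lemma AE_infinitely_often:
  assumes A: "A \<in> sets M" and pos: "0 < measure M A"
  shows "AE \<omega> in S. \<forall>n. \<exists>i>n. \<omega> i \<in> A"
proof -
  have "AE \<omega> in S. \<exists>i>n. \<omega> i \<in> A" for n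
  proof -
    let ?N = "{\<omega>\<in>space S. \<not> (\<exists>i>n. \<omega> i \<in> A)}"
    note [measurable] = A
    have "P.prob ?N \<le> (1 - measure M A) ^ m" for m
    proof -
      have "P.prob ?N \<le> P.prob {\<omega>\<in>space S. \<forall>i\<in>{Suc n..<Suc n + m}. \<omega> i \<in> space M - A}"
        by (rule P.finite_measure_mono) (force simp: space_PiM PiE_iff, measurable)
      also have "\<dots> = (\<Prod>i\<in>{Suc n..<Suc n + m}. measure M (space M - A))"
        using emeasure_PiM_Collect[of "{Suc n..<Suc n + m}" "\<lambda>_. space M - A"] A
        by (simp add: P.emeasure_eq_measure M.emeasure_eq_measure ennreal_power)
      also have "\<dots> = (1 - measure M A) ^ m" using A by (simp add: M.prob_compl)
      finally show ?thesis .
    qed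
    moreover have "(\<lambda>m. (1 - measure M A) ^ m) \<longlonglongrightarrow> 0"
      using pos by (intro LIMSEQ_realpow_zero) auto
    ultimately have "P.prob ?N \<le> 0"
      by (intro LIMSEQ_le_const) auto
    then have "P.prob ?N = 0" by (simp add: measure_le_0_iff)
    then show ?thesis
      by (intro AE_I[of _ _ ?N]) (auto simp: P.emeasure_eq_measure)
  qed
  then show ?thesis by (simp add: AE_all_countable)
qed

text \<open>Each selected observation is distributed as a sample conditioned on its stopping set,
  and different selections are independent. Conditioning on the first observation gives a linear
  equation for the probability instead of a sum over all values of the stopping times. The sequence
  space is indexed from 0 while stopping times start at 1, hence the argument i - 1.\<close>

lemma prob_hits_in:
  assumes "\<And>l. A l \<in> sets M" "\<And>l. B l \<in> sets M" "\<And>l. 0 < measure M (A l)"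
  shows "P.prob {\<omega>\<in>space S. hits_in A B d (\<lambda>i. \<omega> (i - 1))} = (\<Prod>l<d. measure M (A (Suc l) \<inter> B (Suc l)) / measure M (A (Suc l)))"
  using assms
proof (induction d arbitrary: A B)
  case 0
  then show ?case by (simp add: hits_in_def P.prob_space)
next
  case (Suc d)
  note [measurable] = Suc.prems(1,2)
  interpret MS: pair_prob_space M S ..
  have meas: "Measurable.pred S (\<lambda>\<omega>. hits_in A B d (\<lambda>i. \<omega> (i - 1)))" if [measurable]: "\<And>l. A l \<in> sets M" "\<And>l. B l \<in> sets M" for A B d
  proof -
    have [measurable]: "(\<lambda>\<omega>. \<omega> (hit_time A (\<lambda>i. \<omega> (i - 1)) l - 1)) \<in> measurable S M" for l
      by (rule measurable_at_hit_time[where w="\<lambda>\<omega> i. \<omega> (i - 1)"]) measurable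
    show ?thesis unfolding hits_in_def by measurable
  qed
  let ?E = "{\<omega>\<in>space S. hits_in A B (Suc d) (\<lambda>i. \<omega> (i - 1))}"
  let ?E' = "{\<omega>\<in>space S. hits_in (\<lambda>i. A (Suc i)) (\<lambda>i. B (Suc i)) d (\<lambda>i. \<omega> (i - 1))}"
  note [measurable] = meas[of A B] meas[of "\<lambda>i. A (Suc i)" "\<lambda>i. B (Suc i)"]
  have E[measurable]: "?E \<in> sets S" "?E' \<in> sets S" 
    using predE[OF meas[of A B "Suc d"]] predE[OF meas[of "\<lambda>i. A (Suc i)" "\<lambda>i. B (Suc i)" d]] Suc.prems by blast+
  \<comment> \<open>An iid sequence is an independent pair of its head and its tail.\<close>
  have "P.prob ?E = measure (distr (M \<Otimes>\<^sub>M S) S (\<lambda>(s, \<omega>). case_nat s \<omega>)) ?E"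
    by (simp only: PiM_iter)
  also have "\<dots> = MS.prob {x\<in>space (M \<Otimes>\<^sub>M S). case_nat (fst x) (snd x) \<in> ?E}"
    using E(1) by (subst measure_distr) (auto simp: case_prod_beta vimage_def intro!: arg_cong[where f="MS.prob"])
  \<comment> \<open>A miss leaves the same event for the tail; a hit must fall in \<open>B 1\<close>
    and leaves the event with shifted sets. The equality holds only almost everywhere, namely where
    every stopping set recurs forever in the tail.\<close>
  also have "\<dots> = MS.prob ((space M - A 1) \<times> ?E \<union> (A 1 \<inter> B 1) \<times> ?E')"
  proof (rule MS.finite_measure_eq_AE)
    have "AE \<omega> in S. \<forall>l n. \<exists>i>n. \<omega> i \<in> A (Suc l)"
      using AE_infinitely_often[OF Suc.prems(1,3)] by (simp add: AE_all_countable)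
    then have "AE x in M \<Otimes>\<^sub>M S. \<forall>l n. \<exists>i>n. snd x i \<in> A (Suc l)"
      by (intro MS.AE_pair_measure) (auto simp: pred_def)
    then show "AE x in M \<Otimes>\<^sub>M S. (x \<in> {x\<in>space (M \<Otimes>\<^sub>M S). case_nat (fst x) (snd x) \<in> ?E}) = 
      (x \<in> (space M - A 1) \<times> ?E \<union> (A 1 \<inter> B 1) \<times> ?E')"
    proof (eventually_elim)
      case (elim x)
      obtain s \<omega> where x: "x = (s, \<omega>)" by (cases x)
      define w where "w i = case_nat s \<omega> (i - 1)" for i
      have w1: "w 1 = s" by (simp add: w_def)
      have io: "\<exists>i > n. w (Suc i) \<in> A (Suc l)" for l n
      proof -
        obtain i where "i > n" "\<omega> i \<in> A (Suc l)" using elim x by auto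
        then show ?thesis by (intro exI[of _ "Suc i"]) (auto simp: w_def)
      qed
      have shift: "hits_in A B d (\<lambda>i. w (Suc i)) \<longleftrightarrow> hits_in A B d (\<lambda>i. \<omega> (i - 1))" for A B d
        by (rule hits_in_cong) (auto simp: w_def split: nat.split)
      have "A 1 \<subseteq> space M" using Suc.prems(1) sets.sets_into_space by blast
      moreover have "s \<in> space M \<and> \<omega> \<in> space S \<Longrightarrow> case_nat s \<omega> \<in> space S"
        by (auto simp: space_PiM PiE_iff split: nat.split)
      ultimately show ?case
        using hits_in_shift[of w A, OF io, of B] unfolding shift w1
        unfolding x mem_Collect_eq fst_conv snd_conv w_def[abs_def, symmetric]
        by (auto simp: space_pair_measure)
    qed
  qed measurable
  also have "\<dots> = MS.prob ((space M - A 1) \<times> ?E) + MS.prob ((A 1 \<inter> B 1) \<times> ?E')"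
    by (intro MS.finite_measure_Union pair_measureI E sets.Diff sets.Int sets.top Suc.prems) auto
  also have "\<dots> = (1 - measure M (A 1)) * P.prob ?E + measure M (A 1 \<inter> B 1) * P.prob ?E'"
    using Suc.prems
    by (simp add: measure_def[of "M \<Otimes>\<^sub>M S"] P.emeasure_pair_measure_Times E[simplified] enn2real_mult sets.Diff sets.Int
      flip: measure_def M.prob_compl)
  \<comment> \<open>\<open>?E\<close> occurs on both sides because a miss restarts the same problem;
    collecting its terms leaves the factor \<open>measure M (A 1)\<close>.\<close>
  finally have "P.prob ?E * measure M (A 1) = measure M (A 1 \<inter> B 1) * P.prob ?E'"
    by (simp add: algebra_simps)
  then have "P.prob ?E = measure M (A 1 \<inter> B 1) / measure M (A 1) * P.prob ?E'"
    using Suc.prems(3)[of 1] by (simp add: field_simps)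
  also have "P.prob ?E' = (\<Prod>l<d. measure M (A (Suc (Suc l)) \<inter> B (Suc (Suc l))) / measure M (A (Suc (Suc l))))"
    using Suc.prems by (intro Suc.IH) auto
  finally show ?case by (simp add: prod.lessThan_Suc_shift del: prod.lessThan_Suc)
qed

end

text \<open>Bridges two conventions: the renewal argument lives on sequences indexed from 0, the
  observations are numbered from 1. The map f lets standard Gaussian pairs generate the model
  observations at the same time.\<close>

lemma distr_PiM_shift_index:
  assumes "prob_space M" and f[measurable]: "f \<in> measurable M N"
  shows "distr (PiM UNIV (\<lambda>_::nat. M)) (PiM {1..} (\<lambda>_. distr M N f)) (\<lambda>\<omega>. \<lambda>i\<in>{1..}. f (\<omega> (i - 1))) =
    PiM {1..} (\<lambda>_. distr M N f)"
proof -
  interpret M: prob_space M by fact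
  interpret S: product_prob_space "\<lambda>_. M" "UNIV :: nat set" by unfold_locales
  interpret D: prob_space "distr M N f" by (rule M.prob_space_distr) simp
  interpret T: product_prob_space "\<lambda>_. distr M N f" "{1::nat..}" by unfold_locales
  show ?thesis
  proof (rule T.PiM_eq)
    fix J and F :: "nat \<Rightarrow> 'b set"
    assume J: "finite J" "J \<subseteq> {1..}" "\<And>j. j \<in> J \<Longrightarrow> F j \<in> sets (distr M N f)"
    let ?g = "\<lambda>\<omega>. \<lambda>i\<in>{1..}. f (\<omega> (i - 1 :: nat))"
    have inj: "inj_on (\<lambda>j. j - 1) J"
      using J(2) by (auto simp: inj_on_def subset_eq) (metis One_nat_def Suc_le_eq Suc_pred)
    have [measurable]: "?g \<in> measurable (PiM UNIV (\<lambda>_::nat. M)) (PiM {1..} (\<lambda>_. distr M N f))"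
      by (intro measurable_restrict) simp
    have "emeasure (distr (PiM UNIV (\<lambda>_::nat. M)) (PiM {1..} (\<lambda>_. distr M N f)) ?g) (prod_emb {1..} (\<lambda>_. distr M N f) J (Pi\<^sub>E J F)) =
      emeasure (PiM UNIV (\<lambda>_::nat. M)) (?g -` prod_emb {1..} (\<lambda>_. distr M N f) J (Pi\<^sub>E J F) \<inter> space (PiM UNIV (\<lambda>_::nat. M)))"
      using J by (intro emeasure_distr) (auto intro!: sets_PiM_I)
    also have "?g -` prod_emb {1..} (\<lambda>_. distr M N f) J (Pi\<^sub>E J F) \<inter> space (PiM UNIV (\<lambda>_::nat. M)) =
       {\<omega>\<in>space (PiM UNIV (\<lambda>_::nat. M)). \<forall>i\<in>(\<lambda>j. j - 1) ` J. \<omega> i \<in> f -` F (Suc i) \<inter> space M}"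
      using J(2) measurable_space[OF f]
      by (auto simp: prod_emb_def space_PiM PiE_iff subset_eq Suc_le_eq)
    also have "emeasure (PiM UNIV (\<lambda>_::nat. M)) \<dots> = (\<Prod>i\<in>(\<lambda>j. j - 1) ` J. emeasure M (f -` F (Suc i) \<inter> space M))"
      using J by (intro S.emeasure_PiM_Collect) (auto intro!: measurable_sets[OF f])
    also have "\<dots> = (\<Prod>j\<in>J. emeasure (distr M N f) (F j))"
      unfolding prod.reindex[OF inj] using J
      by (intro prod.cong) (auto simp: emeasure_distr subset_eq)
    finally show "emeasure (distr (PiM UNIV (\<lambda>_::nat. M)) (PiM {1..} (\<lambda>_. distr M N f)) ?g) (prod_emb {1..} (\<lambda>_. distr M N f) J (Pi\<^sub>E J F)) =
       (\<Prod>j\<in>J. emeasure (distr M N f) (F j))" .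
  qed simp
qed

section \<open>The law of the stopped observations\<close>

lemma borel_measurable_vec_lambda[measurable (raw)]:
  fixes f :: "'x \<Rightarrow> 'n::finite \<Rightarrow> 'a::euclidean_space"
  assumes "\<And>i. (\<lambda>x. f x i) \<in> borel_measurable M"
  shows "(\<lambda>x. \<chi> i. f x i) \<in> borel_measurable M"
  using assms unfolding borel_measurable_euclidean_space[where f="\<lambda>x. \<chi> i. f x i"]
  by (auto simp: Basis_vec_def inner_axis)

lemma borel_measurable_vec_nth'[measurable (raw)]:
  fixes f :: "'x \<Rightarrow> 'a::euclidean_space^'n"
  assumes [measurable]: "f \<in> borel_measurable M"
  shows "(\<lambda>x. f x $ i) \<in> borel_measurable M"
proof -
  have "(\<lambda>x::'a^'n. x $ i) \<in> borel_measurable borel"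
    by (intro borel_measurable_continuous_onI continuous_intros)
  then show ?thesis by measurable
qed

section \<open>Integrals of products over vector and matrix entries\<close>

lemma prod_Basis_vec:
  "(\<Prod>b\<in>(Basis::('a::euclidean_space^'n) set). g b) = (\<Prod>i\<in>UNIV. \<Prod>b\<in>Basis. g (axis i b))"
proof -
  let ?h = "\<lambda>x::'n \<times> 'a. axis (fst x) (snd x)"
  have inj: "inj_on ?h (UNIV \<times> Basis)"
    by (auto simp: inj_on_def axis_eq_axis nonzero_Basis)
  have "(Basis::('a^'n) set) = ?h ` (UNIV \<times> Basis)"
    unfolding Basis_vec_def by (force simp: image_iff)
  then have "(\<Prod>b\<in>(Basis::('a^'n) set). g b) = prod g (?h ` (UNIV \<times> Basis))"
    by (rule arg_cong)
  also have "\<dots> = (\<Prod>x\<in>UNIV \<times> Basis. g (?h x))"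
    by (subst prod.reindex[OF inj]) (simp add: o_def)
  also have "\<dots> = (\<Prod>i\<in>UNIV. \<Prod>b\<in>Basis. g (axis i b))"
    by (simp add: prod.cartesian_product split_def)
  finally show ?thesis .
qed

lemma lborel_vec_prod:
  fixes f :: "'n::finite \<Rightarrow> real \<Rightarrow> ennreal" and g :: "'n \<Rightarrow> real \<Rightarrow> real"
  shows nn_integral_lborel_vec: "(\<And>i. f i \<in> borel_measurable borel) \<Longrightarrow>
      (\<integral>\<^sup>+x. (\<Prod>i\<in>UNIV. f i (x $ i)) \<partial>(lborel :: (real^'n) measure)) = (\<Prod>i\<in>UNIV. \<integral>\<^sup>+x. f i x \<partial>lborel)"
    and integrable_lborel_vec: "(\<And>i. integrable lborel (g i)) \<Longrightarrow>
      integrable (lborel :: (real^'n) measure) (\<lambda>x. \<Prod>i\<in>UNIV. g i (x $ i))"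
    and integral_lborel_vec: "(\<And>i. integrable lborel (g i)) \<Longrightarrow>
      (\<integral>x. (\<Prod>i\<in>UNIV. g i (x $ i)) \<partial>(lborel :: (real^'n) measure)) = (\<Prod>i\<in>UNIV. \<integral>x. g i x \<partial>lborel)"
proof -
  define k where "k = inv (\<lambda>i::'n. axis i (1::real))"
  have k: "k (axis i 1) = i" for i
    unfolding k_def by (rule inv_f_f) (auto simp: inj_on_def axis_eq_axis)
  show "(\<integral>\<^sup>+x. (\<Prod>i\<in>UNIV. f i (x $ i)) \<partial>(lborel :: (real^'n) measure)) = (\<Prod>i\<in>UNIV. \<integral>\<^sup>+x. f i x \<partial>lborel)"
    if "\<And>i. f i \<in> borel_measurable borel"
    using nn_integral_lborel_prod[of "\<lambda>b::real^'n. f (k b)"] that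
    by (simp add: prod_Basis_vec k inner_axis)
  show "integrable (lborel :: (real^'n) measure) (\<lambda>x. \<Prod>i\<in>UNIV. g i (x $ i))"
       "(\<integral>x. (\<Prod>i\<in>UNIV. g i (x $ i)) \<partial>(lborel :: (real^'n) measure)) = (\<Prod>i\<in>UNIV. \<integral>x. g i x \<partial>lborel)"
    if "\<And>i. integrable lborel (g i)"
    using integral_lborel_prod[of "\<lambda>b::real^'n. g (k b)"] that
    by (simp_all add: prod_Basis_vec k inner_axis)
qed

lemma lborel_matrix_prod:
  fixes f :: "'n::finite \<Rightarrow> 'm::finite \<Rightarrow> real \<Rightarrow> ennreal" and g :: "'n \<Rightarrow> 'm \<Rightarrow> real \<Rightarrow> real"
  shows nn_integral_lborel_matrix: "(\<And>i l. f i l \<in> borel_measurable borel) \<Longrightarrow>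
      (\<integral>\<^sup>+x. (\<Prod>i\<in>UNIV. \<Prod>l\<in>UNIV. f i l (x $ i $ l)) \<partial>(lborel :: (real^'m^'n) measure)) =
      (\<Prod>i\<in>UNIV. \<Prod>l\<in>UNIV. \<integral>\<^sup>+x. f i l x \<partial>lborel)"
    and integrable_lborel_matrix: "(\<And>i l. integrable lborel (g i l)) \<Longrightarrow>
      integrable (lborel :: (real^'m^'n) measure) (\<lambda>x. \<Prod>i\<in>UNIV. \<Prod>l\<in>UNIV. g i l (x $ i $ l))"
    and integral_lborel_matrix: "(\<And>i l. integrable lborel (g i l)) \<Longrightarrow>
      (\<integral>x. (\<Prod>i\<in>UNIV. \<Prod>l\<in>UNIV. g i l (x $ i $ l)) \<partial>(lborel :: (real^'m^'n) measure)) =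
      (\<Prod>i\<in>UNIV. \<Prod>l\<in>UNIV. \<integral>x. g i l x \<partial>lborel)"
proof -
  define k where "k = inv (\<lambda>(i::'n, l::'m). axis i (axis l (1::real)))"
  have k: "k (axis i (axis l 1)) = (i, l)" for i l
  proof -
    have "inj (\<lambda>(i::'n, l::'m). axis i (axis l (1::real)))"
      by (auto simp: inj_on_def axis_eq_axis axis_eq_0_iff)
    then show ?thesis unfolding k_def using inv_f_f[of _ "(i, l)"] by fastforce
  qed
  show "(\<integral>\<^sup>+x. (\<Prod>i\<in>UNIV. \<Prod>l\<in>UNIV. f i l (x $ i $ l)) \<partial>(lborel :: (real^'m^'n) measure)) =
      (\<Prod>i\<in>UNIV. \<Prod>l\<in>UNIV. \<integral>\<^sup>+x. f i l x \<partial>lborel)"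
    if "\<And>i l. f i l \<in> borel_measurable borel"
    using nn_integral_lborel_prod[of "\<lambda>b::real^'m^'n. f (fst (k b)) (snd (k b))"] that
    by (simp add: prod_Basis_vec k inner_axis)
  show "integrable (lborel :: (real^'m^'n) measure) (\<lambda>x. \<Prod>i\<in>UNIV. \<Prod>l\<in>UNIV. g i l (x $ i $ l))"
      "(\<integral>x. (\<Prod>i\<in>UNIV. \<Prod>l\<in>UNIV. g i l (x $ i $ l)) \<partial>(lborel :: (real^'m^'n) measure)) =
      (\<Prod>i\<in>UNIV. \<Prod>l\<in>UNIV. \<integral>x. g i l x \<partial>lborel)"
    if "\<And>i l. integrable lborel (g i l)"
    using integral_lborel_prod[of "\<lambda>b::real^'m^'n. g (fst (k b)) (snd (k b))"] that
    by (simp_all add: prod_Basis_vec k inner_axis)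
qed

lemma gaussian_density_vec: "gaussian_density (x :: real^'n) = (\<Prod>i\<in>UNIV. std_normal_density (x $ i))"
  by (simp add: prod_Basis_vec inner_axis)

lemma emeasure_std_gaussian_rect:
  assumes [measurable]: "\<And>i. A i \<in> sets borel"
  shows "emeasure (std_gaussian :: (real^'n) measure) {x. \<forall>i. x $ i \<in> A i} = (\<Prod>i\<in>UNIV. emeasure std_normal_distribution (A i))"
proof -
  have "emeasure (std_gaussian :: (real^'n) measure) {x. \<forall>i. x $ i \<in> A i} =
     (\<integral>\<^sup>+x. (\<Prod>i\<in>UNIV. ennreal (std_normal_density (x $ i)) * indicator (A i) (x $ i)) \<partial>(lborel :: (real^'n) measure))"
    unfolding std_gaussian_def gaussian_density_vec
    by (subst emeasure_density)
       (auto intro!: nn_integral_cong simp: prod_ennreal[symmetric] prod.distrib indicator_def prod_zero_iff)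
  also have "\<dots> = (\<Prod>i\<in>UNIV. emeasure std_normal_distribution (A i))"
    by (subst nn_integral_lborel_vec) (auto simp: emeasure_density)
  finally show ?thesis .
qed

text \<open>The Gaussian density of a pair factors because the basis of a product space is the
  disjoint union of the two embedded bases.\<close>

lemma pair_std_gaussian:
  "(std_gaussian :: 'a::euclidean_space measure) \<Otimes>\<^sub>M (std_gaussian :: 'b::euclidean_space measure) = std_gaussian"
proof -
  have "sigma_finite_measure (std_gaussian :: 'b measure)"
    by (intro prob_space_imp_sigma_finite prob_space_std_gaussian)
  then have "(std_gaussian :: 'a measure) \<Otimes>\<^sub>M (std_gaussian :: 'b measure) =
     density (lborel \<Otimes>\<^sub>M lborel) (\<lambda>(x, y). ennreal (gaussian_density x) * ennreal (gaussian_density y))"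
    unfolding std_gaussian_def by (intro pair_measure_density) (auto intro: lborel.sigma_finite_measure_axioms)
  also have "(\<lambda>(x::'a, y::'b). ennreal (gaussian_density x) * ennreal (gaussian_density y)) = (\<lambda>z. ennreal (gaussian_density z))"
  proof (clarify intro!: ext)
    fix x :: 'a and y :: 'b
    have "gaussian_density (x, y) = gaussian_density x * gaussian_density y"
      unfolding Basis_prod_def
      by (subst prod.union_disjoint) (auto simp: prod.reindex inj_on_def nonzero_Basis)
    then show "ennreal (gaussian_density x) * ennreal (gaussian_density y) = ennreal (gaussian_density (x, y))"
      by (simp add: ennreal_mult prod_nonneg)
  qed
  finally show ?thesis by (simp add: lborel_prod std_gaussian_def)
qed

lemma std_gaussian_real: "(std_gaussian :: real measure) = std_normal_distribution"
  by (simp add: std_gaussian_def)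

section \<open>The law of the stopped matrix\<close>

definition entry_set :: "real \<Rightarrow> real \<Rightarrow> 'n \<Rightarrow> 'n \<Rightarrow> real set" where
  "entry_set a b i l = (if i = l then {x. a < \<bar>x\<bar>} else {x. \<bar>x\<bar> < b})"

lemma sets_entry_set[measurable]: "entry_set a b i l \<in> sets borel"
  by (simp add: entry_set_def)

lemma stop_set_eq: "stop_set a b l = {w. \<forall>i. w $ i \<in> entry_set a b i l}"
  by (auto simp: stop_set_def entry_set_def)

lemma measure_std_normal_pos:
  assumes A[measurable]: "A \<in> sets borel" and uv: "u < v" "{u<..<v} \<subseteq> A"
  shows "0 < measure std_normal_distribution A"
proof -
  interpret prob_space std_normal_distribution by (rule prob_space_normal_density) simp
  have "emeasure std_normal_distribution {u<..<v} \<noteq> 0"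
  proof
    assume "emeasure std_normal_distribution {u<..<v} = 0"
    then have "{u<..<v} \<in> null_sets std_normal_distribution" by auto
    then have "AE x in lborel. x \<in> {u<..<v} \<longrightarrow> std_normal_density x = 0"
      by (subst (asm) null_sets_density_iff) auto
    then have "AE x in lborel. x \<notin> {u<..<v}"
      using normal_density_pos[of 1 0] by (auto simp: less_le)
    then have "emeasure lborel {x. u < x \<and> x < v} = 0"
      by (subst (asm) AE_iff_measurable[OF _ refl]) auto
    moreover have "{x. u < x \<and> x < v} = {u<..<v}" by auto
    ultimately show False using uv by simp
  qed
  moreover have "emeasure std_normal_distribution {u<..<v} \<le> emeasure std_normal_distribution A"
    using uv by (intro emeasure_mono) auto
  ultimately show ?thesis by (auto simp: emeasure_eq_measure zero_less_measure_iff measure_le_0_iff)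
qed

lemma measure_entry_set_pos:
  assumes "0 < b"
  shows "0 < measure std_normal_distribution (entry_set a b i l)"
proof (cases "i = l")
  case True
  then have "{\<bar>a\<bar><..<\<bar>a\<bar> + 1} \<subseteq> entry_set a b i l" by (auto simp: entry_set_def)
  then show ?thesis by (intro measure_std_normal_pos[of _ "\<bar>a\<bar>" "\<bar>a\<bar> + 1"]) auto
next
  case False
  then have "{0<..<b} \<subseteq> entry_set a b i l" by (auto simp: entry_set_def)
  then show ?thesis using assms by (intro measure_std_normal_pos[of _ 0 b]) auto
qed

text \<open>Density of a standard normal variable conditioned on its entry set; i is the row and l
  the column, so column l comes from the stopping set with label l.\<close>

definition entry_density :: "real \<Rightarrow> real \<Rightarrow> 'n \<Rightarrow> 'n \<Rightarrow> real \<Rightarrow> real" where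
  "entry_density a b i l x =
     indicator (entry_set a b i l) x * std_normal_density x / measure std_normal_distribution (entry_set a b i l)"

definition matrix_density :: "real \<Rightarrow> real \<Rightarrow> real^'n^'n \<Rightarrow> real" where
  "matrix_density a b W = (\<Prod>i\<in>UNIV. \<Prod>l\<in>UNIV. entry_density a b i l (W $ i $ l))"

definition matrix_law :: "real \<Rightarrow> real \<Rightarrow> (real^'n^'n) measure" where
  "matrix_law a b = density lborel (\<lambda>W. ennreal (matrix_density a b W))"

lemma measurable_entry_density[measurable]: "entry_density a b i l \<in> borel_measurable borel"
  unfolding entry_density_def by measurable

lemma measurable_matrix_density[measurable]: "matrix_density a b \<in> borel_measurable borel"
  unfolding matrix_density_def by measurable

lemma entry_density_nonneg[simp]: "0 \<le> entry_density a b i l x"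
  by (simp add: entry_density_def)

lemma matrix_density_nonneg[simp]: "0 \<le> matrix_density a b W"
  unfolding matrix_density_def by (intro prod_nonneg) simp

lemma sets_matrix_law[simp, measurable_cong]: "sets (matrix_law a b) = sets borel"
  and space_matrix_law[simp]: "space (matrix_law a b) = UNIV"
  by (simp_all add: matrix_law_def)

lemma nn_integral_entry_density:
  assumes [measurable]: "A \<in> sets borel" and "0 < b"
  shows "(\<integral>\<^sup>+x. ennreal (entry_density a b i l x) * indicator A x \<partial>lborel) =
     ennreal (measure std_normal_distribution (entry_set a b i l \<inter> A) / measure std_normal_distribution (entry_set a b i l))"
proof -
  interpret prob_space std_normal_distribution by (rule prob_space_normal_density) simp
  let ?E = "entry_set a b i l"
  have "(\<integral>\<^sup>+x. ennreal (entry_density a b i l x) * indicator A x \<partial>lborel) =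
     (\<integral>\<^sup>+x. ennreal (1 / measure std_normal_distribution ?E) * (ennreal (std_normal_density x) * indicator (?E \<inter> A) x) \<partial>lborel)"
    by (intro nn_integral_cong) (auto simp: entry_density_def indicator_def ennreal_mult[symmetric])
  also have "\<dots> = ennreal (1 / measure std_normal_distribution ?E) * emeasure std_normal_distribution (?E \<inter> A)"
    by (simp add: nn_integral_cmult emeasure_density)
  finally show ?thesis by (simp add: emeasure_eq_measure ennreal_mult[symmetric])
qed

lemma emeasure_matrix_law_rect:
  assumes [measurable]: "\<And>i l. A i l \<in> sets borel" and b: "0 < b"
  shows "emeasure (matrix_law a b) {W. \<forall>i l. W $ i $ l \<in> A i l} =
     (\<Prod>i\<in>UNIV. \<Prod>l\<in>UNIV. ennreal (measure std_normal_distribution (entry_set a b i l \<inter> A i l) / measure std_normal_distribution (entry_set a b i l)))"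
proof -
  have "emeasure (matrix_law a b) {W. \<forall>i l. W $ i $ l \<in> A i l} =
     (\<integral>\<^sup>+W. (\<Prod>i\<in>UNIV. \<Prod>l\<in>UNIV. ennreal (entry_density a b i l (W $ i $ l)) * indicator (A i l) (W $ i $ l)) \<partial>lborel)"
    unfolding matrix_law_def matrix_density_def
    by (subst emeasure_density)
       (auto intro!: nn_integral_cong simp: prod_ennreal[symmetric] prod_nonneg prod.distrib indicator_def prod_zero_iff)
  also have "\<dots> = (\<Prod>i\<in>UNIV. \<Prod>l\<in>UNIV. \<integral>\<^sup>+x. ennreal (entry_density a b i l x) * indicator (A i l) x \<partial>lborel)"
    by (rule nn_integral_lborel_matrix) measurable
  finally show ?thesis using b by (simp add: nn_integral_entry_density)
qed

lemma prob_space_matrix_law: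
  assumes "0 < b"
  shows "prob_space (matrix_law a b :: (real^'n^'n) measure)"
proof
  have "measure std_normal_distribution (entry_set a b i l) \<noteq> 0" for i l :: 'n
    using measure_entry_set_pos[OF assms, of a i l] by simp
  then show "emeasure (matrix_law a b :: (real^'n^'n) measure) (space (matrix_law a b)) = 1"
    using emeasure_matrix_law_rect[of "\<lambda>(_::'n) (_::'n). UNIV", OF _ assms, of a] by simp
qed

lemma borel_measurable_fst_snd[measurable]:
  shows borel_measurable_fst: "fst \<in> borel_measurable (borel :: ('a::euclidean_space \<times> 'b::euclidean_space) measure)"
    and borel_measurable_snd: "snd \<in> borel_measurable (borel :: ('a::euclidean_space \<times> 'b::euclidean_space) measure)"
  by (intro borel_measurable_continuous_onI continuous_intros)+

lemma stopping_index_ge_1: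
  fixes e :: "nat \<Rightarrow> 'n::finite"
  assumes "bij_betw e {1..CARD('n)} UNIV"
  obtains m where "inv_into {1..CARD('n)} e l = Suc m" "m < CARD('n)" "e (Suc m) = l"
proof -
  have "l \<in> e ` {1..CARD('n)}" using assms by (simp add: bij_betw_def)
  then have "inv_into {1..CARD('n)} e l \<in> {1..CARD('n)}" "e (inv_into {1..CARD('n)} e l) = l"
    by (rule inv_into_into, rule f_inv_into_f)
  then show thesis using that[of "inv_into {1..CARD('n)} e l - 1"] by (auto simp: Suc_le_eq)
qed

lemma stop_index_ge_1:
  fixes e :: "nat \<Rightarrow> 'n::finite"
  assumes "bij_betw e {1..CARD('n)} UNIV"
  shows "1 \<le> stop_index e a b w l"
  using stopping_index_ge_1[OF assms, of l] hit_time_ge_1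
  unfolding stop_index_def stop_time_eq_hit_time by metis

lemma stopping_statistic_cong:
  fixes e :: "nat \<Rightarrow> 'n::finite" and S :: "real^'n^'n"
  assumes e: "bij_betw e {1..CARD('n)} UNIV" and "\<And>i. 1 \<le> i \<Longrightarrow> x i = x' i" "\<And>i. 1 \<le> i \<Longrightarrow> y i = y' i"
  shows "stopping_statistic S e a b x y = stopping_statistic S e a b x' y'"
proof -
  have "stop_index e a b (\<lambda>i. whiten S (x i)) l = stop_index e a b (\<lambda>i. whiten S (x' i)) l" for l
    unfolding stop_index_def stop_time_eq_hit_time using assms(2) by (intro hit_time_cong) simp
  then show ?thesis
    using assms(2,3) stop_index_ge_1[OF e]
    by (simp add: stopping_statistic_def stopped_matrix_def stopped_row_def Let_def)
qed

text \<open>Outside \<open>I\<close> the extensional functions are constantly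
  \<open>undefined\<close>, so those coordinates are measurable as well. This covers index 0, which
  the measurability of hitting times also quantifies over.\<close>

lemma measurable_PiM_any_component:
  assumes "space N = UNIV"
  shows "(\<lambda>s. s i) \<in> measurable (PiM I (\<lambda>_. N)) N"
proof (cases "i \<in> I")
  case False
  then have "(\<lambda>s. s i) \<in> measurable (PiM I (\<lambda>_. N)) N \<longleftrightarrow> (\<lambda>s. undefined) \<in> measurable (PiM I (\<lambda>_. N)) N"
    by (intro measurable_cong) (auto simp: space_PiM PiE_def extensional_def)
  then show ?thesis using assms by simp
qed simp

lemma measurable_whiten[measurable]: "whiten (S :: real^'n^'n) \<in> borel_measurable borel"
  unfolding whiten_def[abs_def]
  by (intro borel_measurable_continuous_onI linear_continuous_on matrix_vector_mul_bounded_linear)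

lemma sets_stop_set[measurable]: "stop_set a b l \<in> sets borel"
  unfolding stop_set_eq by measurable

lemma measurable_stopping_statistic:
  fixes e :: "nat \<Rightarrow> 'n::finite" and S :: "real^'n^'n"
  assumes [measurable]: "\<And>i. (\<lambda>s. x s i) \<in> borel_measurable M" "\<And>i. (\<lambda>s. y s i) \<in> borel_measurable M"
  shows "(\<lambda>s. stopping_statistic S e a b (x s) (y s)) \<in> borel_measurable M"
proof -
  have [measurable]: "(\<lambda>s. stop_index e a b (\<lambda>i. whiten S (x s i)) l) \<in> measurable M (count_space UNIV)" for l
    unfolding stop_index_def stop_time_eq_hit_time
    by (rule measurable_hit_time[where M=borel]) measurable
  show ?thesis
    unfolding stopping_statistic_def stopped_matrix_def stopped_row_def Let_def
    by measurable
qed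

text \<open>The regression Y = u . W + \<sigma> Z applied to all selected columns at once. It
  carries the entire dependence on r: the matrix law and the noise law are the same for every
  r.\<close>

definition shift_map :: "real^'n^'n \<Rightarrow> real^'n \<Rightarrow> (real^'n^'n) \<times> (real^'n) \<Rightarrow> (real^'n^'n) \<times> (real^'n)" where
  "shift_map S r = (\<lambda>(W, z). (W, (matrix_inv (matrix_sqrt S) *v r) v* W + sqrt (noise_variance S r) *\<^sub>R z))"

lemma measurable_shift_map[measurable]: "shift_map (S :: real^'n^'n) r \<in> borel_measurable borel"
proof -
  have "continuous_on UNIV (\<lambda>W::real^'n^'n. u v* W)" for u :: "real^'n"
    unfolding vector_matrix_mult_def by (intro continuous_intros)
  then have "continuous_on UNIV (\<lambda>x::(real^'n^'n) \<times> (real^'n). u v* fst x)" for u :: "real^'n"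
    by (rule continuous_on_compose2) (auto intro: continuous_intros)
  then have "continuous_on UNIV (shift_map S r)"
    unfolding shift_map_def case_prod_beta by (intro continuous_intros)
  then show ?thesis by (rule borel_measurable_continuous_onI)
qed

text \<open>A box is an event of the form \<open>hits_in\<close>, so its probability is a product
  over labels of conditional probabilities, each of which factors over coordinates because the
  stopping sets are rectangles. The product law on the right gives boxes the same value. The
  \<open>- 1\<close> in \<open>J\<close> translates stopping times into positions counted from
  0.\<close>

lemma law_of_stopped_gaussian:
  fixes e :: "nat \<Rightarrow> 'n::finite" and a b :: real
  assumes e: "bij_betw e {1..CARD('n)} UNIV" and b: "0 < b"
  defines "J \<equiv> (\<lambda>\<omega> l. stop_index e a b (\<lambda>i. fst (\<omega> (i - 1))) l - 1)"
  shows "distr (PiM UNIV (\<lambda>_::nat. std_gaussian :: ((real^'n) \<times> real) measure)) borel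
      (\<lambda>\<omega>. (\<chi> i l. fst (\<omega> (J \<omega> l)) $ i, \<chi> l. snd (\<omega> (J \<omega> l)))) =
    matrix_law a b \<Otimes>\<^sub>M std_gaussian" (is "distr ?PS borel ?G = ?R")
proof -
  let ?M = "std_gaussian :: ((real^'n) \<times> real) measure"
  let ?N = "std_normal_distribution"
  interpret M: prob_space ?M by (rule prob_space_std_gaussian)
  interpret sequence_space ?M by unfold_locales
  interpret N: prob_space ?N by (rule prob_space_normal_density) simp
  interpret W: prob_space "matrix_law a b :: (real^'n^'n) measure" by (rule prob_space_matrix_law[OF b])
  interpret G: prob_space "std_gaussian :: (real^'n) measure" by (rule prob_space_std_gaussian)
  interpret R: pair_prob_space "matrix_law a b :: (real^'n^'n) measure" "std_gaussian :: (real^'n) measure"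
    by unfold_locales
  define A :: "nat \<Rightarrow> ((real^'n) \<times> real) set" where "A l = fst -` stop_set a b (e l)" for l
  have A_eq: "A l = {w. \<forall>i. w $ i \<in> entry_set a b i (e l)} \<times> UNIV" for l
    by (auto simp: A_def stop_set_eq)
  have A[measurable]: "A l \<in> sets ?M" for l unfolding A_eq by (simp add: borel_prod[symmetric])
  have rect: "measure ?M ({w. \<forall>i. w $ i \<in> C i} \<times> D) = (\<Prod>i\<in>UNIV. measure ?N (C i)) * measure ?N D"
    if [measurable]: "\<And>i. C i \<in> sets borel" "D \<in> sets borel" for C :: "'n \<Rightarrow> real set" and D
  proof -
    interpret G1: prob_space "std_gaussian :: real measure" by (rule prob_space_std_gaussian)
    have "emeasure ?M ({w. \<forall>i. w $ i \<in> C i} \<times> D) =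
      emeasure (std_gaussian :: (real^'n) measure) {w. \<forall>i. w $ i \<in> C i} * emeasure (std_gaussian :: real measure) D"
      unfolding pair_std_gaussian[symmetric] by (rule G1.emeasure_pair_measure_Times) auto
    also have "\<dots> = ennreal ((\<Prod>i\<in>UNIV. measure ?N (C i)) * measure ?N D)"
      by (simp add: emeasure_std_gaussian_rect std_gaussian_real N.emeasure_eq_measure prod_ennreal ennreal_mult prod_nonneg)
    finally show ?thesis by (simp add: M.emeasure_eq_measure prod_nonneg)
  qed
  have A_pos: "0 < measure ?M (A l)" for l
    unfolding A_eq by (subst rect) (auto intro!: prod_pos measure_entry_set_pos[OF b] simp: N.prob_space[simplified])
  have J_eq: "J \<omega> l = hit_time A (\<lambda>i. \<omega> (i - 1)) (inv_into {1..CARD('n)} e l) - 1" for \<omega> l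
    unfolding J_def stop_index_def stop_time_eq_hit_time A_def hit_time_comp[where f=fst and w="\<lambda>i. \<omega> (i - 1)"] ..
  have [measurable]: "(\<lambda>\<omega>. \<omega> (J \<omega> l)) \<in> measurable ?PS ?M" for l
    unfolding J_eq by (rule measurable_at_hit_time[where w="\<lambda>\<omega> i. \<omega> (i - 1)"]) measurable
  have [measurable]: "(\<lambda>\<omega>. fst (\<omega> (J \<omega> l))) \<in> borel_measurable ?PS" "(\<lambda>\<omega>. snd (\<omega> (J \<omega> l))) \<in> borel_measurable ?PS" for l
  proof -
    have "fst \<in> borel_measurable ?M" "snd \<in> borel_measurable ?M"
      by (auto intro!: borel_measurable_continuous_onI continuous_intros simp: measurable_cong_sets[OF sets_std_gaussian refl])
    then show "(\<lambda>\<omega>. fst (\<omega> (J \<omega> l))) \<in> borel_measurable ?PS" "(\<lambda>\<omega>. snd (\<omega> (J \<omega> l))) \<in> borel_measurable ?PS"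
      by measurable
  qed
  have G[measurable]: "?G \<in> borel_measurable ?PS" by measurable
  show ?thesis
  proof (rule measure_eq_on_boxes)
    show "sets ?R = sets borel"
      by (simp add: borel_prod[symmetric] cong: sets_pair_measure_cong)
    show "finite_measure (distr ?PS borel ?G)"
      by (intro prob_space.finite_measure P.prob_space_distr G)
    fix lo hi :: "(real^'n^'n) \<times> (real^'n)"
    define C where "C i l = {fst lo $ i $ l <..< fst hi $ i $ l}" for i l
    define D where "D l = {snd lo $ l <..< snd hi $ l}" for l
    define B where "B k = {w. \<forall>i. w $ i \<in> C i (e k)} \<times> D (e k)" for k :: nat
    have CD[measurable]: "C i l \<in> sets borel" "D l \<in> sets borel" for i l by (auto simp: C_def D_def)
    have B[measurable]: "B k \<in> sets ?M" for k unfolding B_def by (simp add: borel_prod[symmetric])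
    have box: "box lo hi = {W. \<forall>i l. W $ i $ l \<in> C i l} \<times> {z. \<forall>l. z $ l \<in> D l}"
    proof -
      have "x \<in> box lo hi \<longleftrightarrow> (\<forall>i l. fst x $ i $ l \<in> C i l) \<and> (\<forall>l. snd x $ l \<in> D l)" for x
        unfolding mem_box Basis_prod_def ball_Un ball_simps
        by (cases x, cases lo, cases hi) (auto simp: Basis_vec_def inner_axis C_def D_def)
      then show ?thesis by (auto simp: mem_Times_iff)
    qed
    have ev: "?G -` box lo hi \<inter> space ?PS = {\<omega>\<in>space ?PS. hits_in A B CARD('n) (\<lambda>i. \<omega> (i - 1))}"
    proof -
      have "?G \<omega> \<in> box lo hi \<longleftrightarrow> hits_in A B CARD('n) (\<lambda>i. \<omega> (i - 1))" for \<omega>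
      proof -
        have "?G \<omega> \<in> box lo hi \<longleftrightarrow> (\<forall>l. fst (\<omega> (J \<omega> l)) \<in> {w. \<forall>i. w $ i \<in> C i l} \<and> snd (\<omega> (J \<omega> l)) \<in> D l)"
          by (auto simp: box)
        also have "\<dots> \<longleftrightarrow> (\<forall>m<CARD('n). fst (\<omega> (J \<omega> (e (Suc m)))) \<in> {w. \<forall>i. w $ i \<in> C i (e (Suc m))} \<and> snd (\<omega> (J \<omega> (e (Suc m)))) \<in> D (e (Suc m)))"
          (is "(\<forall>l. ?Q l) \<longleftrightarrow> _")
        proof safe
          fix l assume *: "\<forall>m<CARD('n). ?Q (e (Suc m))"
          obtain m where "m < CARD('n)" "e (Suc m) = l" using stopping_index_ge_1[OF e] by metis
          with * have "?Q l" by blast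
          then show "fst (\<omega> (J \<omega> l)) $ i \<in> C i l" "snd (\<omega> (J \<omega> l)) \<in> D l" for i by auto
        qed auto
        also have "\<dots> \<longleftrightarrow> (\<forall>m<CARD('n). \<omega> (J \<omega> (e (Suc m))) \<in> B (Suc m))"
          by (simp only: B_def mem_Times_iff)
        also have "\<dots> \<longleftrightarrow> hits_in A B CARD('n) (\<lambda>i. \<omega> (i - 1))"
        proof -
          have "inv_into {1..CARD('n)} e (e (Suc m)) = Suc m" if "m < CARD('n)" for m
            using e that by (intro inv_into_f_f) (auto simp: bij_betw_def)
          then show ?thesis by (auto simp: hits_in_def J_eq)
        qed
        finally show ?thesis .
      qed
      then show ?thesis by auto
    qed
    define h where "h l = (\<Prod>i\<in>UNIV. measure ?N (entry_set a b i l \<inter> C i l) / measure ?N (entry_set a b i l)) * measure ?N (D l)" for l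
    have "measure ?M (A k \<inter> B k) / measure ?M (A k) = h (e k)" for k
    proof -
      have "A k \<inter> B k = {w. \<forall>i. w $ i \<in> entry_set a b i (e k) \<inter> C i (e k)} \<times> D (e k)"
        by (auto simp: A_eq B_def)
      then show ?thesis
        by (simp only: A_eq rect CD sets_entry_set sets.Int sets.top h_def prod_dividef space_borel)
           (simp add: rect N.prob_space[simplified] prod_dividef)
    qed
    then have "P.prob (?G -` box lo hi \<inter> space ?PS) = (\<Prod>m<CARD('n). h (e (Suc m)))"
      unfolding ev by (subst prob_hits_in[OF A B A_pos]) simp
    also have "\<dots> = (\<Prod>k\<in>{1..CARD('n)}. h (e k))"
      by (rule prod.reindex_bij_witness[of _ "\<lambda>k. k - 1" Suc]) auto
    \<comment> \<open>The order in which the labels are visited drops out, since e is a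
      bijection.\<close>
    also have "\<dots> = (\<Prod>l\<in>UNIV. h l)"
      by (rule prod.reindex_bij_betw[OF e])
    finally have L: "emeasure (distr ?PS borel ?G) (box lo hi) = ennreal (\<Prod>l\<in>UNIV. h l)"
      by (subst emeasure_distr) (auto simp: P.emeasure_eq_measure)
    have "emeasure ?R (box lo hi) = emeasure (matrix_law a b) {W::real^'n^'n. \<forall>i l. W $ i $ l \<in> C i l} *
       emeasure (std_gaussian :: (real^'n) measure) {z. \<forall>l. z $ l \<in> D l}"
      unfolding box by (rule G.emeasure_pair_measure_Times) measurable
    also have "\<dots> = ennreal ((\<Prod>i\<in>UNIV. \<Prod>l\<in>UNIV. measure ?N (entry_set a b i l \<inter> C i l) / measure ?N (entry_set a b i l)) * (\<Prod>l\<in>UNIV. measure ?N (D l)))"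
      by (simp add: emeasure_matrix_law_rect b emeasure_std_gaussian_rect N.emeasure_eq_measure prod_ennreal prod_nonneg ennreal_mult)
    \<comment> \<open>The matrix law groups its factors by rows, the selection by columns.\<close>
    also have "\<dots> = ennreal (\<Prod>l\<in>UNIV. h l)"
      unfolding h_def by (subst prod.swap) (simp add: prod.distrib)
    finally show "emeasure (distr ?PS borel ?G) (box lo hi) = emeasure ?R (box lo hi)"
      using L by simp
  qed simp
qed

text \<open>Whitening undoes the square root of S, so the model observations stop exactly when the
  underlying standard Gaussian sequence does. Both laws are compared by pulling them back to that
  sequence.\<close>

lemma statistic_law_eq:
  fixes e :: "nat \<Rightarrow> 'n::finite" and S :: "real^'n^'n"
  assumes e: "bij_betw e {1..CARD('n)} UNIV" and b: "0 < b" and S: "positive_definite S"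
  shows "statistic_law S e a b r = distr (matrix_law a b \<Otimes>\<^sub>M std_gaussian) borel (shift_map S r)"
proof -
  let ?PS = "PiM UNIV (\<lambda>_::nat. std_gaussian :: ((real^'n) \<times> real) measure)"
  let ?PL = "PiM {1..} (\<lambda>_::nat. pair_law S r)"
  let ?g = "\<lambda>\<omega>. \<lambda>i\<in>{1..}. pair_map S r (\<omega> (i - 1 :: nat))"
  let ?stat = "\<lambda>s. stopping_statistic S e a b (\<lambda>i. fst (s i)) (\<lambda>i. snd (s i))"
  define J where "J \<omega> l = stop_index e a b (\<lambda>i. fst (\<omega> (i - 1))) l - 1" for \<omega> :: "nat \<Rightarrow> (real^'n) \<times> real" and l
  let ?G = "\<lambda>\<omega>. (\<chi> i l. fst (\<omega> (J \<omega> l)) $ i, \<chi> l. snd (\<omega> (J \<omega> l)))"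
  have [measurable]: "(\<lambda>s. s i) \<in> measurable ?PL borel" for i
    using measurable_PiM_any_component[of "pair_law S r" i "{1..}"]
    by (simp cong: measurable_cong_sets)
  have stat: "?stat \<in> borel_measurable ?PL"
    by (intro measurable_stopping_statistic) measurable
  have g: "?g \<in> measurable ?PS ?PL"
  proof -
    have "pair_map S r \<in> measurable std_gaussian borel"
      by (subst measurable_cong_sets[OF sets_std_gaussian refl]) (rule measurable_pair_map)
    then show ?thesis
      by (intro measurable_restrict) (auto simp: pair_law_eq intro!: measurable_compose[OF measurable_component_singleton])
  qed
  have G: "?G \<in> borel_measurable ?PS"
  proof -
    have c: "(\<lambda>\<omega>::nat \<Rightarrow> (real^'n) \<times> real. \<omega> i) \<in> measurable ?PS borel" for i
      using measurable_component_singleton[of i UNIV "\<lambda>_. std_gaussian :: ((real^'n) \<times> real) measure"]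
      by (simp cong: measurable_cong_sets)
    have m: "(\<lambda>\<omega>. J \<omega> l) \<in> measurable ?PS (count_space UNIV)" for l
      unfolding J_def stop_index_def stop_time_eq_hit_time
      by (rule measurable_compose[OF measurable_hit_time[where M=borel]])
         (auto intro: measurable_compose[OF c borel_measurable_fst])
    have "(\<lambda>\<omega>. \<omega> (J \<omega> l)) \<in> measurable ?PS std_gaussian" for l
      by (rule measurable_compose_countable[OF _ m]) measurable
    then have [measurable]: "(\<lambda>\<omega>. \<omega> (J \<omega> l)) \<in> measurable ?PS borel" for l
      by (simp cong: measurable_cong_sets)
    show ?thesis by measurable
  qed
  have PL: "?PL = distr ?PS ?PL ?g"
    unfolding pair_law_eq
    by (rule distr_PiM_shift_index[symmetric, OF prob_space_std_gaussian])
       (subst measurable_cong_sets[OF sets_std_gaussian refl], rule measurable_pair_map)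
  have eq: "?stat (?g \<omega>) = shift_map S r (?G \<omega>)" for \<omega>
  proof -
    let ?u = "matrix_inv (matrix_sqrt S) *v r"
    have "?stat (?g \<omega>) = stopping_statistic S e a b (\<lambda>i. fst (pair_map S r (\<omega> (i - 1)))) (\<lambda>i. snd (pair_map S r (\<omega> (i - 1))))"
      by (intro stopping_statistic_cong[OF e]) auto
    also have "\<dots> = (\<chi> i l. fst (\<omega> (J \<omega> l)) $ i, \<chi> l. ?u \<bullet> fst (\<omega> (J \<omega> l)) + sqrt (noise_variance S r) * snd (\<omega> (J \<omega> l)))"
    proof -
      have "whiten S (fst (pair_map S r x)) = fst x" "snd (pair_map S r x) = ?u \<bullet> fst x + sqrt (noise_variance S r) * snd x" for x
        by (simp_all add: whiten_def pair_map_def case_prod_beta matrix_sqrt_inv[OF S] vector_matrix_sqrt_inv[OF S])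
      then show ?thesis
        by (simp only: stopping_statistic_def stopped_matrix_def stopped_row_def Let_def J_def)
    qed
    also have "\<dots> = shift_map S r (?G \<omega>)"
      by (simp add: shift_map_def vec_eq_iff vector_matrix_mult_def inner_vec_def mult.commute)
    finally show ?thesis .
  qed
  have "statistic_law S e a b r = distr (distr ?PS ?PL ?g) borel ?stat"
    unfolding statistic_law_def by (simp only: PL[symmetric])
  also have "\<dots> = distr ?PS borel (\<lambda>\<omega>. ?stat (?g \<omega>))"
    by (subst distr_distr[OF stat g]) (simp add: comp_def)
  also have "\<dots> = distr (distr ?PS borel ?G) borel (shift_map S r)"
    unfolding eq by (subst distr_distr[OF _ G]) (simp_all add: comp_def)
  also have "distr ?PS borel ?G = matrix_law a b \<Otimes>\<^sub>M std_gaussian"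
    unfolding J_def by (rule law_of_stopped_gaussian[OF e b])
  finally show ?thesis .
qed

text \<open>Independence and equal marginals make the joint law of the observations from index 1 on
  the product measure in \<open>statistic_law\<close>, and the statistic reads no other
  index.\<close>

lemma law_of_stopping_statistic:
  fixes e :: "nat \<Rightarrow> 'n::finite" and S :: "real^'n^'n" and Xs :: "nat \<Rightarrow> 'w \<Rightarrow> real^'n"
  assumes M: "prob_space M" and e: "bij_betw e {1..CARD('n)} UNIV"
    and indep: "prob_space.indep_vars M (\<lambda>_. borel) (\<lambda>i \<omega>. (Xs i \<omega>, Ys i \<omega>)) {1..}"
    and law: "\<And>i. 1 \<le> i \<Longrightarrow> distr M borel (\<lambda>\<omega>. (Xs i \<omega>, Ys i \<omega>)) = pair_law S r"
  shows "(\<lambda>\<omega>. stopping_statistic S e a b (\<lambda>i. Xs i \<omega>) (\<lambda>i. Ys i \<omega>)) \<in> borel_measurable M"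
    "distr M borel (\<lambda>\<omega>. stopping_statistic S e a b (\<lambda>i. Xs i \<omega>) (\<lambda>i. Ys i \<omega>)) = statistic_law S e a b r"
proof -
  interpret prob_space M by fact
  let ?PL = "PiM {1..} (\<lambda>_::nat. pair_law S r)" and ?PB = "PiM {1..} (\<lambda>_::nat. borel :: ((real^'n) \<times> real) measure)"
  let ?Z = "\<lambda>\<omega>. \<lambda>i\<in>{1..}. (Xs i \<omega>, Ys i \<omega>)"
  let ?stat = "\<lambda>s. stopping_statistic S e a b (\<lambda>i. fst (s i)) (\<lambda>i. snd (s i))"
  have rv: "(\<lambda>\<omega>. (Xs i \<omega>, Ys i \<omega>)) \<in> borel_measurable M" if "i \<in> {1..}" for i
    using indep that by (auto simp: indep_vars_def)
  have Z: "?Z \<in> measurable M ?PB" by (intro measurable_restrict rv)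
  have "distr M ?PB ?Z = PiM {1..} (\<lambda>i. distr M borel (\<lambda>\<omega>. (Xs i \<omega>, Ys i \<omega>)))"
    by (subst indep_vars_iff_distr_eq_PiM'[symmetric]) (use indep rv in auto)
  also have "\<dots> = ?PL" by (intro PiM_cong law) auto
  finally have dZ: "distr M ?PB ?Z = ?PL" .
  have [measurable]: "(\<lambda>s. s i) \<in> measurable ?PB borel" for i
    by (rule measurable_PiM_any_component) simp
  have stat: "?stat \<in> borel_measurable ?PB"
    by (intro measurable_stopping_statistic) measurable
  have eq: "stopping_statistic S e a b (\<lambda>i. Xs i \<omega>) (\<lambda>i. Ys i \<omega>) = ?stat (?Z \<omega>)" for \<omega>
    by (intro stopping_statistic_cong[OF e]) auto
  show "(\<lambda>\<omega>. stopping_statistic S e a b (\<lambda>i. Xs i \<omega>) (\<lambda>i. Ys i \<omega>)) \<in> borel_measurable M"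
    unfolding eq by (rule measurable_compose[OF Z stat])
  have "distr M borel (\<lambda>\<omega>. ?stat (?Z \<omega>)) = distr (distr M ?PB ?Z) borel ?stat"
    by (subst distr_distr[OF stat Z]) (simp add: comp_def)
  then show "distr M borel (\<lambda>\<omega>. stopping_statistic S e a b (\<lambda>i. Xs i \<omega>) (\<lambda>i. Ys i \<omega>)) = statistic_law S e a b r"
    unfolding eq dZ statistic_law_def by simp
qed

section \<open>Gaussian tails\<close>

lemma measure_std_normal_eq:
  assumes [measurable]: "A \<in> sets borel"
  shows "measure std_normal_distribution A = (\<integral>x. indicator A x * std_normal_density x \<partial>lborel)"
proof -
  have "measure std_normal_distribution A = (\<integral>x. indicator A x \<partial>std_normal_distribution)" by simp
  also have "\<dots> = (\<integral>x. std_normal_density x * indicator A x \<partial>lborel)"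
    by (subst integral_density) auto
  finally show ?thesis by (simp add: mult.commute)
qed

lemma Q_eq_measure: "Q x = measure std_normal_distribution {x..}"
  by (simp add: Q_def set_lebesgue_integral_def measure_std_normal_eq)

lemma std_normal_density_minus[simp]: "std_normal_density (- x) = std_normal_density x"
  by (simp add: std_normal_density_def)

lemma measure_std_normal_uminus:
  assumes [measurable]: "A \<in> sets borel"
  shows "measure std_normal_distribution (uminus ` A) = measure std_normal_distribution A"
proof -
  have eq: "uminus ` A = uminus -` A" by (force simp: image_iff)
  have [measurable]: "uminus -` A \<in> sets borel"
    using measurable_sets[of uminus borel borel A] by simp
  show ?thesis unfolding eq
    by (subst (1 2) measure_std_normal_eq; simp?)
       (subst lborel_integral_real_affine[of "-1" _ 0], auto simp: indicator_def intro!: Bochner_Integration.integral_cong)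
qed

lemma prob_space_std_normal: "prob_space std_normal_distribution"
  by (rule prob_space_normal_density) simp

lemma measure_std_normal_singleton[simp]: "measure std_normal_distribution {x} = 0"
proof -
  have "AE y in lborel. indicator {x} y * std_normal_density y = 0"
    using AE_lborel_singleton[of x] by eventually_elim auto
  then show ?thesis
    by (subst measure_std_normal_eq) (auto intro: integral_eq_zero_AE)
qed

lemma measure_std_normal_Ioi: "measure std_normal_distribution {x<..} = Q x"
proof -
  interpret prob_space std_normal_distribution by (rule prob_space_std_normal)
  have "measure std_normal_distribution ({x} \<union> {x<..}) = measure std_normal_distribution {x} + measure std_normal_distribution {x<..}"
    by (rule finite_measure_Union) auto
  moreover have "{x} \<union> {x<..} = {x..}" by auto
  ultimately show ?thesis by (simp add: Q_eq_measure)
qed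

lemma measure_std_normal_tails:
  assumes "0 \<le> a"
  shows "measure std_normal_distribution {x. a < \<bar>x\<bar>} = 2 * Q a"
proof -
  interpret prob_space std_normal_distribution by (rule prob_space_std_normal)
  have "{x. a < \<bar>x\<bar>} = {a<..} \<union> uminus ` {a<..}" using assms by auto
  moreover have "measure std_normal_distribution ({a<..} \<union> uminus ` {a<..}) =
      measure std_normal_distribution {a<..} + measure std_normal_distribution (uminus ` {a<..})"
    using assms by (intro finite_measure_Union) auto
  moreover have "measure std_normal_distribution (uminus ` {a<..}) = Q a"
    by (subst measure_std_normal_uminus) (auto simp: measure_std_normal_Ioi)
  ultimately show ?thesis by (simp only: measure_std_normal_Ioi)
qed

lemma measure_std_normal_bulk:
  assumes "0 < b"
  shows "measure std_normal_distribution {x. \<bar>x\<bar> < b} = 1 - 2 * Q b"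
proof -
  interpret prob_space std_normal_distribution by (rule prob_space_std_normal)
  have "{x. \<bar>x\<bar> < b} = space std_normal_distribution - ({x. b < \<bar>x\<bar>} \<union> {b, -b})"
    using assms by auto
  then have "measure std_normal_distribution {x. \<bar>x\<bar> < b} = 1 - measure std_normal_distribution ({x. b < \<bar>x\<bar>} \<union> {b, -b})"
    by (simp only:) (subst prob_compl, auto)
  also have "measure std_normal_distribution ({x. b < \<bar>x\<bar>} \<union> {b, -b}) = measure std_normal_distribution {x. b < \<bar>x\<bar>}"
  proof -
    have "measure std_normal_distribution {b, -b} = 0"
      using measure_Un_le[of "{b}" std_normal_distribution "{-b}"] by (simp add: measure_le_0_iff insert_commute)
    then have "measure std_normal_distribution ({x. b < \<bar>x\<bar>} \<union> {b, -b}) \<le> measure std_normal_distribution {x. b < \<bar>x\<bar>}"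
      using measure_Un_le[of "{x. b < \<bar>x\<bar>}" std_normal_distribution "{b, -b}"] by simp
    moreover have "measure std_normal_distribution {x. b < \<bar>x\<bar>} \<le> measure std_normal_distribution ({x. b < \<bar>x\<bar>} \<union> {b, -b})"
      by (rule finite_measure_mono) auto
    ultimately show ?thesis by linarith
  qed
  finally show ?thesis using assms by (simp add: measure_std_normal_tails)
qed

lemma Q_pos: "0 < Q x"
  unfolding Q_eq_measure by (rule measure_std_normal_pos[of _ x "x + 1"]) auto

lemma Q_less_half: "0 < b \<Longrightarrow> 2 * Q b < 1"
proof -
  assume b: "0 < b"
  then have "0 < measure std_normal_distribution {x. \<bar>x\<bar> < b}"
    by (intro measure_std_normal_pos[of _ "-b" b]) auto
  then show "2 * Q b < 1" using measure_std_normal_bulk[OF b] by simp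
qed

lemma Q_antimono: "x \<le> y \<Longrightarrow> Q y \<le> Q x"
proof -
  interpret prob_space std_normal_distribution by (rule prob_space_std_normal)
  show "x \<le> y \<Longrightarrow> Q y \<le> Q x" unfolding Q_eq_measure by (intro finite_measure_mono) auto
qed

text \<open>A preimage exists by the intermediate value theorem for the distribution function, which
  is continuous because single points have mass zero.\<close>

lemma Q_Q_inv:
  assumes "0 < y" "y < 1"
  shows "Q (Q_inv y) = y"
proof -
  interpret real_distribution std_normal_distribution by (rule real_dist_normal_dist)
  have Q: "Q x = 1 - cdf std_normal_distribution x" for x
  proof -
    have "{x<..} = space std_normal_distribution - {..x}" by auto
    then show ?thesis unfolding measure_std_normal_Ioi[symmetric] cdf_def2
      by (simp only:) (subst prob_compl, auto)
  qed
  have "eventually (\<lambda>x. cdf std_normal_distribution x > 1 - y) at_top"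
    using assms by (intro order_tendstoD[OF cdf_lim_at_top_prob]) auto
  then obtain v where v: "cdf std_normal_distribution v > 1 - y"
    by (auto simp: eventually_at_top_linorder)
  have "eventually (\<lambda>x. cdf std_normal_distribution x < 1 - y) at_bot"
    using assms by (intro order_tendstoD[OF cdf_lim_at_bot]) auto
  then obtain u where u: "cdf std_normal_distribution u < 1 - y"
    by (auto simp: eventually_at_bot_linorder)
  have "u \<le> v" using u v cdf_nondecreasing[of v u] by linarith
  then obtain x where "cdf std_normal_distribution x = 1 - y"
    using IVT[of "cdf std_normal_distribution" u "1 - y" v] u v isCont_cdf by auto
  then have "Q x = y" by (simp add: Q)
  then show ?thesis unfolding Q_inv_def by (intro f_inv_into_f) auto
qed

lemma std_normal_density_tendsto: "(std_normal_density \<longlongrightarrow> 0) at_top"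
  "((\<lambda>x. x * std_normal_density x) \<longlongrightarrow> 0) at_top"
  unfolding std_normal_density_def[abs_def] by real_asymp+

lemma DERIV_std_normal_density[derivative_intros]:
  "(std_normal_density has_real_derivative - x * std_normal_density x) (at x)"
  unfolding std_normal_density_def[abs_def]
  by (auto intro!: derivative_eq_intros simp: field_simps)

lemma ennreal_indicator_mult: "ennreal (indicator A x * y) = ennreal y * indicator A x"
  by (simp add: indicator_def)

lemma has_bochner_integral_nonneg:
  fixes f :: "'a \<Rightarrow> real"
  shows "has_bochner_integral M f c \<Longrightarrow> (\<And>x. 0 \<le> f x) \<Longrightarrow> 0 \<le> c"
  by (metis Bochner_Integration.integral_nonneg has_bochner_integral_integral_eq)

text \<open>With \<phi> the normal density, -\<phi> is an antiderivative of x \<phi> and -x \<phi>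
  one of (x^2 - 1) \<phi>. The condition 1 \<le> a makes the latter integrand nonnegative on the
  whole tail.\<close>

lemma tail_integrals:
  shows tail_integral_0: "has_bochner_integral lborel (\<lambda>x. indicator {a..} x * std_normal_density x) (Q a)"
    and tail_integral_1: "0 \<le> a \<Longrightarrow> has_bochner_integral lborel (\<lambda>x. indicator {a..} x * (x * std_normal_density x)) (std_normal_density a)"
    and tail_integral_2: "1 \<le> a \<Longrightarrow> has_bochner_integral lborel (\<lambda>x. indicator {a..} x * (x\<^sup>2 * std_normal_density x)) (a * std_normal_density a + Q a)"
proof -
  have "integrable lborel (\<lambda>x. std_normal_density x * indicator {a..} x)"
    by (intro integrable_mult_indicator[where 'a=real, simplified, of _ lborel] integrable_real_mult_indicator) auto
  then show 0: "has_bochner_integral lborel (\<lambda>x. indicator {a..} x * std_normal_density x) (Q a)"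
    by (simp add: has_bochner_integral_iff Q_def set_lebesgue_integral_def mult.commute)
  show "has_bochner_integral lborel (\<lambda>x. indicator {a..} x * (x * std_normal_density x)) (std_normal_density a)" if "0 \<le> a"
  proof (rule has_bochner_integral_nn_integral)
    have "(\<integral>\<^sup>+x. ennreal (x * std_normal_density x) * indicator {a..} x \<partial>lborel) = ennreal (0 - - std_normal_density a)"
      using that std_normal_density_tendsto(1)
      by (intro nn_integral_FTC_atLeast) (auto intro!: derivative_eq_intros tendsto_eq_intros)
    then show "(\<integral>\<^sup>+x. ennreal (indicator {a..} x * (x * std_normal_density x)) \<partial>lborel) = ennreal (std_normal_density a)"
      by (simp add: ennreal_indicator_mult)
  qed (use that in \<open>auto simp: indicator_def\<close>)
  have 2: "has_bochner_integral lborel (\<lambda>x. indicator {a..} x * ((x\<^sup>2 - 1) * std_normal_density x)) (a * std_normal_density a)" if "1 \<le> a"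
  proof (rule has_bochner_integral_nn_integral)
    have ge: "0 \<le> x\<^sup>2 - 1" if "a \<le> x" for x
      using one_le_power[of x 2] that \<open>1 \<le> a\<close> by simp
    have "(\<integral>\<^sup>+x. ennreal ((x\<^sup>2 - 1) * std_normal_density x) * indicator {a..} x \<partial>lborel) = ennreal (0 - - (a * std_normal_density a))"
    proof (rule nn_integral_FTC_atLeast)
      show "((\<lambda>x. - (x * std_normal_density x)) \<longlongrightarrow> 0) at_top"
        using tendsto_minus[OF std_normal_density_tendsto(2)] by simp
      show "((\<lambda>x. - (x * std_normal_density x)) has_real_derivative (x\<^sup>2 - 1) * std_normal_density x) (at x)" for x
        by (auto intro!: derivative_eq_intros simp: algebra_simps power2_eq_square)
    qed (use ge in auto)
    then show "(\<integral>\<^sup>+x. ennreal (indicator {a..} x * ((x\<^sup>2 - 1) * std_normal_density x)) \<partial>lborel) = ennreal (a * std_normal_density a)"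
      by (simp add: ennreal_indicator_mult)
    show "AE x in lborel. 0 \<le> indicator {a..} x * ((x\<^sup>2 - 1) * std_normal_density x)"
      using ge by (auto simp: indicator_def)
  qed (use that in auto)
  show "has_bochner_integral lborel (\<lambda>x. indicator {a..} x * (x\<^sup>2 * std_normal_density x)) (a * std_normal_density a + Q a)" if "1 \<le> a"
    using has_bochner_integral_add[OF 2[OF that] 0] by (simp add: algebra_simps)
qed

text \<open>The Mills ratio bounds: integrate (x - a) \<phi> \<ge> 0 and (x - a)^2 \<phi> \<ge> 0
  over the tail beyond a.\<close>

lemma Q_bounds:
  assumes "1 \<le> a"
  shows Q_upper: "a * Q a \<le> std_normal_density a"
    and Q_lower: "a * std_normal_density a \<le> (1 + a\<^sup>2) * Q a"
proof -
  have a: "0 \<le> a" using assms by simp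
  note h0 = tail_integral_0[of a] and h1 = tail_integral_1[OF a] and h2 = tail_integral_2[OF assms]
  have "has_bochner_integral lborel (\<lambda>x. indicator {a..} x * (x * std_normal_density x) - a * (indicator {a..} x * std_normal_density x)) (std_normal_density a - a * Q a)"
    by (intro has_bochner_integral_diff has_bochner_integral_mult_right h0 h1)
  then have "0 \<le> std_normal_density a - a * Q a"
    by (rule has_bochner_integral_nonneg) (auto simp: indicator_def mult_right_mono)
  then show "a * Q a \<le> std_normal_density a" by simp
  have "has_bochner_integral lborel (\<lambda>x. indicator {a..} x * (x\<^sup>2 * std_normal_density x) - 2 * a * (indicator {a..} x * (x * std_normal_density x)) +
      a\<^sup>2 * (indicator {a..} x * std_normal_density x)) (a * std_normal_density a + Q a - 2 * a * std_normal_density a + a\<^sup>2 * Q a)"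
    by (intro has_bochner_integral_diff has_bochner_integral_add has_bochner_integral_mult_right h0 h1 h2)
  moreover have "indicator {a..} x * (x\<^sup>2 * std_normal_density x) - 2 * a * (indicator {a..} x * (x * std_normal_density x)) +
      a\<^sup>2 * (indicator {a..} x * std_normal_density x) = indicator {a..} x * ((x - a)\<^sup>2 * std_normal_density x)" for x
    by (simp add: power2_eq_square algebra_simps)
  ultimately have "has_bochner_integral lborel (\<lambda>x. indicator {a..} x * ((x - a)\<^sup>2 * std_normal_density x))
      (a * std_normal_density a + Q a - 2 * a * std_normal_density a + a\<^sup>2 * Q a)"
    by simp
  then have "0 \<le> a * std_normal_density a + Q a - 2 * a * std_normal_density a + a\<^sup>2 * Q a"
    by (rule has_bochner_integral_nonneg) auto
  then show "a * std_normal_density a \<le> (1 + a\<^sup>2) * Q a" by (simp add: algebra_simps)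
qed

section \<open>Moments of the stopped observations\<close>

lemma prod_delta2:
  fixes c d :: "'b::comm_monoid_mult"
  assumes "u \<noteq> v"
  shows "(\<Prod>x\<in>(UNIV::'a::finite set). if x = u then c else if x = v then d else 1) = c * d"
proof -
  have "(\<Prod>x\<in>UNIV. if x = u then c else if x = v then d else 1) = (\<Prod>x\<in>{u, v}. if x = u then c else if x = v then d else 1)"
    by (rule prod.mono_neutral_right) auto
  then show ?thesis using assms by simp
qed

lemma std_gaussian_coordinate:
  fixes l :: "'n::finite"
  assumes [measurable]: "f \<in> borel_measurable borel" and int: "integrable lborel (\<lambda>x. std_normal_density x * f x)"
  shows "integrable (std_gaussian :: (real^'n) measure) (\<lambda>z. f (z $ l))"
    "(\<integral>z. f (z $ l) \<partial>(std_gaussian :: (real^'n) measure)) = (\<integral>x. std_normal_density x * f x \<partial>lborel)"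
proof -
  let ?h = "\<lambda>i x. if i = l then f x else 1"
  have eq: "gaussian_density z * f (z $ l) = (\<Prod>i\<in>UNIV. std_normal_density (z $ i) * ?h i (z $ i))" for z :: "real^'n"
    by (simp add: gaussian_density_vec prod.distrib)
  have i: "integrable lborel (\<lambda>x. std_normal_density x * ?h i x)" for i using int by (cases "i = l") auto
  show "integrable (std_gaussian :: (real^'n) measure) (\<lambda>z. f (z $ l))"
    unfolding std_gaussian_def by (subst integrable_density) (auto simp: eq intro!: prod_nonneg integrable_lborel_vec i)
  have "(\<integral>z. f (z $ l) \<partial>(std_gaussian :: (real^'n) measure)) = (\<Prod>i\<in>UNIV. \<integral>x. std_normal_density x * ?h i x \<partial>lborel)"
    unfolding std_gaussian_def by (subst integral_density) (auto simp: eq intro!: prod_nonneg integral_lborel_vec i)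
  also have "\<dots> = (\<Prod>i\<in>UNIV. if i = l then (\<integral>x. std_normal_density x * f x \<partial>lborel) else 1)"
    by (intro prod.cong) auto
  finally show "(\<integral>z. f (z $ l) \<partial>(std_gaussian :: (real^'n) measure)) = (\<integral>x. std_normal_density x * f x \<partial>lborel)"
    by simp
qed

lemma std_gaussian_two_coordinates:
  fixes l m :: "'n::finite"
  assumes [measurable]: "f \<in> borel_measurable borel" "g \<in> borel_measurable borel"
    and int: "integrable lborel (\<lambda>x. std_normal_density x * f x)" "integrable lborel (\<lambda>x. std_normal_density x * g x)"
    and "l \<noteq> m"
  shows "integrable (std_gaussian :: (real^'n) measure) (\<lambda>z. f (z $ l) * g (z $ m))"
    "(\<integral>z. f (z $ l) * g (z $ m) \<partial>(std_gaussian :: (real^'n) measure)) =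
      (\<integral>x. std_normal_density x * f x \<partial>lborel) * (\<integral>x. std_normal_density x * g x \<partial>lborel)"
proof -
  let ?h = "\<lambda>i x. if i = l then f x else if i = m then g x else 1"
  have "f (z $ l) * g (z $ m) = (\<Prod>i\<in>UNIV. ?h i (z $ i))" for z :: "real^'n"
  proof -
    have "(\<Prod>i\<in>UNIV. ?h i (z $ i)) = (\<Prod>i\<in>UNIV. if i = l then f (z $ l) else if i = m then g (z $ m) else 1)"
      by (intro prod.cong) auto
    then show ?thesis by (simp only: prod_delta2[OF \<open>l \<noteq> m\<close>])
  qed
  then have eq: "gaussian_density z * (f (z $ l) * g (z $ m)) = (\<Prod>i\<in>UNIV. std_normal_density (z $ i) * ?h i (z $ i))" for z :: "real^'n"
    by (simp only: gaussian_density_vec prod.distrib)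
  have i: "integrable lborel (\<lambda>x. std_normal_density x * ?h i x)" for i using int by (cases "i = l"; cases "i = m") auto
  show "integrable (std_gaussian :: (real^'n) measure) (\<lambda>z. f (z $ l) * g (z $ m))"
    unfolding std_gaussian_def
    by (subst integrable_density) (auto simp only: eq real_scaleR_def intro!: prod_nonneg integrable_lborel_vec i, auto intro!: prod_nonneg)
  have "(\<integral>z. f (z $ l) * g (z $ m) \<partial>(std_gaussian :: (real^'n) measure)) = (\<Prod>i\<in>UNIV. \<integral>x. std_normal_density x * ?h i x \<partial>lborel)"
    unfolding std_gaussian_def
    by (subst integral_density) (auto simp only: eq real_scaleR_def intro!: prod_nonneg integral_lborel_vec i, auto intro!: prod_nonneg)
  also have "\<dots> = (\<Prod>i\<in>UNIV. if i = l then (\<integral>x. std_normal_density x * f x \<partial>lborel) else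
      if i = m then (\<integral>x. std_normal_density x * g x \<partial>lborel) else 1)"
    by (intro prod.cong) auto
  finally show "(\<integral>z. f (z $ l) * g (z $ m) \<partial>(std_gaussian :: (real^'n) measure)) =
      (\<integral>x. std_normal_density x * f x \<partial>lborel) * (\<integral>x. std_normal_density x * g x \<partial>lborel)"
    by (simp only: prod_delta2[OF \<open>l \<noteq> m\<close>])
qed

text \<open>The functions x and 1 - x^2 are, up to factors, the scores for location and for scale.
  Their being centred and orthogonal, with second moments 1 and 2, produces the Fisher
  information.\<close>

lemma std_normal_moments:
  "has_bochner_integral lborel (\<lambda>x. std_normal_density x * x) 0"
  "has_bochner_integral lborel (\<lambda>x. std_normal_density x * x\<^sup>2) 1"
  "has_bochner_integral lborel (\<lambda>x. std_normal_density x * (1 - x\<^sup>2)) 0"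
  "has_bochner_integral lborel (\<lambda>x. std_normal_density x * (x * (1 - x\<^sup>2))) 0"
  "has_bochner_integral lborel (\<lambda>x. std_normal_density x * (1 - x\<^sup>2)\<^sup>2) 2"
proof -
  note m0 = std_normal_moment_even[of 0, simplified] and m1 = std_normal_moment_odd[of 0, simplified]
    and m2 = std_normal_moment_even[of 1, simplified] and m3 = std_normal_moment_odd[of 1]
    and m4 = std_normal_moment_even[of 2]
  show "has_bochner_integral lborel (\<lambda>x. std_normal_density x * x) 0" by (rule m1)
  show 2: "has_bochner_integral lborel (\<lambda>x. std_normal_density x * x\<^sup>2) 1" using m2 by simp
  show "has_bochner_integral lborel (\<lambda>x. std_normal_density x * (1 - x\<^sup>2)) 0"
    using has_bochner_integral_diff[OF m0 2] by (simp add: right_diff_distrib)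
  show "has_bochner_integral lborel (\<lambda>x. std_normal_density x * (x * (1 - x\<^sup>2))) 0"
  proof -
    have "std_normal_density x * (x * (1 - x\<^sup>2)) = std_normal_density x * x - std_normal_density x * x ^ (2 * 1 + 1)" for x :: real
      by (simp add: algebra_simps power2_eq_square power3_eq_cube)
    then show ?thesis using has_bochner_integral_diff[OF m1 m3] by simp
  qed
  show "has_bochner_integral lborel (\<lambda>x. std_normal_density x * (1 - x\<^sup>2)\<^sup>2) 2"
  proof -
    have "std_normal_density x * (1 - x\<^sup>2)\<^sup>2 = std_normal_density x - 2 * (std_normal_density x * x\<^sup>2) + std_normal_density x * x ^ (2 * 2)" for x :: real
      by (simp add: algebra_simps power2_eq_square power4_eq_xxxx)
    moreover have "fact (2 * 2) / (2 ^ 2 * fact 2 :: real) = 3" by (simp add: fact_numeral)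
    ultimately show ?thesis
      using has_bochner_integral_add[OF has_bochner_integral_diff[OF m0 has_bochner_integral_mult_right[OF 2, of 2]] m4] by simp
  qed
qed

lemma std_gaussian_moments:
  fixes l m :: "'n::finite"
  defines "G \<equiv> (std_gaussian :: (real^'n) measure)"
  shows "has_bochner_integral G (\<lambda>z. z $ l) 0"
    "has_bochner_integral G (\<lambda>z. z $ l * z $ m) (if l = m then 1 else 0)"
    "has_bochner_integral G (\<lambda>z. z $ l * (1 - (z $ m)\<^sup>2)) 0"
    "has_bochner_integral G (\<lambda>z. (1 - (z $ l)\<^sup>2) * (1 - (z $ m)\<^sup>2)) (if l = m then 2 else 0)"
proof -
  note h = std_normal_moments[unfolded has_bochner_integral_iff]
  note one = std_gaussian_coordinate[of _ l, folded G_def] and two = std_gaussian_two_coordinates[of _ _ l m, folded G_def]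
  show "has_bochner_integral G (\<lambda>z. z $ l) 0"
    using one[of "\<lambda>x. x"] h(1) by (auto simp: has_bochner_integral_iff)
  show "has_bochner_integral G (\<lambda>z. z $ l * z $ m) (if l = m then 1 else 0)"
    using one[of "\<lambda>x. x\<^sup>2"] two[of "\<lambda>x. x" "\<lambda>x. x"] h(1,2)
    by (cases "l = m") (auto simp: has_bochner_integral_iff power2_eq_square)
  show "has_bochner_integral G (\<lambda>z. z $ l * (1 - (z $ m)\<^sup>2)) 0"
    using one[of "\<lambda>x. x * (1 - x\<^sup>2)"] two[of "\<lambda>x. x" "\<lambda>x. 1 - x\<^sup>2"] h(1,3,4)
    by (cases "l = m") (auto simp: has_bochner_integral_iff)
  show "has_bochner_integral G (\<lambda>z. (1 - (z $ l)\<^sup>2) * (1 - (z $ m)\<^sup>2)) (if l = m then 2 else 0)"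
    using one[of "\<lambda>x. (1 - x\<^sup>2)\<^sup>2"] two[of "\<lambda>x. 1 - x\<^sup>2" "\<lambda>x. 1 - x\<^sup>2"] h(3,5)
    by (cases "l = m") (auto simp: has_bochner_integral_iff power2_eq_square)
qed

lemma integrable_entry_density:
  "integrable lborel (\<lambda>x. entry_density a b i l x * x ^ k)"
proof -
  have "integrable lborel (\<lambda>x. (std_normal_density x * x ^ k) * indicator (entry_set a b i l) x)"
    by (intro integrable_real_mult_indicator integrable_std_normal_moment) simp
  then have "integrable lborel (\<lambda>x. (std_normal_density x * x ^ k) * indicator (entry_set a b i l) x / measure std_normal_distribution (entry_set a b i l))"
    by (rule integrable_divide)
  then show ?thesis by (simp add: entry_density_def mult_ac)
qed

lemma integral_entry_density:
  assumes "0 < b"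
  shows "(\<integral>x. entry_density a b i l x \<partial>lborel) = 1"
    and "(\<integral>x. entry_density a b i l x * x \<partial>lborel) = 0"
proof -
  have "(\<integral>x. entry_density a b i l x \<partial>lborel) =
     (\<integral>x. indicator (entry_set a b i l) x * std_normal_density x \<partial>lborel) / measure std_normal_distribution (entry_set a b i l)"
    by (simp add: entry_density_def)
  then show "(\<integral>x. entry_density a b i l x \<partial>lborel) = 1"
    using measure_entry_set_pos[OF assms, of a i l] by (simp add: measure_std_normal_eq)
  \<comment> \<open>Entry sets are symmetric about 0, so reflection turns the mean into its
    negative.\<close>
  have even: "entry_density a b i l (- x) = entry_density a b i l x" for x
    by (simp add: entry_density_def entry_set_def indicator_def)
  have "(\<integral>x. entry_density a b i l x * x \<partial>lborel) = - (\<integral>x. entry_density a b i l x * x \<partial>lborel)"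
    by (subst lborel_integral_real_affine[of "-1" _ 0]) (auto simp: even)
  then show "(\<integral>x. entry_density a b i l x * x \<partial>lborel) = 0" by simp
qed

text \<open>Used twice: c = a gives the full second moment of a diagonal entry, and c = sqrt 3 * a
  gives the part of it lost by truncation.\<close>

lemma diag_tail_moment:
  assumes "1 \<le> c" "0 \<le> a" "a \<le> c"
  shows "has_bochner_integral lborel (\<lambda>x. entry_density a b i i x * (indicator {x. c < \<bar>x\<bar>} x * x\<^sup>2))
     ((c * std_normal_density c + Q c) / Q a)"
proof -
  let ?f = "\<lambda>x. indicator {c..} x * (x\<^sup>2 * std_normal_density x)"
  have e: "entry_density a b i i x = indicator {x. a < \<bar>x\<bar>} x * std_normal_density x / (2 * Q a)" for x
    using assms by (simp add: entry_density_def entry_set_def measure_std_normal_tails)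
  note h = tail_integral_2[OF assms(1)]
  have "has_bochner_integral lborel (\<lambda>x. ?f (0 + (-1) * x)) ((c * std_normal_density c + Q c) /\<^sub>R \<bar>-1\<bar>)"
    using h by (subst lborel_has_bochner_integral_real_affine_iff[symmetric]) auto
  from has_bochner_integral_add[OF h this]
  have "has_bochner_integral lborel (\<lambda>x. ?f x + ?f (- x)) (2 * (c * std_normal_density c + Q c))" by simp
  then have "has_bochner_integral lborel (\<lambda>x. (?f x + ?f (- x)) / (2 * Q a)) (2 * (c * std_normal_density c + Q c) / (2 * Q a))"
    by (rule has_bochner_integral_divide_zero)
  also have "has_bochner_integral lborel (\<lambda>x. (?f x + ?f (- x)) / (2 * Q a)) (2 * (c * std_normal_density c + Q c) / (2 * Q a)) \<longleftrightarrow>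
    has_bochner_integral lborel (\<lambda>x. entry_density a b i i x * (indicator {x. c < \<bar>x\<bar>} x * x\<^sup>2)) (2 * (c * std_normal_density c + Q c) / (2 * Q a))"
  proof (rule has_bochner_integral_cong_AE)
    \<comment> \<open>The tail and its reflection cover both signs. Closed half-lines stand on the
      left and open ones on the right, so the points c and -c are excluded.\<close>
    show "AE x in lborel. (?f x + ?f (- x)) / (2 * Q a) = entry_density a b i i x * (indicator {x. c < \<bar>x\<bar>} x * x\<^sup>2)"
      using AE_lborel_singleton[of c] AE_lborel_singleton[of "-c"]
    proof eventually_elim
      case (elim x)
      then show ?case using assms
        by (auto simp: e indicator_def abs_if split: if_splits)
    qed
  qed measurable
  finally show ?thesis by (simp del: distrib_left_numeral)
qed

lemma diag_second_moment:
  assumes "1 \<le> a"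
  shows "(\<integral>x. entry_density a b i i x * x\<^sup>2 \<partial>lborel) = 1 + a * std_normal_density a / Q a"
proof -
  have "entry_density a b i i x * (indicator {x. a < \<bar>x\<bar>} x * x\<^sup>2) = entry_density a b i i x * x\<^sup>2" for x
    by (simp add: entry_density_def entry_set_def indicator_def)
  then show ?thesis
    using diag_tail_moment[of a a b i] assms Q_pos[of a] unfolding has_bochner_integral_iff
    by (simp only:) (simp add: add_divide_distrib)
qed

text \<open>Both follow from the Mills ratio bounds: a diagonal entry has second moment a^2 up to an
  additive constant, which is what makes the efficiency limit exact.\<close>

lemma diag_second_moment_bounds:
  assumes "1 \<le> a"
  shows "a\<^sup>2 \<le> 1 + a * std_normal_density a / Q a" "1 + a * std_normal_density a / Q a \<le> a\<^sup>2 + 2"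
proof -
  have "a * a * Q a \<le> a * std_normal_density a"
    using mult_left_mono[OF Q_upper[OF assms], of a] assms by (simp add: mult.assoc)
  then show "a\<^sup>2 \<le> 1 + a * std_normal_density a / Q a"
    using Q_pos[of a] by (simp add: field_simps power2_eq_square add_increasing)
  show "1 + a * std_normal_density a / Q a \<le> a\<^sup>2 + 2"
    using Q_lower[OF assms] Q_pos[of a] by (simp add: field_simps)
qed

lemma matrix_law_entry:
  fixes p q :: "'n::finite"
  assumes b: "0 < b" and [measurable]: "f \<in> borel_measurable borel" and int: "integrable lborel (\<lambda>x. entry_density a b p q x * f x)"
  shows "integrable (matrix_law a b) (\<lambda>W. f (W $ p $ q))"
    "(\<integral>W. f (W $ p $ q) \<partial>matrix_law a b) = (\<integral>x. entry_density a b p q x * f x \<partial>lborel)"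
proof -
  let ?h = "\<lambda>i l x. if i = p then if l = q then f x else 1 else 1"
  have "(\<Prod>l\<in>UNIV. ?h i l (W $ i $ l)) = (if i = p then f (W $ p $ q) else 1)" for W :: "real^'n^'n" and i by simp
  then have eq: "matrix_density a b W * f (W $ p $ q) = (\<Prod>i\<in>UNIV. \<Prod>l\<in>UNIV. entry_density a b i l (W $ i $ l) * ?h i l (W $ i $ l))" for W :: "real^'n^'n"
    by (simp add: matrix_density_def prod.distrib)
  have i: "integrable lborel (\<lambda>x. entry_density a b i l x * ?h i l x)" for i l
    using int integrable_entry_density[of a b i l 0] by (cases "i = p"; cases "l = q") auto
  show "integrable (matrix_law a b) (\<lambda>W. f (W $ p $ q))"
    unfolding matrix_law_def by (subst integrable_density) (auto simp: eq intro!: integrable_lborel_matrix i)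
  have "(\<integral>W. f (W $ p $ q) \<partial>matrix_law a b) = (\<Prod>i\<in>UNIV. \<Prod>l\<in>UNIV. \<integral>x. entry_density a b i l x * ?h i l x \<partial>lborel)"
    unfolding matrix_law_def by (subst integral_density) (auto simp: eq intro!: integral_lborel_matrix i)
  moreover have "(\<integral>x. entry_density a b i l x * ?h i l x \<partial>lborel) =
      (if i = p then if l = q then \<integral>x. entry_density a b p q x * f x \<partial>lborel else 1 else 1)" for i l
    using integral_entry_density[OF b, of a i l] by auto
  ultimately have "(\<integral>W. f (W $ p $ q) \<partial>matrix_law a b) =
      (\<Prod>i\<in>UNIV. \<Prod>l\<in>UNIV. if i = p then if l = q then \<integral>x. entry_density a b p q x * f x \<partial>lborel else 1 else 1)"
    by (simp only:)
  moreover have "(\<Prod>l\<in>UNIV. if i = p then if l = q then \<integral>x. entry_density a b p q x * f x \<partial>lborel else 1 else 1) =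
     (if i = p then \<integral>x. entry_density a b p q x * f x \<partial>lborel else 1)" for i
    by simp
  ultimately show "(\<integral>W. f (W $ p $ q) \<partial>matrix_law a b) = (\<integral>x. entry_density a b p q x * f x \<partial>lborel)"
    by simp
qed

lemma matrix_law_uncorrelated:
  fixes p p' q :: "'n::finite"
  assumes b: "0 < b" and ne: "p \<noteq> p'"
  shows "integrable (matrix_law a b) (\<lambda>W. W $ p $ q * W $ p' $ q)"
    "(\<integral>W. W $ p $ q * W $ p' $ q \<partial>matrix_law a b) = 0"
proof -
  let ?h = "\<lambda>i l x. if i = p then (if l = q then x else 1) else if i = p' then (if l = q then x else 1) else 1 :: real"
  have "(\<Prod>l\<in>UNIV. ?h i l (W $ i $ l)) = (if i = p then W $ p $ q else if i = p' then W $ p' $ q else 1)" for W :: "real^'n^'n" and i by simp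
  then have eq: "matrix_density a b W * (W $ p $ q * W $ p' $ q) = (\<Prod>i\<in>UNIV. \<Prod>l\<in>UNIV. entry_density a b i l (W $ i $ l) * ?h i l (W $ i $ l))" for W :: "real^'n^'n"
    by (simp only: matrix_density_def prod.distrib prod_delta2[OF ne])
  have i: "integrable lborel (\<lambda>x. entry_density a b i l x * ?h i l x)" for i l
    using integrable_entry_density[of a b i l 0] integrable_entry_density[of a b i l 1] by (cases "i = p"; cases "i = p'"; cases "l = q") auto
  show "integrable (matrix_law a b) (\<lambda>W. W $ p $ q * W $ p' $ q)"
    unfolding matrix_law_def by (subst integrable_density) (auto simp only: eq real_scaleR_def intro!: integrable_lborel_matrix i, auto)
  have "(\<integral>W. W $ p $ q * W $ p' $ q \<partial>matrix_law a b) = (\<Prod>i\<in>UNIV. \<Prod>l\<in>UNIV. \<integral>x. entry_density a b i l x * ?h i l x \<partial>lborel)"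
    unfolding matrix_law_def by (subst integral_density) (auto simp only: eq real_scaleR_def intro!: integral_lborel_matrix i, auto)
  also have "\<dots> = 0"
  proof (rule prod_zero)
    have "(\<Prod>l\<in>UNIV. \<integral>x. entry_density a b p l x * ?h p l x \<partial>lborel) = 0"
      by (rule prod_zero) (auto intro!: exI[of _ q] simp: integral_entry_density[OF b])
    then show "\<exists>i\<in>UNIV. (\<Prod>l\<in>UNIV. \<integral>x. entry_density a b i l x * ?h i l x \<partial>lborel) = 0" by blast
  qed simp
  finally show "(\<integral>W. W $ p $ q * W $ p' $ q \<partial>matrix_law a b) = 0" .
qed

text \<open>Entries are independent and centred, so the expectation of W times its transpose is a
  multiple of the identity. This is the multiple: one diagonal second moment and d - 1 off-diagonal
  ones. The type argument supplies d.\<close>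

definition column_moment :: "'n::finite itself \<Rightarrow> real \<Rightarrow> real \<Rightarrow> real" where
  "column_moment T a b = (1 + a * std_normal_density a / Q a) +
     (real CARD('n) - 1) * ((\<integral>x. indicator {x. \<bar>x\<bar> < b} x * std_normal_density x * x\<^sup>2 \<partial>lborel) / (1 - 2 * Q b))"

lemma matrix_law_second_moment:
  fixes p p' :: "'n::finite"
  assumes b: "0 < b" and a: "1 \<le> a"
  shows "has_bochner_integral (matrix_law a b) (\<lambda>W. \<Sum>q\<in>UNIV. W $ p $ q * W $ p' $ q)
    (if p = p' then column_moment TYPE('n) a b else 0)"
proof (cases "p = p'")
  case False
  then show ?thesis
    using matrix_law_uncorrelated[OF b False, of a] by (simp add: has_bochner_integral_iff)
next
  case True
  have *: "has_bochner_integral (matrix_law a b) (\<lambda>W. W $ p $ q * W $ p $ q) (\<integral>x. entry_density a b p q x * x\<^sup>2 \<partial>lborel)" for q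
    using matrix_law_entry[OF b _ integrable_entry_density[of a b p q 2]] by (simp add: has_bochner_integral_iff power2_eq_square)
  have off: "(\<integral>x. entry_density a b p q x * x\<^sup>2 \<partial>lborel) =
      (\<integral>x. indicator {x. \<bar>x\<bar> < b} x * std_normal_density x * x\<^sup>2 \<partial>lborel) / (1 - 2 * Q b)" if "q \<noteq> p" for q
    using that b by (simp add: entry_density_def entry_set_def measure_std_normal_bulk)
  have "has_bochner_integral (matrix_law a b) (\<lambda>W. \<Sum>q\<in>UNIV. W $ p $ q * W $ p $ q) (\<Sum>q\<in>UNIV. \<integral>x. entry_density a b p q x * x\<^sup>2 \<partial>lborel)"
    by (intro has_bochner_integral_sum *)
  also have "(\<Sum>q\<in>UNIV. \<integral>x. entry_density a b p q x * x\<^sup>2 \<partial>lborel) = column_moment TYPE('n) a b"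
    by (subst sum.remove[of _ p]) (auto simp: diag_second_moment[OF a] off column_moment_def of_nat_diff)
  finally show ?thesis using True by simp
qed

lemma AE_matrix_law:
  "AE W in matrix_law a b. \<forall>i l. W $ i $ l \<in> entry_set a b i l"
proof -
  have "W $ i $ l \<in> entry_set a b i l" if "0 < matrix_density a b W" for W :: "real^'n^'n" and i l
  proof (rule ccontr)
    assume "W $ i $ l \<notin> entry_set a b i l"
    then have "entry_density a b i l (W $ i $ l) = 0" by (simp add: entry_density_def)
    then have "(\<Prod>l\<in>UNIV. entry_density a b i l (W $ i $ l)) = 0" by (subst prod_zero_iff) auto
    then have "matrix_density a b W = 0" unfolding matrix_density_def by (subst prod_zero_iff) auto
    with that show False by simp
  qed
  then show ?thesis unfolding matrix_law_def by (subst AE_density) auto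
qed

lemma has_bochner_integral_pair_mult:
  fixes f :: "'a \<Rightarrow> real" and g :: "'b \<Rightarrow> real"
  assumes "prob_space M1" "prob_space M2" and f: "has_bochner_integral M1 f x" and g: "has_bochner_integral M2 g y"
  shows "has_bochner_integral (M1 \<Otimes>\<^sub>M M2) (\<lambda>(s, t). f s * g t) (x * y)"
proof -
  interpret M1: prob_space M1 by fact
  interpret M2: prob_space M2 by fact
  interpret P: pair_prob_space M1 M2 by unfold_locales
  have i: "integrable M1 f" "integrable M2 g" and v: "(\<integral>s. f s \<partial>M1) = x" "(\<integral>t. g t \<partial>M2) = y"
    using f g by (auto simp: has_bochner_integral_iff)
  have [measurable]: "f \<in> borel_measurable M1" "g \<in> borel_measurable M2" using i by auto
  have int: "integrable (M1 \<Otimes>\<^sub>M M2) (\<lambda>(s, t). f s * g t)"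
    using i by (intro P.Fubini_integrable) (auto simp: abs_mult intro!: integrable_mult_left)
  have "(\<integral>x. (case x of (s, t) \<Rightarrow> f s * g t) \<partial>(M1 \<Otimes>\<^sub>M M2)) = (\<integral>s. \<integral>t. f s * g t \<partial>M2 \<partial>M1)"
    using P.integral_fst'[OF int] by simp
  also have "\<dots> = x * y" using i v by simp
  finally show ?thesis using int by (simp add: has_bochner_integral_iff)
qed

section \<open>Quantization\<close>

lemma cell_index_le: "cell_index lo hi N w \<le> N - 1"
  by (simp add: cell_index_def)

text \<open>Valid for every real w: \<open>nat\<close> sends negative positions to cell 0 and
  \<open>min\<close> caps at the last cell. Hence the quantized matrix obeys its entry bounds
  everywhere, not just almost surely.\<close>

lemma cell_quantize_bounds:
  assumes "lo < hi" "1 \<le> N" "\<And>j. 0 \<le> \<theta> j \<and> \<theta> j \<le> 1"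
  shows "lo \<le> cell_quantize lo hi N \<theta> w" "cell_quantize lo hi N \<theta> w \<le> hi"
proof -
  let ?j = "cell_index lo hi N w"
  have j: "real ?j + \<theta> ?j \<le> real N"
    using cell_index_le[of lo hi N w] assms(2) assms(3)[of ?j] by linarith
  have "(real ?j + \<theta> ?j) * (hi - lo) \<le> real N * (hi - lo)"
    using j assms(1) by (intro mult_right_mono) auto
  then have "(real ?j + \<theta> ?j) * (hi - lo) / real N \<le> hi - lo"
    using assms(2) by (simp add: divide_le_eq mult.commute)
  then show "cell_quantize lo hi N \<theta> w \<le> hi" by (simp add: cell_quantize_def Let_def)
  have "0 \<le> (real ?j + \<theta> ?j) * (hi - lo) / real N"
    using assms by (intro divide_nonneg_nonneg mult_nonneg_nonneg) auto
  then show "lo \<le> cell_quantize lo hi N \<theta> w" by (simp add: cell_quantize_def Let_def)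
qed

lemma cell_quantize_error:
  assumes "lo < hi" "1 \<le> N" "\<And>j. 0 \<le> \<theta> j \<and> \<theta> j \<le> 1" "lo \<le> w" "w \<le> hi"
  shows "\<bar>cell_quantize lo hi N \<theta> w - w\<bar> \<le> (hi - lo) / real N"
proof -
  define x where "x = (w - lo) * real N / (hi - lo)"
  let ?j = "cell_index lo hi N w"
  have x0: "0 \<le> x" using assms by (simp add: x_def)
  have xN: "x \<le> real N" using assms by (simp add: x_def divide_le_eq mult.commute mult_left_mono)
  have fl: "real (nat \<lfloor>x\<rfloor>) = of_int \<lfloor>x\<rfloor>" using x0 by simp
  have j: "?j = min (N - 1) (nat \<lfloor>x\<rfloor>)" by (simp add: cell_index_def x_def)
  have "real ?j \<le> x" using fl of_int_floor_le[of x] j by linarith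
  moreover have "x \<le> real ?j + 1"
  proof (cases "nat \<lfloor>x\<rfloor> \<le> N - 1")
    case True
    then show ?thesis using j fl floor_correct[of x] by (simp add: min_def)
  next
    \<comment> \<open>This occurs only at the right endpoint w = hi, where x = N and the cap assigns
      the last cell.\<close>
    case False
    then show ?thesis using j xN assms(2) by (simp add: min_def)
  qed
  ultimately have "\<bar>real ?j + \<theta> ?j - x\<bar> \<le> 1" using assms(3)[of ?j] by (simp add: abs_le_iff)
  moreover have "cell_quantize lo hi N \<theta> w - w = (real ?j + \<theta> ?j - x) * ((hi - lo) / real N)"
    using assms(1,2) by (simp add: cell_quantize_def Let_def x_def field_simps)
  moreover have "0 \<le> (hi - lo) / real N" using assms(1) by simp
  ultimately show ?thesis
    using mult_right_mono[of "\<bar>real ?j + \<theta> ?j - x\<bar>" 1 "(hi - lo) / real N"] by (simp only: abs_mult abs_of_nonneg mult_1)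
qed

text \<open>Each sign owns 2^(n - 1) cells, so the cell width is (sqrt 3 - 1) a / 2^(n - 1). The
  lower bound a holds for any input and later yields invertibility.\<close>

lemma diag_quantize_cases:
  assumes a: "0 < a" and \<theta>: "\<And>j. 0 \<le> \<theta> j \<and> \<theta> j \<le> 1"
  shows diag_quantize_ge: "a \<le> \<bar>diag_quantize a n \<theta> w\<bar>"
    and diag_quantize_le: "\<bar>diag_quantize a n \<theta> w\<bar> \<le> sqrt 3 * a"
    and diag_quantize_truncated_error: "a \<le> \<bar>w\<bar> \<Longrightarrow>
      \<bar>diag_quantize a n \<theta> w - (if \<bar>w\<bar> > sqrt 3 * a then sgn w * (sqrt 3 * a) else w)\<bar> \<le> (sqrt 3 - 1) * a / 2 ^ (n - 1)"
proof -
  define c where "c = sqrt 3 * a"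
  define v where "v = (if \<bar>w\<bar> > c then sgn w * c else w)"
  have s3: "1 < sqrt 3" by (rule real_less_rsqrt) simp
  then have c: "a < c" using a by (simp add: c_def)
  have N: "1 \<le> (2::nat) ^ (n - 1)" by simp
  have q: "diag_quantize a n \<theta> w = (if v < 0 then cell_quantize (- c) (- a) (2 ^ (n - 1)) \<theta> v
         else cell_quantize a c (2 ^ (n - 1)) (\<lambda>j. \<theta> (2 ^ (n - 1) + j)) v)"
    unfolding diag_quantize_def Let_def c_def[symmetric] v_def[symmetric] ..
  note b1 = cell_quantize_bounds[of "-c" "-a" "2^(n-1)" \<theta> v] and b2 = cell_quantize_bounds[of a c "2^(n-1)" "\<lambda>j. \<theta> (2 ^ (n - 1) + j)" v]
  show "a \<le> \<bar>diag_quantize a n \<theta> w\<bar>" "\<bar>diag_quantize a n \<theta> w\<bar> \<le> sqrt 3 * a"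
    unfolding q c_def[symmetric] using b1 b2 c a \<theta> N by (auto simp: abs_if)
  assume w: "a \<le> \<bar>w\<bar>"
  have v: "a \<le> \<bar>v\<bar>" "\<bar>v\<bar> \<le> c" using w c a by (auto simp: v_def abs_mult sgn_if)
  have "\<bar>diag_quantize a n \<theta> w - v\<bar> \<le> (c - a) / 2 ^ (n - 1)"
  proof (cases "v < 0")
    case True
    then show ?thesis
      using cell_quantize_error[of "-c" "-a" "2^(n-1)" \<theta> v] v c \<theta> N by (simp add: q)
  next
    case False
    then show ?thesis
      using cell_quantize_error[of a c "2^(n-1)" "\<lambda>j. \<theta> (2 ^ (n - 1) + j)" v] v c \<theta> N by (simp add: q)
  qed
  then show "\<bar>diag_quantize a n \<theta> w - (if \<bar>w\<bar> > sqrt 3 * a then sgn w * (sqrt 3 * a) else w)\<bar> \<le> (sqrt 3 - 1) * a / 2 ^ (n - 1)"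
    unfolding v_def c_def by (simp only: left_diff_distrib mult_1)
qed

text \<open>Truncation affects the two bounds differently. The distance to w must pay for the
  overshoot, which is at most |w|, whereas the square pays nothing, since truncation only shrinks
  |w|.\<close>

lemma diag_quantize_error:
  assumes a: "0 < a" and \<theta>: "\<And>j. 0 \<le> \<theta> j \<and> \<theta> j \<le> 1" and w: "a \<le> \<bar>w\<bar>"
  shows "\<bar>w - diag_quantize a n \<theta> w\<bar> \<le> (sqrt 3 - 1) * a / 2 ^ (n - 1) + indicator {x. sqrt 3 * a < \<bar>x\<bar>} w * \<bar>w\<bar>"
    and "(diag_quantize a n \<theta> w)\<^sup>2 \<le> w\<^sup>2 + 2 * (sqrt 3 * a) * ((sqrt 3 - 1) * a / 2 ^ (n - 1)) + ((sqrt 3 - 1) * a / 2 ^ (n - 1))\<^sup>2"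
proof -
  define v where "v = (if \<bar>w\<bar> > sqrt 3 * a then sgn w * (sqrt 3 * a) else w)"
  define D where "D = diag_quantize a n \<theta> w"
  define \<eta> where "\<eta> = (sqrt 3 - 1) * a / 2 ^ (n - 1)"
  have e: "\<bar>D - v\<bar> \<le> \<eta>" using diag_quantize_truncated_error[OF a \<theta> w] by (simp add: v_def D_def \<eta>_def)
  have c: "0 < sqrt 3 * a" using a by simp
  have vw: "\<bar>w - v\<bar> \<le> indicator {x. sqrt 3 * a < \<bar>x\<bar>} w * \<bar>w\<bar>"
  proof (cases "\<bar>w\<bar> > sqrt 3 * a")
    case True
    have "w - sgn w * (sqrt 3 * a) = sgn w * (\<bar>w\<bar> - sqrt 3 * a)"
      by (simp add: sgn_if abs_if algebra_simps)
    then have "\<bar>w - sgn w * (sqrt 3 * a)\<bar> \<le> \<bar>\<bar>w\<bar> - sqrt 3 * a\<bar>"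
      by (simp only: abs_mult) (simp add: abs_sgn_eq)
    then show ?thesis using True c by (simp add: v_def)
  qed (simp add: v_def)
  have "\<bar>w - D\<bar> \<le> \<eta> + indicator {x. sqrt 3 * a < \<bar>x\<bar>} w * \<bar>w\<bar>" using e vw by linarith
  then show "\<bar>w - diag_quantize a n \<theta> w\<bar> \<le> (sqrt 3 - 1) * a / 2 ^ (n - 1) + indicator {x. sqrt 3 * a < \<bar>x\<bar>} w * \<bar>w\<bar>"
    by (simp add: D_def \<eta>_def)
  have v: "\<bar>v\<bar> \<le> \<bar>w\<bar>" "\<bar>v\<bar> \<le> sqrt 3 * a" using c a by (auto simp: v_def sgn_if abs_mult)
  have \<eta>0: "0 \<le> \<eta>" using e by linarith
  have "D\<^sup>2 = \<bar>D\<bar>\<^sup>2" by simp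
  also have "\<dots> \<le> (\<bar>v\<bar> + \<eta>)\<^sup>2" using e by (intro power_mono) auto
  also have "\<dots> = \<bar>v\<bar>\<^sup>2 + 2 * \<bar>v\<bar> * \<eta> + \<eta>\<^sup>2" by (simp add: power2_sum)
  also have "\<dots> \<le> w\<^sup>2 + 2 * (sqrt 3 * a) * \<eta> + \<eta>\<^sup>2"
    using v \<eta>0 by (intro add_mono mult_right_mono) (auto simp: abs_le_square_iff[symmetric])
  finally show "(diag_quantize a n \<theta> w)\<^sup>2 \<le> w\<^sup>2 + 2 * (sqrt 3 * a) * ((sqrt 3 - 1) * a / 2 ^ (n - 1)) + ((sqrt 3 - 1) * a / 2 ^ (n - 1))\<^sup>2"
    by (simp add: D_def \<eta>_def)
qed

lemma offdiag_quantize_bounds: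
  assumes b: "0 < b" and \<theta>: "\<And>j. 0 \<le> \<theta> j \<and> \<theta> j \<le> 1"
  shows "\<bar>offdiag_quantize b n \<theta> w\<bar> \<le> b"
    and "\<bar>w\<bar> < b \<Longrightarrow> \<bar>w - offdiag_quantize b n \<theta> w\<bar> \<le> 2 * b / 2 ^ n"
  using cell_quantize_bounds[of "-b" b "2^n" \<theta> w] cell_quantize_error[of "-b" b "2^n" \<theta> w] assms
  by (auto simp: offdiag_quantize_def abs_le_iff abs_minus_commute)

lemma measurable_cell_quantize[measurable]: "cell_quantize lo hi N \<theta> \<in> borel_measurable borel"
proof -
  have [measurable]: "cell_index lo hi N \<in> measurable borel (count_space UNIV)"
    unfolding cell_index_def by measurable
  show ?thesis unfolding cell_quantize_def Let_def by measurable
qed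

lemma measurable_diag_quantize[measurable]: "diag_quantize a n \<theta> \<in> borel_measurable borel"
  unfolding diag_quantize_def Let_def by measurable

lemma measurable_offdiag_quantize[measurable]: "offdiag_quantize b n \<theta> \<in> borel_measurable borel"
  unfolding offdiag_quantize_def by measurable

lemma finite_range_cell_quantize: "finite (range (cell_quantize lo hi N \<theta>))"
proof (rule finite_subset)
  show "range (cell_quantize lo hi N \<theta>) \<subseteq> (\<lambda>j. lo + (real j + \<theta> j) * (hi - lo) / real N) ` {..N - 1}"
    using cell_index_le by (auto simp: cell_quantize_def Let_def)
qed simp

lemma finite_range_diag_quantize: "finite (range (diag_quantize a n \<theta>))"
proof (rule finite_subset)
  let ?c = "sqrt 3 * a" and ?N = "2 ^ (n - 1) :: nat"
  show "range (diag_quantize a n \<theta>) \<subseteq> range (cell_quantize (- ?c) (- a) ?N \<theta>) \<union> range (cell_quantize a ?c ?N (\<lambda>j. \<theta> (?N + j)))"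
    by (auto simp: diag_quantize_def Let_def)
qed (simp add: finite_range_cell_quantize)

lemma finite_matrices:
  assumes "finite F"
  shows "finite {A :: real^'n^'m. \<forall>i j. A $ i $ j \<in> F}"
proof (rule finite_subset)
  show "{A :: real^'n^'m. \<forall>i j. A $ i $ j \<in> F} \<subseteq> (\<lambda>f. \<chi> i j. f (i, j)) ` (PiE UNIV (\<lambda>_. F))"
  proof
    fix A :: "real^'n^'m" assume "A \<in> {A. \<forall>i j. A $ i $ j \<in> F}"
    then show "A \<in> (\<lambda>f. \<chi> i j. f (i, j)) ` (PiE UNIV (\<lambda>_. F))"
      by (intro image_eqI[of _ _ "\<lambda>(i, j). A $ i $ j"]) (auto simp: vec_eq_iff)
  qed
  show "finite ((\<lambda>f. (\<chi> i j. f (i, j)) :: real^'n^'m) ` (PiE UNIV (\<lambda>_. F)))"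
    using assms by (intro finite_imageI finite_PiE) auto
qed

lemma measurable_quantize_matrix[measurable]: "quantize_matrix a b n \<theta> \<in> borel_measurable borel"
  unfolding quantize_matrix_def
  by (intro borel_measurable_vec_lambda) (auto intro!: measurable_If)

text \<open>Measurability of the matrix inverse is not needed: only finitely many matrices occur.\<close>

lemma measurable_quantize_comp:
  fixes f :: "real^'n^'n \<Rightarrow> 'b::topological_space"
  shows "(\<lambda>W. f (quantize_matrix a b n \<theta> W)) \<in> borel_measurable borel"
proof -
  let ?F = "(\<Union>i::'n. \<Union>j. range (diag_quantize a n (\<theta> i j))) \<union> (\<Union>i::'n. \<Union>j. range (offdiag_quantize b n (\<theta> i j)))"
  have "finite ?F"
    by (auto simp: finite_range_diag_quantize offdiag_quantize_def[abs_def] finite_range_cell_quantize)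
  moreover have "quantize_matrix a b n \<theta> ` space borel \<subseteq> {A. \<forall>i j. A $ i $ j \<in> ?F}"
  proof (intro subsetI, elim imageE, hypsubst, unfold mem_Collect_eq, intro allI)
    fix W :: "real^'n^'n" and i j
    have "diag_quantize a n (\<theta> i j) (W $ i $ j) \<in> ?F" "offdiag_quantize b n (\<theta> i j) (W $ i $ j) \<in> ?F" by blast+
    then show "quantize_matrix a b n \<theta> W $ i $ j \<in> ?F"
      by (cases "i = j") (simp_all only: quantize_matrix_def vec_lambda_beta if_True if_False refl)
  qed
  ultimately have "finite (quantize_matrix a b n \<theta> ` space borel)"
    using finite_matrices finite_subset by blast
  then have "simple_function borel (quantize_matrix a b n \<theta>)"
    by (intro simple_function_borel_measurable) auto
  then have "simple_function borel (\<lambda>W. f (quantize_matrix a b n \<theta> W))"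
    by (rule simple_function_compose1)
  from measurable_compose[OF measurable_simple_function[OF this], of "\<lambda>x. x" borel] show ?thesis by simp
qed

section \<open>Frobenius norm and inverses of nearly diagonal matrices\<close>

lemma norm_matrix_vector_mult_le: "norm (A *v x) \<le> norm A * norm (x :: real^'n)" for A :: "real^'n^'m"
proof -
  have "norm (A *v x) = L2_set (\<lambda>i. norm ((A *v x) $ i)) UNIV" by (simp add: norm_vec_def)
  also have "\<dots> \<le> L2_set (\<lambda>i. norm (A $ i) * norm x) UNIV"
    by (intro L2_set_mono) (auto simp: matrix_vector_mul_component intro: Cauchy_Schwarz_ineq2)
  also have "\<dots> = norm A * norm x" by (simp add: norm_vec_def[of A] L2_set_left_distrib)
  finally show ?thesis .
qed

lemma norm_matrix_sq: "(norm A)\<^sup>2 = (\<Sum>i\<in>UNIV. \<Sum>j\<in>UNIV. (A $ i $ j)\<^sup>2)" for A :: "real^'n^'m"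
  by (simp add: norm_vec_def L2_set_def sum_nonneg)

lemma norm_matrix_le:
  fixes A :: "real^'n^'n"
  assumes "\<And>i j. \<bar>A $ i $ j\<bar> \<le> b"
  shows "norm A \<le> real CARD('n) * b"
proof (rule power2_le_imp_le)
  have "(A $ i $ j)\<^sup>2 \<le> b\<^sup>2" for i j
    using power_mono[OF assms[of i j], of 2] by simp
  then have "(norm A)\<^sup>2 \<le> (\<Sum>i\<in>(UNIV::'n set). \<Sum>j\<in>(UNIV::'n set). b\<^sup>2)"
    unfolding norm_matrix_sq by (intro sum_mono)
  then show "(norm A)\<^sup>2 \<le> (real CARD('n) * b)\<^sup>2" by (simp add: power_mult_distrib power2_eq_square mult_ac)
  show "0 \<le> real CARD('n) * b" using assms[of undefined undefined] by simp
qed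

text \<open>Split A into its diagonal and the rest. The rest has Frobenius norm at most d b and so
  perturbs the action of the diagonal by at most d b |x|.\<close>

lemma near_diagonal_bounds:
  fixes A :: "real^'n^'n"
  assumes off: "\<And>i j. i \<noteq> j \<Longrightarrow> \<bar>A $ i $ j\<bar> \<le> b" and b: "0 \<le> b"
  shows "(\<And>i. a \<le> \<bar>A $ i $ i\<bar>) \<Longrightarrow> 0 \<le> a \<Longrightarrow> (a - real CARD('n) * b) * norm x \<le> norm (A *v x)"
    and "(\<And>i. \<bar>A $ i $ i\<bar> \<le> m) \<Longrightarrow> norm (A *v x) \<le> (m + real CARD('n) * b) * norm x"
proof -
  define B where "B = (\<chi> i j. if i = j then 0 else A $ i $ j)"
  define D where "D = (\<chi> i. A $ i $ i * x $ i)"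
  have split: "A *v x = D + B *v x"
  proof -
    have "(A *v x) $ i = D $ i + (B *v x) $ i" for i
    proof -
      have "(A *v x) $ i = (\<Sum>j\<in>UNIV. (if j = i then A $ i $ i * x $ i else 0) + B $ i $ j * x $ j)"
        unfolding matrix_vector_mult_def by (auto simp: B_def intro!: sum.cong)
      then show ?thesis by (simp add: D_def matrix_vector_mult_def sum.distrib)
    qed
    then show ?thesis by (simp add: vec_eq_iff)
  qed
  have "norm B \<le> real CARD('n) * b"
    using off b by (intro norm_matrix_le) (auto simp: B_def)
  then have B: "norm (B *v x) \<le> real CARD('n) * b * norm x"
    using norm_matrix_vector_mult_le[of B x] by (meson mult_right_mono norm_ge_zero order_trans)
  show "(a - real CARD('n) * b) * norm x \<le> norm (A *v x)" if "\<And>i. a \<le> \<bar>A $ i $ i\<bar>" "0 \<le> a"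
  proof -
    have "norm (a *\<^sub>R x) \<le> norm D"
      using that by (intro norm_le_componentwise_cart) (auto simp: D_def abs_mult mult_right_mono)
    then have "a * norm x \<le> norm D" using that by simp
    moreover have "norm D \<le> norm (A *v x) + norm (B *v x)"
      using norm_triangle_ineq4[of "A *v x" "B *v x"] by (simp add: split)
    ultimately show ?thesis using B by (simp add: left_diff_distrib)
  qed
  show "norm (A *v x) \<le> (m + real CARD('n) * b) * norm x" if "\<And>i. \<bar>A $ i $ i\<bar> \<le> m"
  proof -
    have "0 \<le> m" using that[of undefined] by simp
    then have "norm D \<le> norm (m *\<^sub>R x)"
      using that by (intro norm_le_componentwise_cart) (auto simp: D_def abs_mult mult_right_mono)
    then have "norm D \<le> m * norm x" using \<open>0 \<le> m\<close> by simp
    then show ?thesis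
      using B norm_triangle_ineq[of D "B *v x"] by (simp add: split distrib_right)
  qed
qed

text \<open>The lower bound of \<open>near_diagonal_bounds\<close> makes A injective, and applied to
  A^-1 x it bounds the inverse.\<close>

lemma near_diagonal_invertible:
  fixes A :: "real^'n^'n"
  assumes off: "\<And>i j. i \<noteq> j \<Longrightarrow> \<bar>A $ i $ j\<bar> \<le> b" and b: "0 \<le> b"
    and diag: "\<And>i. a \<le> \<bar>A $ i $ i\<bar>" and ab: "real CARD('n) * b < a"
  shows "invertible A" "norm (matrix_inv A *v x) \<le> norm x / (a - real CARD('n) * b)"
proof -
  have a: "0 \<le> a" using ab b by (meson less_imp_le mult_nonneg_nonneg of_nat_0_le_iff order_trans)
  note lower = near_diagonal_bounds(1)[OF off b diag a]
  have "x = 0" if "A *v x = 0" for x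
  proof -
    have "(a - real CARD('n) * b) * norm x \<le> 0" using lower[of x] that by simp
    then show ?thesis using ab by (simp add: mult_le_0_iff)
  qed
  then show inv: "invertible A"
    unfolding invertible_left_inverse matrix_left_invertible_ker by blast
  show "norm (matrix_inv A *v x) \<le> norm x / (a - real CARD('n) * b)"
    using lower[of "matrix_inv A *v x"] ab by (simp add: matrix_inv_mult[OF inv] pos_le_divide_eq mult.commute)
qed

section \<open>Moments of the estimator\<close>

lemma inner_vec_eq_sum: "v \<bullet> x = (\<Sum>i\<in>UNIV. v $ i * x $ i)" for v x :: "real^'n"
  by (simp add: inner_vec_def)

lemma integrable_mult_if_square_integrable:
  fixes f g :: "'a \<Rightarrow> real"
  assumes [measurable]: "f \<in> borel_measurable M" "g \<in> borel_measurable M"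
    and sq: "integrable M (\<lambda>x. (f x)\<^sup>2)" "integrable M (\<lambda>x. (g x)\<^sup>2)"
  shows "integrable M (\<lambda>x. f x * g x)"
proof (rule Bochner_Integration.integrable_bound)
  show "integrable M (\<lambda>x. (f x)\<^sup>2 + (g x)\<^sup>2)" using sq by simp
  show "AE x in M. norm (f x * g x) \<le> norm ((f x)\<^sup>2 + (g x)\<^sup>2)"
  proof (rule AE_I2)
    fix x
    have "2 * (\<bar>f x\<bar> * \<bar>g x\<bar>) \<le> \<bar>f x\<bar>\<^sup>2 + \<bar>g x\<bar>\<^sup>2"
      using sum_squares_bound[of "\<bar>f x\<bar>" "\<bar>g x\<bar>"] by (simp add: mult.assoc)
    moreover have "0 \<le> \<bar>f x\<bar> * \<bar>g x\<bar>" by simp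
    moreover have "norm (f x * g x) = \<bar>f x\<bar> * \<bar>g x\<bar>" "norm ((f x)\<^sup>2 + (g x)\<^sup>2) = \<bar>f x\<bar>\<^sup>2 + \<bar>g x\<bar>\<^sup>2"
      by (simp_all add: abs_mult)
    ultimately show "norm (f x * g x) \<le> norm ((f x)\<^sup>2 + (g x)\<^sup>2)" by linarith
  qed
qed measurable

lemma (in prob_space) square_expectation_le:
  fixes f :: "'a \<Rightarrow> real"
  assumes "f \<in> borel_measurable M" "integrable M (\<lambda>x. (f x)\<^sup>2)"
  shows "(expectation f)\<^sup>2 \<le> expectation (\<lambda>x. (f x)\<^sup>2)"
proof -
  have "0 \<le> variance f" by (rule integral_nonneg_AE) simp
  then show ?thesis using variance_eq[OF square_integrable_imp_integrable[OF assms] assms(2)] by simp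
qed

lemma covariance_matrix_quadratic_form:
  fixes V :: "'w \<Rightarrow> real^'n"
  assumes "prob_space M" and [measurable]: "V \<in> borel_measurable M"
    and sq: "\<And>i. integrable M (\<lambda>\<omega>. (V \<omega> $ i)\<^sup>2)"
  shows "v \<bullet> (covariance_matrix M V *v v) = (\<integral>\<omega>. (v \<bullet> V \<omega>)\<^sup>2 \<partial>M) - (\<integral>\<omega>. v \<bullet> V \<omega> \<partial>M)\<^sup>2"
proof -
  interpret prob_space M by fact
  have i1: "integrable M (\<lambda>\<omega>. V \<omega> $ i)" for i
    by (rule square_integrable_imp_integrable[OF _ sq]) measurable
  have i2: "integrable M (\<lambda>\<omega>. V \<omega> $ i * V \<omega> $ j)" for i j
    by (intro integrable_mult_if_square_integrable sq) measurable
  define m where "m i = (\<integral>\<omega>. V \<omega> $ i \<partial>M)" for i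
  have cov: "covariance_matrix M V $ i $ j = (\<integral>\<omega>. V \<omega> $ i * V \<omega> $ j \<partial>M) - m i * m j" for i j
  proof -
    have "covariance_matrix M V $ i $ j = (\<integral>\<omega>. (V \<omega> $ i - m i) * (V \<omega> $ j - m j) \<partial>M)"
      by (simp add: covariance_matrix_def m_def)
    also have "\<dots> = (\<integral>\<omega>. V \<omega> $ i * V \<omega> $ j - m j * V \<omega> $ i - m i * V \<omega> $ j + m i * m j \<partial>M)"
      by (intro Bochner_Integration.integral_cong) (auto simp: algebra_simps)
    also have "\<dots> = (\<integral>\<omega>. V \<omega> $ i * V \<omega> $ j \<partial>M) - m i * m j"
      using i1 i2 by (simp add: prob_space m_def)
    finally show ?thesis .
  qed
  have lin: "(\<integral>\<omega>. v \<bullet> V \<omega> \<partial>M) = (\<Sum>i\<in>UNIV. v $ i * m i)"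
    unfolding inner_vec_eq_sum using i1 by (simp add: m_def)
  have "(v \<bullet> V \<omega>)\<^sup>2 = (\<Sum>i\<in>UNIV. \<Sum>j\<in>UNIV. v $ i * v $ j * (V \<omega> $ i * V \<omega> $ j))" for \<omega>
    by (simp add: inner_vec_eq_sum power2_eq_square sum_product mult_ac)
  then have quad: "(\<integral>\<omega>. (v \<bullet> V \<omega>)\<^sup>2 \<partial>M) = (\<Sum>i\<in>UNIV. \<Sum>j\<in>UNIV. v $ i * v $ j * (\<integral>\<omega>. V \<omega> $ i * V \<omega> $ j \<partial>M))"
    using i2 by simp
  have "v \<bullet> (covariance_matrix M V *v v) = (\<Sum>i\<in>UNIV. \<Sum>j\<in>UNIV. v $ i * v $ j * covariance_matrix M V $ i $ j)"
    by (simp add: inner_vec_eq_sum matrix_vector_mult_def sum_distrib_left mult_ac)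
  also have "\<dots> = (\<integral>\<omega>. (v \<bullet> V \<omega>)\<^sup>2 \<partial>M) - (\<Sum>i\<in>UNIV. \<Sum>j\<in>UNIV. (v $ i * m i) * (v $ j * m j))"
    unfolding quad cov by (simp add: right_diff_distrib sum_subtractf mult_ac)
  also have "(\<Sum>i\<in>UNIV. \<Sum>j\<in>UNIV. (v $ i * m i) * (v $ j * m j)) = (\<integral>\<omega>. v \<bullet> V \<omega> \<partial>M)\<^sup>2"
    unfolding lin power2_eq_square by (simp add: sum_product)
  finally show ?thesis .
qed

text \<open>Given x, the noise enters linearly: centredness removes the mean and the cross term, and
  unit covariance turns the square of z . \<zeta> into |\<zeta>|^2. Boundedness of \<zeta> secures
  integrability of all products.\<close>

lemma gaussian_noise_moments:
  fixes \<beta> :: "'a \<Rightarrow> real" and \<zeta> :: "'a \<Rightarrow> real^'n"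
  assumes "prob_space N" and \<beta>: "\<beta> \<in> borel_measurable N" and \<beta>2: "integrable N (\<lambda>x. (\<beta> x)\<^sup>2)"
    and \<zeta>: "\<zeta> \<in> borel_measurable N" and bd: "\<And>x. norm (\<zeta> x) \<le> C"
  shows "has_bochner_integral (N \<Otimes>\<^sub>M std_gaussian) (\<lambda>(x, z). \<beta> x + s * (z \<bullet> \<zeta> x)) (\<integral>x. \<beta> x \<partial>N)"
    and "has_bochner_integral (N \<Otimes>\<^sub>M std_gaussian) (\<lambda>(x, z). (\<beta> x + s * (z \<bullet> \<zeta> x))\<^sup>2)
       ((\<integral>x. (\<beta> x)\<^sup>2 \<partial>N) + s\<^sup>2 * (\<integral>x. (norm (\<zeta> x))\<^sup>2 \<partial>N))"
proof -
  interpret prob_space N by fact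
  let ?G = "std_gaussian :: (real^'n) measure"
  interpret G: prob_space ?G by (rule prob_space_std_gaussian)
  note [measurable] = \<beta> \<zeta>
  note pm = has_bochner_integral_pair_mult[OF \<open>prob_space N\<close> prob_space_std_gaussian[where 'a="real^'n"]]
  have c: "\<bar>\<zeta> x $ i\<bar> \<le> C" for x i using component_le_norm_cart[of "\<zeta> x" i] bd[of x] by linarith
  have C0: "0 \<le> C" using bd norm_ge_zero order_trans by blast
  have i1: "integrable N \<beta>" by (rule square_integrable_imp_integrable[OF \<beta> \<beta>2])
  have i2: "integrable N (\<lambda>x. \<zeta> x $ i)" for i
    by (rule integrable_const_bound[of _ C]) (use c in auto)
  have i3: "integrable N (\<lambda>x. \<zeta> x $ i * \<zeta> x $ j)" for i j
    by (rule integrable_const_bound[of _ "C * C"]) (use c C0 in \<open>auto simp: abs_mult intro!: mult_mono\<close>)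
  have i4: "integrable N (\<lambda>x. \<beta> x * \<zeta> x $ i)" for i
  proof (rule Bochner_Integration.integrable_bound)
    show "integrable N (\<lambda>x. C * \<beta> x)" using i1 by simp
    show "AE x in N. norm (\<beta> x * \<zeta> x $ i) \<le> norm (C * \<beta> x)"
    proof (rule AE_I2)
      fix x show "norm (\<beta> x * \<zeta> x $ i) \<le> norm (C * \<beta> x)"
        using mult_left_mono[OF c[of x i], of "\<bar>\<beta> x\<bar>"] C0 by (simp add: abs_mult mult.commute)
    qed
  qed measurable
  note I = has_bochner_integral_integrable
  have "has_bochner_integral (N \<Otimes>\<^sub>M ?G) (\<lambda>(x, z). \<beta> x * 1) ((\<integral>x. \<beta> x \<partial>N) * 1)"
    by (intro pm I i1) (auto simp: has_bochner_integral_iff G.prob_space[simplified])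
  moreover
  have "has_bochner_integral (N \<Otimes>\<^sub>M ?G) (\<lambda>(x, z). \<zeta> x $ i * z $ i) ((\<integral>x. \<zeta> x $ i \<partial>N) * 0)" for i
    by (intro pm I i2 std_gaussian_moments)
  then have "has_bochner_integral (N \<Otimes>\<^sub>M ?G) (\<lambda>p. s * (\<Sum>i\<in>UNIV. case p of (x, z) \<Rightarrow> \<zeta> x $ i * z $ i)) (s * (\<Sum>i\<in>(UNIV::'n set). 0))"
    by - (rule has_bochner_integral_mult_right, rule has_bochner_integral_sum, simp)
  ultimately have "has_bochner_integral (N \<Otimes>\<^sub>M ?G) (\<lambda>p. (case p of (x, z) \<Rightarrow> \<beta> x * 1) + s * (\<Sum>i\<in>UNIV. case p of (x, z) \<Rightarrow> \<zeta> x $ i * z $ i))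
     ((\<integral>x. \<beta> x \<partial>N) * 1 + s * (\<Sum>i\<in>(UNIV::'n set). 0))"
    by (rule has_bochner_integral_add)
  then show "has_bochner_integral (N \<Otimes>\<^sub>M ?G) (\<lambda>(x, z). \<beta> x + s * (z \<bullet> \<zeta> x)) (\<integral>x. \<beta> x \<partial>N)"
    by (simp add: case_prod_beta' inner_vec_eq_sum mult.commute)
  have h1: "has_bochner_integral (N \<Otimes>\<^sub>M ?G) (\<lambda>(x, z). (\<beta> x)\<^sup>2 * 1) ((\<integral>x. (\<beta> x)\<^sup>2 \<partial>N) * 1)"
    by (intro pm I \<beta>2) (auto simp: has_bochner_integral_iff G.prob_space[simplified])
  have "has_bochner_integral (N \<Otimes>\<^sub>M ?G) (\<lambda>(x, z). (\<beta> x * \<zeta> x $ i) * z $ i) ((\<integral>x. \<beta> x * \<zeta> x $ i \<partial>N) * 0)" for i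
    by (intro pm I i4 std_gaussian_moments)
  then have h2: "has_bochner_integral (N \<Otimes>\<^sub>M ?G) (\<lambda>p. (2 * s) * (\<Sum>i\<in>UNIV. case p of (x, z) \<Rightarrow> (\<beta> x * \<zeta> x $ i) * z $ i)) ((2 * s) * (\<Sum>i\<in>(UNIV::'n set). 0))"
    by - (rule has_bochner_integral_mult_right, rule has_bochner_integral_sum, simp)
  have "has_bochner_integral (N \<Otimes>\<^sub>M ?G) (\<lambda>(x, z). (\<zeta> x $ i * \<zeta> x $ j) * (z $ i * z $ j)) ((\<integral>x. \<zeta> x $ i * \<zeta> x $ j \<partial>N) * (if i = j then 1 else 0))" for i j
    by (intro pm I i3 std_gaussian_moments)
  then have h3: "has_bochner_integral (N \<Otimes>\<^sub>M ?G) (\<lambda>p. s\<^sup>2 * (\<Sum>i\<in>UNIV. \<Sum>j\<in>UNIV. case p of (x, z) \<Rightarrow> (\<zeta> x $ i * \<zeta> x $ j) * (z $ i * z $ j)))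
     (s\<^sup>2 * (\<Sum>i\<in>UNIV. \<Sum>j\<in>UNIV. (\<integral>x. \<zeta> x $ i * \<zeta> x $ j \<partial>N) * (if i = j then 1 else 0)))"
    by - (rule has_bochner_integral_mult_right, rule has_bochner_integral_sum, rule has_bochner_integral_sum, simp)
  have val: "(\<Sum>i\<in>UNIV. \<Sum>j\<in>UNIV. (\<integral>x. \<zeta> x $ i * \<zeta> x $ j \<partial>N) * (if i = j then 1 else 0)) = (\<integral>x. (norm (\<zeta> x))\<^sup>2 \<partial>N)"
  proof -
    have "(\<integral>x. (norm (\<zeta> x))\<^sup>2 \<partial>N) = (\<integral>x. (\<Sum>i\<in>UNIV. \<zeta> x $ i * \<zeta> x $ i) \<partial>N)"
      by (simp add: dot_square_norm[symmetric] inner_vec_def)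
    then show ?thesis using i3 by (simp add: if_distrib cong: if_cong)
  qed
  have fn: "(case p of (x, z) \<Rightarrow> (\<beta> x)\<^sup>2 * 1) + (2 * s) * (\<Sum>i\<in>UNIV. case p of (x, z) \<Rightarrow> (\<beta> x * \<zeta> x $ i) * z $ i) +
      s\<^sup>2 * (\<Sum>i\<in>UNIV. \<Sum>j\<in>UNIV. case p of (x, z) \<Rightarrow> (\<zeta> x $ i * \<zeta> x $ j) * (z $ i * z $ j)) =
      (case p of (x, z) \<Rightarrow> (\<beta> x + s * (z \<bullet> \<zeta> x))\<^sup>2)" for p :: "'a \<times> (real^'n)"
  proof -
    obtain x z where p: "p = (x, z)" by (cases p)
    have 1: "(\<Sum>i\<in>UNIV. (\<beta> x * \<zeta> x $ i) * z $ i) = \<beta> x * (z \<bullet> \<zeta> x)"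
      by (simp add: inner_vec_eq_sum sum_distrib_left mult_ac)
    have 2: "(\<Sum>i\<in>UNIV. \<Sum>j\<in>UNIV. (\<zeta> x $ i * \<zeta> x $ j) * (z $ i * z $ j)) = (z \<bullet> \<zeta> x) * (z \<bullet> \<zeta> x)"
      by (simp add: inner_vec_eq_sum sum_product mult_ac)
    show ?thesis unfolding p case_prod_conv 1 2 by (simp add: power2_eq_square algebra_simps)
  qed
  show "has_bochner_integral (N \<Otimes>\<^sub>M ?G) (\<lambda>(x, z). (\<beta> x + s * (z \<bullet> \<zeta> x))\<^sup>2)
       ((\<integral>x. (\<beta> x)\<^sup>2 \<partial>N) + s\<^sup>2 * (\<integral>x. (norm (\<zeta> x))\<^sup>2 \<partial>N))"
    using has_bochner_integral_add[OF has_bochner_integral_add[OF h1 h2] h3] unfolding fn val by simp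
qed

section \<open>Decomposition of the estimation error\<close>

definition estimator_map ::
    "real^'n^'n \<Rightarrow> real \<Rightarrow> real \<Rightarrow> nat \<Rightarrow> ('n \<Rightarrow> 'n \<Rightarrow> nat \<Rightarrow> real) \<Rightarrow> (real^'n^'n) \<times> (real^'n) \<Rightarrow> real^'n" where
  "estimator_map S a b n \<theta> = (\<lambda>(W, y). (y v* matrix_inv (quantize_matrix a b n \<theta> W)) v* matrix_sqrt S)"

lemma stopping_estimator_eq: "stopping_estimator S e a b n \<theta> x y = estimator_map S a b n \<theta> (stopping_statistic S e a b x y)"
  by (simp add: stopping_estimator_def estimator_map_def)

lemma measurable_estimator_map[measurable]: "estimator_map (S :: real^'n^'n) a b n \<theta> \<in> borel_measurable borel"
proof -
  have [measurable]: "(\<lambda>W. matrix_inv (quantize_matrix a b n \<theta> W)) \<in> borel_measurable (borel :: (real^'n^'n) measure)"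
    by (rule measurable_quantize_comp)
  show ?thesis unfolding estimator_map_def vector_matrix_mult_def case_prod_beta by measurable
qed

text \<open>The vector \<zeta> of the overview: the estimator in direction v is y . \<zeta>, so
  \<zeta> is the factor by which noise is amplified.\<close>

definition gain :: "real^'n^'n \<Rightarrow> real \<Rightarrow> real \<Rightarrow> nat \<Rightarrow> ('n \<Rightarrow> 'n \<Rightarrow> nat \<Rightarrow> real) \<Rightarrow> real^'n \<Rightarrow> real^'n^'n \<Rightarrow> real^'n" where
  "gain S a b n \<theta> v W = matrix_inv (quantize_matrix a b n \<theta> W) *v (matrix_sqrt S *v v)"

text \<open>The error remaining for a given matrix once the noise is averaged out.\<close>

definition quant_bias ::
    "real^'n^'n \<Rightarrow> real^'n \<Rightarrow> real \<Rightarrow> real \<Rightarrow> nat \<Rightarrow> ('n \<Rightarrow> 'n \<Rightarrow> nat \<Rightarrow> real) \<Rightarrow> real^'n \<Rightarrow> real^'n^'n \<Rightarrow> real" where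
  "quant_bias S r a b n \<theta> v W =
     (matrix_inv (matrix_sqrt S) *v r) \<bullet> ((W - quantize_matrix a b n \<theta> W) *v gain S a b n \<theta> v W)"

definition step_error :: "real \<Rightarrow> nat \<Rightarrow> real" where
  "step_error a n = (sqrt 3 - 1) * a / 2 ^ (n - 1)"

text \<open>Bound for the mean of |W - A|^2. The squared off-diagonal cell width is charged at all
  d^2 positions. Each diagonal position adds its own cell width and the overshoot beyond sqrt 3 * a;
  the factors 2 come from (x + y)^2 \<le> 2 x^2 + 2 y^2.\<close>

definition quant_error :: "nat \<Rightarrow> real \<Rightarrow> real \<Rightarrow> nat \<Rightarrow> real" where
  "quant_error d a b n = (real d)\<^sup>2 * (2 * b / 2 ^ n)\<^sup>2 + real d * (2 * (step_error a n)\<^sup>2 +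
     2 * ((sqrt 3 * a * std_normal_density (sqrt 3 * a) + Q (sqrt 3 * a)) / Q a))"

text \<open>Relative loss in the lower bound for the mean of |\<zeta>|^2: a bound for the mean
  excess over a^2 of a squared operator norm bound of A, divided by a^2.\<close>

definition gain_gap :: "nat \<Rightarrow> real \<Rightarrow> real \<Rightarrow> nat \<Rightarrow> real" where
  "gain_gap d a b n = (real d * (2 + 2 * (sqrt 3 * a) * step_error a n + (step_error a n)\<^sup>2) +
     2 * real d * b * (sqrt (1 + 2 * real d) * a) + (real d * b)\<^sup>2) / a\<^sup>2"

text \<open>The dominance condition \<open>ab\<close> makes every quantized matrix invertible. It
  holds for all large budgets because a tends to infinity while b stays fixed.\<close>

locale quantized_sampling =
  fixes S :: "real^'n^'n" and a b :: real and n :: nat and \<theta> :: "'n \<Rightarrow> 'n \<Rightarrow> nat \<Rightarrow> real"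
  assumes S: "positive_definite S" and b: "0 < b" and a1: "1 \<le> a" and ab: "real CARD('n) * b < a"
    and \<theta>: "\<And>i j m. 0 \<le> \<theta> i j m \<and> \<theta> i j m \<le> 1"
begin

lemma a_pos: "0 < a" using a1 by simp

abbreviation "A \<equiv> quantize_matrix a b n \<theta>"

lemma A_entries:
  "a \<le> \<bar>A W $ i $ i\<bar>" "\<bar>A W $ i $ i\<bar> \<le> sqrt 3 * a" "i \<noteq> j \<Longrightarrow> \<bar>A W $ i $ j\<bar> \<le> b"
  using diag_quantize_ge[OF a_pos \<theta>] diag_quantize_le[OF a_pos \<theta>] offdiag_quantize_bounds(1)[OF b \<theta>]
  by (simp_all add: quantize_matrix_def)

lemma A_invertible: "invertible (A W)"
  and norm_A_inv: "norm (matrix_inv (A W) *v x) \<le> norm x / (a - real CARD('n) * b)"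
  using near_diagonal_invertible[of "A W" b a, OF A_entries(3) less_imp_le[OF b] A_entries(1) ab] by auto

lemma norm_gain: "norm (gain S a b n \<theta> v W) \<le> norm (matrix_sqrt S *v v) / (a - real CARD('n) * b)"
  unfolding gain_def by (rule norm_A_inv)

lemma measurable_gain[measurable]: "gain S a b n \<theta> v \<in> borel_measurable borel"
  unfolding gain_def[abs_def] by (rule measurable_quantize_comp)

lemma measurable_quant_bias[measurable]: "quant_bias S r a b n \<theta> v \<in> borel_measurable borel"
proof -
  have "gain S a b n \<theta> v \<in> borel_measurable borel" by (rule measurable_gain)
  note [measurable] = this
  show ?thesis unfolding quant_bias_def inner_vec_def matrix_vector_mult_def by measurable
qed

text \<open>An exact identity. With y = u W + \<sigma> z and A \<zeta> = R v, split W = (W - A) + A;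
  the part u . A \<zeta> = u . R v equals v . r and is the estimand.\<close>

lemma estimator_decomposition:
  "v \<bullet> estimator_map S a b n \<theta> (shift_map S r (W, z)) - v \<bullet> r =
     quant_bias S r a b n \<theta> v W + sqrt (noise_variance S r) * (z \<bullet> gain S a b n \<theta> v W)"
proof -
  let ?u = "matrix_inv (matrix_sqrt S) *v r" and ?\<zeta> = "gain S a b n \<theta> v W" and ?s = "sqrt (noise_variance S r)"
  have dot: "v \<bullet> ((y v* matrix_inv (A W)) v* matrix_sqrt S) = y \<bullet> ?\<zeta>" for y
    by (simp add: gain_def dot_lmul_matrix inner_commute[of v])
  have A\<zeta>: "A W *v ?\<zeta> = matrix_sqrt S *v v"
    by (simp add: gain_def matrix_inv_mult[OF A_invertible])
  have "?u \<bullet> (W *v ?\<zeta>) = ?u \<bullet> ((W - A W) *v ?\<zeta>) + ?u \<bullet> (A W *v ?\<zeta>)"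
    by (simp add: matrix_vector_mult_diff_rdistrib inner_diff_right)
  also have "?u \<bullet> (A W *v ?\<zeta>) = v \<bullet> r"
    unfolding A\<zeta> matrix_sqrt_self_adjoint[OF S] matrix_sqrt_inv[OF S] by (rule inner_commute)
  finally show ?thesis
    by (simp add: estimator_map_def shift_map_def dot inner_add_left dot_lmul_matrix quant_bias_def)
qed

end

context quantized_sampling
begin

abbreviation "\<nu> \<equiv> matrix_law a b :: (real^'n^'n) measure"

lemma matrix_law_prob: "prob_space \<nu>"
  by (rule prob_space_matrix_law[OF b])

lemma sqrt3_a: "1 \<le> sqrt 3 * a" "a \<le> sqrt 3 * a"
proof -
  have "1 \<le> sqrt 3" by (rule real_le_rsqrt) simp
  then show "a \<le> sqrt 3 * a" using a_pos by simp
  then show "1 \<le> sqrt 3 * a" using a1 by linarith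
qed

lemma diag_moments:
  shows "has_bochner_integral \<nu> (\<lambda>W. (W $ i $ i)\<^sup>2) (1 + a * std_normal_density a / Q a)"
    and "has_bochner_integral \<nu> (\<lambda>W. indicator {x. sqrt 3 * a < \<bar>x\<bar>} (W $ i $ i) * (W $ i $ i)\<^sup>2)
      ((sqrt 3 * a * std_normal_density (sqrt 3 * a) + Q (sqrt 3 * a)) / Q a)"
proof -
  show "has_bochner_integral \<nu> (\<lambda>W. (W $ i $ i)\<^sup>2) (1 + a * std_normal_density a / Q a)"
    using matrix_law_entry[OF b _ integrable_entry_density[of a b i i 2]] diag_second_moment[OF a1]
    by (simp add: has_bochner_integral_iff)
  show "has_bochner_integral \<nu> (\<lambda>W. indicator {x. sqrt 3 * a < \<bar>x\<bar>} (W $ i $ i) * (W $ i $ i)\<^sup>2)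
      ((sqrt 3 * a * std_normal_density (sqrt 3 * a) + Q (sqrt 3 * a)) / Q a)"
    using matrix_law_entry[OF b, of "\<lambda>x. indicator {x. sqrt 3 * a < \<bar>x\<bar>} x * x\<^sup>2" a i i] diag_tail_moment[OF sqrt3_a(1) less_imp_le[OF a_pos] sqrt3_a(2), of b i]
    by (simp add: has_bochner_integral_iff)
qed

lemma quantization_error:
  shows "integrable \<nu> (\<lambda>W. (norm (W - A W))\<^sup>2)" "(\<integral>W. (norm (W - A W))\<^sup>2 \<partial>\<nu>) \<le> quant_error CARD('n) a b n"
proof -
  interpret prob_space \<nu> by (rule matrix_law_prob)
  let ?\<eta> = "step_error a n" and ?I = "indicator {x. sqrt 3 * a < \<bar>x\<bar>} :: real \<Rightarrow> real"
  let ?E = "\<lambda>W. (real CARD('n))\<^sup>2 * (2 * b / 2 ^ n)\<^sup>2 + (\<Sum>i\<in>UNIV. 2 * ?\<eta>\<^sup>2 + 2 * (?I (W $ i $ i) * (W $ i $ i)\<^sup>2))"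
  have E: "has_bochner_integral \<nu> ?E ((real CARD('n))\<^sup>2 * (2 * b / 2 ^ n)\<^sup>2 + (\<Sum>i\<in>(UNIV::'n set). 2 * ?\<eta>\<^sup>2 +
     2 * ((sqrt 3 * a * std_normal_density (sqrt 3 * a) + Q (sqrt 3 * a)) / Q a)))"
    by (intro has_bochner_integral_add has_bochner_integral_sum has_bochner_integral_mult_right diag_moments)
       (auto simp: has_bochner_integral_iff prob_space[simplified])
  \<comment> \<open>The entry bounds need W inside its support; this costs nothing, since it holds
    almost surely.\<close>
  have bound: "(norm (W - A W))\<^sup>2 \<le> ?E W" if W: "\<forall>i l. W $ i $ l \<in> entry_set a b i l" for W :: "real^'n^'n"
  proof -
    have "((W - A W) $ i $ j)\<^sup>2 \<le> (2 * b / 2 ^ n)\<^sup>2 + (if i = j then 2 * ?\<eta>\<^sup>2 + 2 * (?I (W $ i $ i) * (W $ i $ i)\<^sup>2) else 0)" for i j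
    proof (cases "i = j")
      case True
      then have w: "a \<le> \<bar>W $ i $ i\<bar>" using W by (auto simp: entry_set_def dest!: spec[of _ i] less_imp_le)
      have "((W - A W) $ i $ j)\<^sup>2 = \<bar>W $ i $ i - diag_quantize a n (\<theta> i i) (W $ i $ i)\<bar>\<^sup>2"
        using True by (simp add: quantize_matrix_def)
      also have "\<dots> \<le> (?\<eta> + ?I (W $ i $ i) * \<bar>W $ i $ i\<bar>)\<^sup>2"
        using diag_quantize_error(1)[OF a_pos \<theta> w] by (intro power_mono) (auto simp: step_error_def)
      also have "\<dots> \<le> 2 * ?\<eta>\<^sup>2 + 2 * (?I (W $ i $ i) * \<bar>W $ i $ i\<bar>)\<^sup>2"
        using sum_squares_bound[of ?\<eta> "?I (W $ i $ i) * \<bar>W $ i $ i\<bar>"] by (simp add: power2_sum)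
      also have "(?I (W $ i $ i) * \<bar>W $ i $ i\<bar>)\<^sup>2 = ?I (W $ i $ i) * (W $ i $ i)\<^sup>2"
        by (simp add: indicator_def)
      finally show ?thesis using True by (simp add: add_increasing)
    next
      case False
      have "W $ i $ j \<in> entry_set a b i j" using W by blast
      with False have w: "\<bar>W $ i $ j\<bar> < b" by (simp add: entry_set_def)
      have "((W - A W) $ i $ j)\<^sup>2 = \<bar>W $ i $ j - offdiag_quantize b n (\<theta> i j) (W $ i $ j)\<bar>\<^sup>2"
        using False by (simp add: quantize_matrix_def)
      also have "\<dots> \<le> (2 * b / 2 ^ n)\<^sup>2"
        using offdiag_quantize_bounds(2)[OF b \<theta> w] by (intro power_mono) auto
      finally show ?thesis using False by simp
    qed
    then have "(norm (W - A W))\<^sup>2 \<le> (\<Sum>i\<in>UNIV. \<Sum>j\<in>UNIV. (2 * b / 2 ^ n)\<^sup>2 + (if i = j then 2 * ?\<eta>\<^sup>2 + 2 * (?I (W $ i $ i) * (W $ i $ i)\<^sup>2) else 0))"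
      unfolding norm_matrix_sq by (intro sum_mono)
    also have "\<dots> = ?E W"
      by (simp add: sum.distrib power2_eq_square mult.assoc)
    finally show ?thesis .
  qed
  have bound: "AE W in \<nu>. (norm (W - A W))\<^sup>2 \<le> ?E W"
    using AE_matrix_law by eventually_elim (rule bound)
  have [measurable]: "(\<lambda>W. (norm (W - A W))\<^sup>2) \<in> borel_measurable \<nu>"
    by measurable
  note iE = conjunct1[OF E[unfolded has_bochner_integral_iff]] and vE = conjunct2[OF E[unfolded has_bochner_integral_iff]]
  show i: "integrable \<nu> (\<lambda>W. (norm (W - A W))\<^sup>2)"
  proof (rule Bochner_Integration.integrable_bound[OF iE])
    show "AE W in \<nu>. norm ((norm (W - A W))\<^sup>2) \<le> norm (?E W)"
      using bound
    proof eventually_elim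
      case (elim W)
      then show ?case
        unfolding real_norm_def abs_of_nonneg[OF zero_le_power2] by (rule order_trans[OF _ abs_ge_self])
    qed
  qed measurable
  have "(\<integral>W. (norm (W - A W))\<^sup>2 \<partial>\<nu>) \<le> (\<integral>W. ?E W \<partial>\<nu>)"
    by (rule integral_mono_AE[OF i iE bound])
  also have "\<dots> = quant_error CARD('n) a b n"
    unfolding vE by (simp add: quant_error_def)
  finally show "(\<integral>W. (norm (W - A W))\<^sup>2 \<partial>\<nu>) \<le> quant_error CARD('n) a b n" .
qed

lemma quant_bias_moment:
  shows "integrable \<nu> (\<lambda>W. (quant_bias S r a b n \<theta> v W)\<^sup>2)"
    "(\<integral>W. (quant_bias S r a b n \<theta> v W)\<^sup>2 \<partial>\<nu>) \<le>
       (norm (matrix_inv (matrix_sqrt S) *v r))\<^sup>2 * quant_error CARD('n) a b n * (norm (matrix_sqrt S *v v))\<^sup>2 / (a - real CARD('n) * b)\<^sup>2"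
proof -
  let ?u = "matrix_inv (matrix_sqrt S) *v r" and ?g = "norm (matrix_sqrt S *v v) / (a - real CARD('n) * b)"
  let ?K = "(norm ?u)\<^sup>2 * ?g\<^sup>2"
  have bd: "(quant_bias S r a b n \<theta> v W)\<^sup>2 \<le> ?K * (norm (W - A W))\<^sup>2" for W
  proof -
    have "\<bar>quant_bias S r a b n \<theta> v W\<bar> \<le> norm ?u * norm ((W - A W) *v gain S a b n \<theta> v W)"
      unfolding quant_bias_def by (rule Cauchy_Schwarz_ineq2)
    also have "\<dots> \<le> norm ?u * (norm (W - A W) * ?g)"
      by (intro mult_left_mono order_trans[OF norm_matrix_vector_mult_le] norm_gain) auto
    finally have "\<bar>quant_bias S r a b n \<theta> v W\<bar>\<^sup>2 \<le> (norm ?u * (norm (W - A W) * ?g))\<^sup>2"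
      by (rule power_mono) simp
    then show ?thesis by (simp add: power_mult_distrib power_divide mult_ac)
  qed
  have i: "integrable \<nu> (\<lambda>W. ?K * (norm (W - A W))\<^sup>2)"
    using quantization_error(1) by simp
  show j: "integrable \<nu> (\<lambda>W. (quant_bias S r a b n \<theta> v W)\<^sup>2)"
    using bd by (intro Bochner_Integration.integrable_bound[OF i]) auto
  have "(\<integral>W. (quant_bias S r a b n \<theta> v W)\<^sup>2 \<partial>\<nu>) \<le> (\<integral>W. ?K * (norm (W - A W))\<^sup>2 \<partial>\<nu>)"
    using bd by (intro integral_mono i j)
  also have "\<dots> \<le> ?K * quant_error CARD('n) a b n"
    using quantization_error(2) by (simp add: mult_left_mono)
  finally show "(\<integral>W. (quant_bias S r a b n \<theta> v W)\<^sup>2 \<partial>\<nu>) \<le>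
       (norm ?u)\<^sup>2 * quant_error CARD('n) a b n * (norm (matrix_sqrt S *v v))\<^sup>2 / (a - real CARD('n) * b)\<^sup>2"
    by (simp add: power_divide mult_ac)
qed

text \<open>The upper bound is deterministic, from the bound on the inverse. For the lower one, |R
  v| = |A \<zeta>| \<le> M |\<zeta>| with M a bound for the operator norm of A, so a mean of 1 / M^2
  must be bounded below.\<close>

lemma gain_moment:
  shows "integrable \<nu> (\<lambda>W. (norm (gain S a b n \<theta> v W))\<^sup>2)"
    "(\<integral>W. (norm (gain S a b n \<theta> v W))\<^sup>2 \<partial>\<nu>) \<le> (norm (matrix_sqrt S *v v))\<^sup>2 / (a - real CARD('n) * b)\<^sup>2"
    "(norm (matrix_sqrt S *v v))\<^sup>2 * (1 - gain_gap CARD('n) a b n) / a\<^sup>2 \<le> (\<integral>W. (norm (gain S a b n \<theta> v W))\<^sup>2 \<partial>\<nu>)"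
proof -
  interpret prob_space \<nu> by (rule matrix_law_prob)
  let ?x = "norm (matrix_sqrt S *v v)" and ?\<kappa> = "2 * (sqrt 3 * a) * step_error a n + (step_error a n)\<^sup>2"
  have up: "(norm (gain S a b n \<theta> v W))\<^sup>2 \<le> ?x\<^sup>2 / (a - real CARD('n) * b)\<^sup>2" for W
    using power_mono[OF norm_gain, of v W 2] by (simp add: power_divide)
  show i: "integrable \<nu> (\<lambda>W. (norm (gain S a b n \<theta> v W))\<^sup>2)"
    by (rule integrable_const_bound[of _ "?x\<^sup>2 / (a - real CARD('n) * b)\<^sup>2"]) (use up in auto)
  have "(\<integral>W. (norm (gain S a b n \<theta> v W))\<^sup>2 \<partial>\<nu>) \<le> (\<integral>W. ?x\<^sup>2 / (a - real CARD('n) * b)\<^sup>2 \<partial>\<nu>)"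
    by (intro integral_mono i up) simp
  then show "(\<integral>W. (norm (gain S a b n \<theta> v W))\<^sup>2 \<partial>\<nu>) \<le> ?x\<^sup>2 / (a - real CARD('n) * b)\<^sup>2"
    by (simp add: prob_space[simplified])
  let ?c = "2 * real CARD('n) * b * (sqrt (1 + 2 * real CARD('n)) * a) + (real CARD('n) * b)\<^sup>2"
  let ?L = "\<lambda>W. ?x\<^sup>2 / a\<^sup>2 * (1 - ((\<Sum>i\<in>UNIV. (W $ i $ i)\<^sup>2 - a\<^sup>2 + ?\<kappa>) + ?c) / a\<^sup>2)"
  have low: "?L W \<le> (norm (gain S a b n \<theta> v W))\<^sup>2" if W: "\<forall>i l. W $ i $ l \<in> entry_set a b i l" for W :: "real^'n^'n"
  proof -
    \<comment> \<open>A substitute for the largest squared diagonal entry. Every summand is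
      nonnegative, so it dominates each square, and being a sum it has a computable mean. Since the
      squares are at most 3 a^2, it is at most (1 + 2 d) a^2.\<close>
    define M2 where "M2 = a\<^sup>2 + (\<Sum>i\<in>UNIV. (A W $ i $ i)\<^sup>2 - a\<^sup>2)"
    have pos: "0 \<le> (A W $ i $ i)\<^sup>2 - a\<^sup>2" for i
      using power_mono[OF A_entries(1)[of W i], of 2] a_pos by simp
    have le: "(A W $ i $ i)\<^sup>2 \<le> 3 * a\<^sup>2" for i
      using power_mono[OF A_entries(2)[of W i], of 2] by (simp add: power_mult_distrib)
    have M2: "a\<^sup>2 \<le> M2" unfolding M2_def using pos by (simp add: sum_nonneg)
    have "(A W $ i $ i)\<^sup>2 \<le> M2" for i
      using member_le_sum[of i UNIV "\<lambda>i. (A W $ i $ i)\<^sup>2 - a\<^sup>2"] pos by (simp add: M2_def)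
    then have diag: "\<bar>A W $ i $ i\<bar> \<le> sqrt M2" for i by (rule real_le_rsqrt[of "\<bar>_\<bar>", simplified])
    have "M2 \<le> a\<^sup>2 + (\<Sum>i\<in>(UNIV::'n set). 2 * a\<^sup>2)"
      unfolding M2_def using le by (intro add_left_mono sum_mono) (simp add: algebra_simps)
    then have "M2 \<le> (1 + 2 * real CARD('n)) * a\<^sup>2" by (simp add: algebra_simps)
    then have sM: "sqrt M2 \<le> sqrt (1 + 2 * real CARD('n)) * a"
      using real_sqrt_le_mono[of M2 "(1 + 2 * real CARD('n)) * a\<^sup>2"] a_pos by (simp add: real_sqrt_mult)
    let ?\<zeta> = "norm (gain S a b n \<theta> v W)" and ?M = "sqrt M2 + real CARD('n) * b"
    have "A W *v gain S a b n \<theta> v W = matrix_sqrt S *v v"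
      by (simp add: gain_def matrix_inv_mult[OF A_invertible])
    then have "?x \<le> ?M * ?\<zeta>"
      using near_diagonal_bounds(2)[of "A W" b "sqrt M2" "gain S a b n \<theta> v W", OF A_entries(3) less_imp_le[OF b] diag] by simp
    then have x: "?x\<^sup>2 \<le> ?M\<^sup>2 * ?\<zeta>\<^sup>2" using power_mono[of ?x "?M * ?\<zeta>" 2] by (simp add: power_mult_distrib)
    have M: "?M\<^sup>2 \<le> M2 + ?c"
    proof -
      have "?M\<^sup>2 = M2 + 2 * real CARD('n) * b * sqrt M2 + (real CARD('n) * b)\<^sup>2"
        using M2 order_trans[OF zero_le_power2 M2] by (simp add: power2_sum)
      moreover have "2 * real CARD('n) * b * sqrt M2 \<le> 2 * real CARD('n) * b * (sqrt (1 + 2 * real CARD('n)) * a)"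
        using sM b by (intro mult_left_mono) auto
      ultimately show ?thesis by simp
    qed
    have Mpos: "0 < ?M\<^sup>2"
    proof -
      have "0 < sqrt M2" using M2 a_pos by (smt (verit) real_sqrt_gt_zero zero_less_power)
      then show ?thesis using b by (intro zero_less_power add_pos_nonneg) auto
    qed
    have D: "(A W $ i $ i)\<^sup>2 - a\<^sup>2 \<le> (W $ i $ i)\<^sup>2 - a\<^sup>2 + ?\<kappa>" for i
    proof -
      have "a \<le> \<bar>W $ i $ i\<bar>" using W by (auto simp: entry_set_def dest!: spec[of _ i] less_imp_le)
      from diag_quantize_error(2)[of a "\<theta> i i" "W $ i $ i" n, OF a_pos \<theta> this] show ?thesis
        by (simp add: quantize_matrix_def step_error_def)
    qed
    define T where "T = ((\<Sum>i\<in>UNIV. (W $ i $ i)\<^sup>2 - a\<^sup>2 + ?\<kappa>) + ?c)"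
    have "?M\<^sup>2 \<le> a\<^sup>2 + T"
      using M sum_mono[of UNIV "\<lambda>i. (A W $ i $ i)\<^sup>2 - a\<^sup>2" "\<lambda>i. (W $ i $ i)\<^sup>2 - a\<^sup>2 + ?\<kappa>"] D by (simp add: M2_def T_def)
    then have y: "?M\<^sup>2 / a\<^sup>2 \<le> 1 + T / a\<^sup>2" using a_pos by (simp add: field_simps)
    \<comment> \<open>The tangent inequality 1 / t \<ge> 2 - t at t = 1. It replaces the reciprocal
      by an expression linear in M^2, whose mean is accessible.\<close>
    have inv: "2 - ?M\<^sup>2 / a\<^sup>2 \<le> a\<^sup>2 / ?M\<^sup>2"
    proof -
      define t where "t = ?M\<^sup>2 / a\<^sup>2"
      have t: "0 < t" using Mpos a_pos by (simp add: t_def)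
      have "0 \<le> (t - 1)\<^sup>2" by simp
      then have "(2 - t) * t \<le> 1" by (simp add: power2_eq_square algebra_simps)
      then have "2 - t \<le> 1 / t" using t by (simp add: pos_le_divide_eq)
      then show ?thesis by (simp add: t_def)
    qed
    have "?x\<^sup>2 / a\<^sup>2 * (1 - T / a\<^sup>2) \<le> ?x\<^sup>2 / a\<^sup>2 * (a\<^sup>2 / ?M\<^sup>2)"
      using y inv by (intro mult_left_mono) auto
    also have "\<dots> = ?x\<^sup>2 / ?M\<^sup>2" using a_pos by simp
    also have "\<dots> \<le> ?\<zeta>\<^sup>2" using x Mpos by (simp add: pos_divide_le_eq mult.commute)
    finally show ?thesis by (simp add: T_def)
  qed
  let ?t = "1 + a * std_normal_density a / Q a"
  have L: "has_bochner_integral \<nu> ?L (?x\<^sup>2 / a\<^sup>2 * (1 - ((\<Sum>i\<in>(UNIV::'n set). ?t - a\<^sup>2 + ?\<kappa>) + ?c) / a\<^sup>2))"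
    by (intro has_bochner_integral_add has_bochner_integral_diff has_bochner_integral_sum has_bochner_integral_mult_right has_bochner_integral_divide_zero diag_moments)
       (auto simp: has_bochner_integral_iff prob_space[simplified])
  have "?x\<^sup>2 * (1 - gain_gap CARD('n) a b n) / a\<^sup>2 \<le> ?x\<^sup>2 / a\<^sup>2 * (1 - ((\<Sum>i\<in>(UNIV::'n set). ?t - a\<^sup>2 + ?\<kappa>) + ?c) / a\<^sup>2)"
  proof -
    have "(\<Sum>i\<in>(UNIV::'n set). ?t - a\<^sup>2 + ?\<kappa>) \<le> (\<Sum>i\<in>(UNIV::'n set). 2 + ?\<kappa>)"
      using diag_second_moment_bounds(2)[OF a1] by (intro sum_mono) simp
    then have "((\<Sum>i\<in>(UNIV::'n set). ?t - a\<^sup>2 + ?\<kappa>) + ?c) / a\<^sup>2 \<le> gain_gap CARD('n) a b n"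
      unfolding gain_gap_def by (intro divide_right_mono) (auto simp: algebra_simps)
    then have "?x\<^sup>2 / a\<^sup>2 * (1 - gain_gap CARD('n) a b n) \<le> ?x\<^sup>2 / a\<^sup>2 * (1 - ((\<Sum>i\<in>(UNIV::'n set). ?t - a\<^sup>2 + ?\<kappa>) + ?c) / a\<^sup>2)"
      by (intro mult_left_mono) auto
    then show ?thesis by simp
  qed
  also have "\<dots> = (\<integral>W. ?L W \<partial>\<nu>)" using L by (simp only: has_bochner_integral_iff)
  also have "\<dots> \<le> (\<integral>W. (norm (gain S a b n \<theta> v W))\<^sup>2 \<partial>\<nu>)"
  proof (rule integral_mono_AE[OF _ i])
    show "integrable \<nu> ?L" using L by (simp only: has_bochner_integral_iff)
    show "AE W in \<nu>. ?L W \<le> (norm (gain S a b n \<theta> v W))\<^sup>2"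
      using AE_matrix_law by eventually_elim (rule low)
  qed
  finally show "?x\<^sup>2 * (1 - gain_gap CARD('n) a b n) / a\<^sup>2 \<le> (\<integral>W. (norm (gain S a b n \<theta> v W))\<^sup>2 \<partial>\<nu>)" .
qed

end

lemma sets_matrix_law_pair: "sets (matrix_law a b \<Otimes>\<^sub>M (std_gaussian :: (real^'n) measure)) = sets (borel :: ((real^'n^'n) \<times> (real^'n)) measure)"
  by (simp add: borel_prod[symmetric] cong: sets_pair_measure_cong)

lemma norm_sq_vec: "(norm x)\<^sup>2 = (\<Sum>i\<in>UNIV. (x $ i)\<^sup>2)" for x :: "real^'n"
  by (simp add: norm_vec_def L2_set_def sum_nonneg)

context quantized_sampling
begin

text \<open>V stands for the estimator on the original probability space. It enters through its law
  alone, so its moments become integrals over the matrix and the noise.\<close>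

context
  fixes r :: "real^'n" and M :: "'w measure" and V :: "'w \<Rightarrow> real^'n"
  assumes M: "prob_space M" and V[measurable]: "V \<in> borel_measurable M"
    and law: "distr M borel V = distr (\<nu> \<Otimes>\<^sub>M std_gaussian) borel (\<lambda>x. estimator_map S a b n \<theta> (shift_map S r x))"
    and noise: "0 \<le> noise_variance S r"
begin

lemma estimator_moments:
  shows "has_bochner_integral M (\<lambda>\<omega>. v \<bullet> V \<omega> - v \<bullet> r) (\<integral>W. quant_bias S r a b n \<theta> v W \<partial>\<nu>)"
    "has_bochner_integral M (\<lambda>\<omega>. (v \<bullet> V \<omega> - v \<bullet> r)\<^sup>2)
       ((\<integral>W. (quant_bias S r a b n \<theta> v W)\<^sup>2 \<partial>\<nu>) + noise_variance S r * (\<integral>W. (norm (gain S a b n \<theta> v W))\<^sup>2 \<partial>\<nu>))"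
proof -
  let ?\<beta> = "quant_bias S r a b n \<theta> v" and ?\<zeta> = "gain S a b n \<theta> v" and ?s = "sqrt (noise_variance S r)"
  let ?h = "\<lambda>x. estimator_map S a b n \<theta> (shift_map S r x)"
  have h: "?h \<in> borel_measurable (\<nu> \<Otimes>\<^sub>M std_gaussian)"
    by (subst measurable_cong_sets[OF sets_matrix_law_pair refl]) measurable
  have tr: "has_bochner_integral M (\<lambda>\<omega>. g (V \<omega>)) c \<longleftrightarrow> has_bochner_integral (\<nu> \<Otimes>\<^sub>M std_gaussian) (\<lambda>x. g (?h x)) c"
    if [measurable]: "g \<in> borel_measurable borel" for g :: "real^'n \<Rightarrow> real" and c
    using integrable_distr_eq[OF V that] integral_distr[OF V that] integrable_distr_eq[OF h that] integral_distr[OF h that]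
    by (simp add: law has_bochner_integral_iff)
  have dec: "v \<bullet> ?h x - v \<bullet> r = (case x of (W, z) \<Rightarrow> ?\<beta> W + ?s * (z \<bullet> ?\<zeta> W))" for x
    by (cases x) (simp add: estimator_decomposition)
  have \<beta>: "?\<beta> \<in> borel_measurable \<nu>" and \<zeta>: "?\<zeta> \<in> borel_measurable \<nu>"
    using measurable_quant_bias measurable_gain
    by (simp_all cong: measurable_cong_sets)
  note g = gaussian_noise_moments[OF matrix_law_prob \<beta> quant_bias_moment(1) \<zeta> norm_gain, of ?s]
  show "has_bochner_integral M (\<lambda>\<omega>. v \<bullet> V \<omega> - v \<bullet> r) (\<integral>W. ?\<beta> W \<partial>\<nu>)"
    using g(1) by (subst tr[of "\<lambda>x. v \<bullet> x - v \<bullet> r"]) (simp_all add: dec)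
  show "has_bochner_integral M (\<lambda>\<omega>. (v \<bullet> V \<omega> - v \<bullet> r)\<^sup>2)
       ((\<integral>W. (?\<beta> W)\<^sup>2 \<partial>\<nu>) + noise_variance S r * (\<integral>W. (norm (?\<zeta> W))\<^sup>2 \<partial>\<nu>))"
    using g(2) noise by (subst tr[of "\<lambda>x. (v \<bullet> x - v \<bullet> r)\<^sup>2"]) (simp_all add: dec case_prod_beta')
qed

lemma estimator_second_moment_le:
  "(\<integral>\<omega>. (v \<bullet> V \<omega> - v \<bullet> r)\<^sup>2 \<partial>M) \<le>
     ((norm (matrix_inv (matrix_sqrt S) *v r))\<^sup>2 * quant_error CARD('n) a b n + noise_variance S r) *
     (norm (matrix_sqrt S *v v))\<^sup>2 / (a - real CARD('n) * b)\<^sup>2"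
proof -
  have "(\<integral>\<omega>. (v \<bullet> V \<omega> - v \<bullet> r)\<^sup>2 \<partial>M) = (\<integral>W. (quant_bias S r a b n \<theta> v W)\<^sup>2 \<partial>\<nu>) + noise_variance S r * (\<integral>W. (norm (gain S a b n \<theta> v W))\<^sup>2 \<partial>\<nu>)"
    using estimator_moments(2) by (simp add: has_bochner_integral_iff)
  also have "\<dots> \<le> (norm (matrix_inv (matrix_sqrt S) *v r))\<^sup>2 * quant_error CARD('n) a b n * (norm (matrix_sqrt S *v v))\<^sup>2 / (a - real CARD('n) * b)\<^sup>2 +
     noise_variance S r * ((norm (matrix_sqrt S *v v))\<^sup>2 / (a - real CARD('n) * b)\<^sup>2)"
    by (intro add_mono quant_bias_moment(2) mult_left_mono gain_moment(2) noise)
  finally show ?thesis by (simp add: distrib_right add_divide_distrib)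
qed

lemma estimator_square_integrable: "integrable M (\<lambda>\<omega>. (norm (V \<omega> - c))\<^sup>2)"
proof -
  interpret prob_space M by fact
  have 1: "integrable M (\<lambda>\<omega>. V \<omega> $ i - r $ i)" and 2: "integrable M (\<lambda>\<omega>. (V \<omega> $ i - r $ i)\<^sup>2)" for i
    using estimator_moments[of "axis i 1"] by (simp_all add: has_bochner_integral_iff inner_axis')
  have "(norm (V \<omega> - c))\<^sup>2 = (\<Sum>i\<in>UNIV. (V \<omega> $ i - r $ i)\<^sup>2 + 2 * (r $ i - c $ i) * (V \<omega> $ i - r $ i) + (r $ i - c $ i)\<^sup>2)" for \<omega>
    unfolding norm_sq_vec by (intro sum.cong) (auto simp: power2_eq_square algebra_simps)
  then show ?thesis using 1 2 by simp
qed

lemma estimator_mse: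
  assumes unit: "\<And>l. S $ l $ l = 1"
  shows "(\<integral>\<omega>. (norm (V \<omega> - r))\<^sup>2 \<partial>M) \<le> real CARD('n) *
    ((norm (matrix_inv (matrix_sqrt S) *v r))\<^sup>2 * quant_error CARD('n) a b n + noise_variance S r) / (a - real CARD('n) * b)\<^sup>2"
proof -
  let ?B = "((norm (matrix_inv (matrix_sqrt S) *v r))\<^sup>2 * quant_error CARD('n) a b n + noise_variance S r) / (a - real CARD('n) * b)\<^sup>2"
  have 2: "integrable M (\<lambda>\<omega>. (V \<omega> $ i - r $ i)\<^sup>2)" for i
    using estimator_moments(2)[of "axis i 1"] by (simp add: has_bochner_integral_iff inner_axis')
  have 3: "(\<integral>\<omega>. (V \<omega> $ i - r $ i)\<^sup>2 \<partial>M) \<le> ?B" for i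
  proof -
    \<comment> \<open>|R e_i|^2 is S_ii, the variance of the i-th coordinate of X.\<close>
    have "(norm (matrix_sqrt S *v axis i 1))\<^sup>2 = 1"
      unfolding norm_matrix_sqrt[OF S] using unit by (simp add: inner_axis' matrix_vector_mult_basis column_def)
    then show ?thesis using estimator_second_moment_le[of "axis i 1"] by (simp add: inner_axis')
  qed
  have "(norm (V \<omega> - r))\<^sup>2 = (\<Sum>i\<in>UNIV. (V \<omega> $ i - r $ i)\<^sup>2)" for \<omega>
    by (simp add: norm_sq_vec)
  then have "(\<integral>\<omega>. (norm (V \<omega> - r))\<^sup>2 \<partial>M) = (\<Sum>i\<in>UNIV. \<integral>\<omega>. (V \<omega> $ i - r $ i)\<^sup>2 \<partial>M)"
    using 2 by simp
  also have "\<dots> \<le> (\<Sum>i\<in>(UNIV::'n set). ?B)" by (intro sum_mono 3)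
  finally show ?thesis by simp
qed

text \<open>The noise part is centred, so the bias is the mean of \<open>quant_bias\<close>, and the
  square of a mean is at most the mean square.\<close>

lemma estimator_bias:
  "((\<integral>\<omega>. V \<omega> \<partial>M) $ i - r $ i)\<^sup>2 \<le> (norm (matrix_inv (matrix_sqrt S) *v r))\<^sup>2 * quant_error CARD('n) a b n *
     (norm (matrix_sqrt S *v axis i 1))\<^sup>2 / (a - real CARD('n) * b)\<^sup>2"
proof -
  interpret prob_space M by fact
  interpret N: prob_space \<nu> by (rule matrix_law_prob)
  have i: "integrable M (\<lambda>\<omega>. V \<omega> $ i)" for i
  proof -
    have "integrable M (\<lambda>\<omega>. (axis i 1 \<bullet> V \<omega> - axis i 1 \<bullet> r) + r $ i)"
      using estimator_moments(1)[of "axis i 1"] by (intro Bochner_Integration.integrable_add) (auto simp: has_bochner_integral_iff)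
    then show ?thesis by (simp add: inner_axis')
  qed
  have "(\<integral>\<omega>. V \<omega> \<partial>M) $ i - r $ i = (\<integral>\<omega>. axis i 1 \<bullet> V \<omega> - axis i 1 \<bullet> r \<partial>M)"
    using integral_vec_nth(2)[of M V, OF i] i by (simp add: inner_axis' prob_space)
  also have "\<dots> = (\<integral>W. quant_bias S r a b n \<theta> (axis i 1) W \<partial>\<nu>)"
    using estimator_moments(1) by (simp add: has_bochner_integral_iff)
  finally have "((\<integral>\<omega>. V \<omega> \<partial>M) $ i - r $ i)\<^sup>2 = (\<integral>W. quant_bias S r a b n \<theta> (axis i 1) W \<partial>\<nu>)\<^sup>2" by simp
  also have "\<dots> \<le> (\<integral>W. (quant_bias S r a b n \<theta> (axis i 1) W)\<^sup>2 \<partial>\<nu>)"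
  proof -
    have m: "quant_bias S r a b n \<theta> (axis i 1) \<in> borel_measurable \<nu>"
      using measurable_quant_bias by (simp cong: measurable_cong_sets)
    show ?thesis by (rule N.square_expectation_le[OF m quant_bias_moment(1)])
  qed
  finally show ?thesis using quant_bias_moment(2)[of r "axis i 1"] by linarith
qed

text \<open>The variance in direction v is that of \<open>quant_bias\<close> plus the noise part.
  Dropping the first, which is nonnegative, gives the lower bound; bounding a variance by the mean
  squared error gives the upper one.\<close>

lemma estimator_covariance:
  shows "noise_variance S r * ((norm (matrix_sqrt S *v v))\<^sup>2 * (1 - gain_gap CARD('n) a b n) / a\<^sup>2) \<le> v \<bullet> (covariance_matrix M V *v v)"
    "v \<bullet> (covariance_matrix M V *v v) \<le> ((norm (matrix_inv (matrix_sqrt S) *v r))\<^sup>2 * quant_error CARD('n) a b n + noise_variance S r) *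
     (norm (matrix_sqrt S *v v))\<^sup>2 / (a - real CARD('n) * b)\<^sup>2"
proof -
  interpret prob_space M by fact
  interpret N: prob_space \<nu> by (rule matrix_law_prob)
  let ?\<beta> = "quant_bias S r a b n \<theta> v" and ?\<zeta> = "gain S a b n \<theta> v"
  have sq: "integrable M (\<lambda>\<omega>. (V \<omega> $ i)\<^sup>2)" for i
  proof (rule Bochner_Integration.integrable_bound[OF estimator_square_integrable[of 0]])
    show "AE \<omega> in M. norm ((V \<omega> $ i)\<^sup>2) \<le> norm ((norm (V \<omega> - 0))\<^sup>2)"
      using power_mono[OF component_le_norm_cart abs_ge_zero, of _ i 2] by simp
  qed measurable
  note m1 = estimator_moments(1)[of v, unfolded has_bochner_integral_iff] and m2 = estimator_moments(2)[of v, unfolded has_bochner_integral_iff]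
  have e1: "(\<integral>\<omega>. v \<bullet> V \<omega> \<partial>M) = (\<integral>W. ?\<beta> W \<partial>\<nu>) + v \<bullet> r"
  proof -
    have "(\<integral>\<omega>. (v \<bullet> V \<omega> - v \<bullet> r) + v \<bullet> r \<partial>M) = (\<integral>W. ?\<beta> W \<partial>\<nu>) + v \<bullet> r"
      using m1 by (subst Bochner_Integration.integral_add) (auto simp: prob_space)
    then show ?thesis by simp
  qed
  have e2: "(\<integral>\<omega>. (v \<bullet> V \<omega>)\<^sup>2 \<partial>M) = (\<integral>\<omega>. (v \<bullet> V \<omega> - v \<bullet> r)\<^sup>2 \<partial>M) + 2 * (v \<bullet> r) * (\<integral>W. ?\<beta> W \<partial>\<nu>) + (v \<bullet> r)\<^sup>2"
  proof -
    have "(v \<bullet> V \<omega>)\<^sup>2 = (v \<bullet> V \<omega> - v \<bullet> r)\<^sup>2 + 2 * (v \<bullet> r) * (v \<bullet> V \<omega> - v \<bullet> r) + (v \<bullet> r)\<^sup>2" for \<omega>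
      by (simp add: power2_eq_square algebra_simps)
    then have "(\<integral>\<omega>. (v \<bullet> V \<omega>)\<^sup>2 \<partial>M) = (\<integral>\<omega>. (v \<bullet> V \<omega> - v \<bullet> r)\<^sup>2 + 2 * (v \<bullet> r) * (v \<bullet> V \<omega> - v \<bullet> r) + (v \<bullet> r)\<^sup>2 \<partial>M)"
      by (simp only:)
    also have "\<dots> = (\<integral>\<omega>. (v \<bullet> V \<omega> - v \<bullet> r)\<^sup>2 \<partial>M) + 2 * (v \<bullet> r) * (\<integral>\<omega>. v \<bullet> V \<omega> - v \<bullet> r \<partial>M) + (v \<bullet> r)\<^sup>2"
      using conjunct1[OF m1] conjunct1[OF m2]
      by (subst Bochner_Integration.integral_add Bochner_Integration.integral_add | simp add: prob_space del: Bochner_Integration.integral_diff)+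
    finally show ?thesis using m1 by simp
  qed
  have var: "v \<bullet> (covariance_matrix M V *v v) = (\<integral>W. (?\<beta> W)\<^sup>2 \<partial>\<nu>) - (\<integral>W. ?\<beta> W \<partial>\<nu>)\<^sup>2 + noise_variance S r * (\<integral>W. (norm (?\<zeta> W))\<^sup>2 \<partial>\<nu>)"
    unfolding covariance_matrix_quadratic_form[OF M V sq] e2 e1 conjunct2[OF m2] by (simp add: power2_eq_square algebra_simps)
  have "(\<integral>W. ?\<beta> W \<partial>\<nu>)\<^sup>2 \<le> (\<integral>W. (?\<beta> W)\<^sup>2 \<partial>\<nu>)"
  proof -
    have m: "?\<beta> \<in> borel_measurable \<nu>"
      using measurable_quant_bias by (simp cong: measurable_cong_sets)
    show ?thesis by (rule N.square_expectation_le[OF m quant_bias_moment(1)])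
  qed
  then have "noise_variance S r * (\<integral>W. (norm (?\<zeta> W))\<^sup>2 \<partial>\<nu>) \<le> v \<bullet> (covariance_matrix M V *v v)"
    using var by linarith
  moreover have "noise_variance S r * ((norm (matrix_sqrt S *v v))\<^sup>2 * (1 - gain_gap CARD('n) a b n) / a\<^sup>2) \<le> noise_variance S r * (\<integral>W. (norm (?\<zeta> W))\<^sup>2 \<partial>\<nu>)"
    by (intro mult_left_mono gain_moment(3) noise)
  ultimately show "noise_variance S r * ((norm (matrix_sqrt S *v v))\<^sup>2 * (1 - gain_gap CARD('n) a b n) / a\<^sup>2) \<le> v \<bullet> (covariance_matrix M V *v v)"
    by linarith
  have "v \<bullet> (covariance_matrix M V *v v) \<le> (\<integral>\<omega>. (v \<bullet> V \<omega> - v \<bullet> r)\<^sup>2 \<partial>M)"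
    using var conjunct2[OF m2] by (simp only:) simp
  then show "v \<bullet> (covariance_matrix M V *v v) \<le> ((norm (matrix_inv (matrix_sqrt S) *v r))\<^sup>2 * quant_error CARD('n) a b n + noise_variance S r) *
     (norm (matrix_sqrt S *v v))\<^sup>2 / (a - real CARD('n) * b)\<^sup>2"
    using estimator_second_moment_le[of v] by linarith
qed

end

end

section \<open>Fisher information\<close>

text \<open>The first term is the information on the regression mean. The second arises because the
  noise variance v depends on r with gradient -2 S^-1 r: a normal sample carries information 1 / (2
  v^2) about v, which gives 2 / v^2 for each of the d samples.\<close>

definition fisher_matrix :: "real^'n^'n \<Rightarrow> real^'n \<Rightarrow> real \<Rightarrow> real^'n^'n" where
  "fisher_matrix S r t = (\<chi> i j. t / noise_variance S r * matrix_inv S $ i $ j +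
     2 * real CARD('n) / (noise_variance S r)\<^sup>2 * ((matrix_inv S *v r) $ i * (matrix_inv S *v r) $ j))"

text \<open>The inverse is given by the Sherman--Morrison formula.\<close>

lemma fisher_matrix_inverse:
  fixes S :: "real^'n^'n"
  assumes S: "positive_definite S" and v: "0 < noise_variance S r" and t: "0 < t"
  defines "\<alpha> \<equiv> t / noise_variance S r" and "\<beta> \<equiv> 2 * real CARD('n) / (noise_variance S r)\<^sup>2"
  shows "invertible (fisher_matrix S r t)"
    "x \<bullet> (matrix_inv (fisher_matrix S r t) *v x) =
       (x \<bullet> (S *v x) - \<beta> / (\<alpha> + \<beta> * (1 - noise_variance S r)) * (r \<bullet> x)\<^sup>2) / \<alpha>"
proof -
  define q where "q = matrix_inv S *v r"
  define \<gamma> where "\<gamma> = \<beta> / (\<alpha> + \<beta> * (1 - noise_variance S r))"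
  have inv: "invertible S" using S by (simp add: positive_definite_def)
  have Sq: "S *v q = r" by (simp add: q_def matrix_inv_mult[OF inv])
  have qr: "r \<bullet> q = 1 - noise_variance S r" by (simp add: noise_variance_eq[OF S] q_def)
  have qr0: "0 \<le> 1 - noise_variance S r" by (simp add: noise_variance_eq_norm[OF S])
  have \<alpha>: "0 < \<alpha>" using v t by (simp add: \<alpha>_def)
  have \<beta>: "0 \<le> \<beta>" by (simp add: \<beta>_def)
  have den: "0 < \<alpha> + \<beta> * (1 - noise_variance S r)" using \<alpha> \<beta> qr0 by (intro add_pos_nonneg) auto
  define B where "B = (\<chi> i j. (S $ i $ j - \<gamma> * (r $ i * r $ j)) / \<alpha>)"
  have Bx: "B *v y = (1 / \<alpha>) *\<^sub>R (S *v y - (\<gamma> * (r \<bullet> y)) *\<^sub>R r)" for y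
    by (simp add: vec_eq_iff B_def matrix_vector_mult_def inner_vec_def left_diff_distrib right_diff_distrib diff_divide_distrib sum_subtractf
        sum_distrib_left sum_distrib_right sum_divide_distrib mult_ac)
  have Ix: "fisher_matrix S r t *v y = \<alpha> *\<^sub>R (matrix_inv S *v y) + (\<beta> * (q \<bullet> y)) *\<^sub>R q" for y
  proof -
    have "fisher_matrix S r t $ i $ j = \<alpha> * matrix_inv S $ i $ j + \<beta> * (q $ i * q $ j)" for i j
      by (simp add: fisher_matrix_def \<alpha>_def \<beta>_def q_def)
    then show ?thesis
      by (simp add: vec_eq_iff matrix_vector_mult_def inner_vec_def distrib_right sum.distrib sum_distrib_left sum_distrib_right mult_ac)
         (simp add: distrib_left sum.distrib mult_ac)
  qed
  \<comment> \<open>Since S q = r and r . q = 1 - \<sigma>^2, applying S to the rank-one term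
    produces a multiple of r, and \<gamma> is chosen to cancel it.\<close>
  have "B *v (fisher_matrix S r t *v y) = y" for y
  proof -
    have "r \<bullet> (matrix_inv S *v y) = q \<bullet> y"
      by (simp add: q_def matrix_inv_self_adjoint[OF S])
    then have ry: "r \<bullet> (fisher_matrix S r t *v y) = (\<alpha> + \<beta> * (1 - noise_variance S r)) * (q \<bullet> y)"
      by (simp add: Ix inner_add_right qr algebra_simps)
    have "\<gamma> * (r \<bullet> (fisher_matrix S r t *v y)) = \<beta> * (q \<bullet> y)"
      unfolding ry \<gamma>_def using den by simp
    moreover have "S *v (fisher_matrix S r t *v y) = \<alpha> *\<^sub>R y + (\<beta> * (q \<bullet> y)) *\<^sub>R r"
      by (simp add: Ix matrix_vector_right_distrib matrix_vector_mult_scaleR Sq matrix_inv_mult[OF inv])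
    ultimately show ?thesis using \<alpha> by (simp add: Bx)
  qed
  then have "B ** fisher_matrix S r t = mat 1"
    by (simp add: matrix_eq matrix_vector_mul_assoc[symmetric])
  then show "invertible (fisher_matrix S r t)" "x \<bullet> (matrix_inv (fisher_matrix S r t) *v x) =
       (x \<bullet> (S *v x) - \<beta> / (\<alpha> + \<beta> * (1 - noise_variance S r)) * (r \<bullet> x)\<^sup>2) / \<alpha>"
    using matrix_inv_left_unique[of B "fisher_matrix S r t"]
    by (auto simp: invertible_left_inverse Bx inner_diff_right inner_commute[of x r] power2_eq_square \<gamma>_def)
qed

section \<open>Density and score of the statistic\<close>

definition statistic_density :: "real^'n^'n \<Rightarrow> real \<Rightarrow> real \<Rightarrow> real^'n \<Rightarrow> (real^'n^'n) \<times> (real^'n) \<Rightarrow> real" where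
  "statistic_density S a b s t = matrix_density a b (fst t) *
     (\<Prod>l\<in>UNIV. normal_density (s \<bullet> (matrix_inv (matrix_sqrt S) *v column l (fst t))) (sqrt (noise_variance S s)) (snd t $ l))"

lemma shifted_mean_eq:
  assumes "positive_definite S"
  shows "((matrix_inv (matrix_sqrt S) *v s) v* W) $ l = s \<bullet> (matrix_inv (matrix_sqrt S) *v column l W)"
proof -
  have "((matrix_inv (matrix_sqrt S) *v s) v* W) $ l = (matrix_inv (matrix_sqrt S) *v s) \<bullet> column l W"
    by (simp add: vector_matrix_mult_def inner_vec_def column_def mult.commute)
  then show ?thesis by (simp add: matrix_sqrt_inv_self_adjoint[OF assms])
qed

lemma measurable_statistic_density[measurable]: "statistic_density (S :: real^'n^'n) a b s \<in> borel_measurable borel"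
proof -
  show ?thesis
    unfolding statistic_density_def normal_density_def matrix_vector_mult_def inner_vec_def column_def by measurable
qed

lemma statistic_density_nonneg: "0 \<le> statistic_density S a b s t"
  unfolding statistic_density_def by (intro mult_nonneg_nonneg prod_nonneg) auto

text \<open>For fixed W substitute y = m W + \<sigma> z. The Jacobian \<sigma>^d is absorbed by
  rescaling the d normal densities, which is where positive noise variance enters.\<close>

lemma statistic_law_density:
  fixes e :: "nat \<Rightarrow> 'n::finite" and S :: "real^'n^'n"
  assumes e: "bij_betw e {1..CARD('n)} UNIV" and b: "0 < b" and S: "positive_definite S" and v: "0 < noise_variance S s"
  shows "statistic_law S e a b s = density lborel (\<lambda>t. ennreal (statistic_density S a b s t))"
proof (rule measure_eqI)
  let ?\<nu> = "matrix_law a b :: (real^'n^'n) measure" and ?G = "std_gaussian :: (real^'n) measure"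
  interpret G: prob_space ?G by (rule prob_space_std_gaussian)
  define \<sigma> where "\<sigma> = sqrt (noise_variance S s)"
  have \<sigma>: "0 < \<sigma>" using v by (simp add: \<sigma>_def)
  note law = statistic_law_eq[OF e b S, of a s]
  show "sets (statistic_law S e a b s) = sets (density lborel (\<lambda>t. ennreal (statistic_density S a b s t)))"
    by (simp add: law)
  fix B :: "((real^'n^'n) \<times> (real^'n)) set" assume "B \<in> sets (statistic_law S e a b s)"
  then have B: "B \<in> sets borel" by (simp add: law)
  have sh: "shift_map S s \<in> measurable (?\<nu> \<Otimes>\<^sub>M ?G) borel"
    by (subst measurable_cong_sets[OF sets_matrix_law_pair refl]) (rule measurable_shift_map)
  define m where "m W = (matrix_inv (matrix_sqrt S) *v s) v* W" for W :: "real^'n^'n"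
  have shift: "shift_map S s (W, z) = (W, m W + \<sigma> *\<^sub>R z)" for W z
    by (simp add: shift_map_def m_def \<sigma>_def)
  have "emeasure (statistic_law S e a b s) B = (\<integral>\<^sup>+x. indicator B x \<partial>distr (?\<nu> \<Otimes>\<^sub>M ?G) borel (shift_map S s))"
    using B by (simp add: law)
  also have "\<dots> = (\<integral>\<^sup>+x. indicator B (shift_map S s x) \<partial>(?\<nu> \<Otimes>\<^sub>M ?G))"
    using B by (intro nn_integral_distr sh) simp
  also have "\<dots> = (\<integral>\<^sup>+W. \<integral>\<^sup>+z. indicator B (W, m W + \<sigma> *\<^sub>R z) \<partial>?G \<partial>?\<nu>)"
    using B sh by (subst G.nn_integral_fst[symmetric]) (auto simp: shift intro!: measurable_compose[OF sh])
  also have "\<dots> = (\<integral>\<^sup>+W. ennreal (matrix_density a b W) * (\<integral>\<^sup>+z. indicator B (W, m W + \<sigma> *\<^sub>R z) \<partial>?G) \<partial>lborel)"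
  proof -
    have "(\<lambda>x. indicator B (shift_map S s x) :: ennreal) \<in> borel_measurable (?\<nu> \<Otimes>\<^sub>M ?G)"
      using B by (intro measurable_compose[OF sh]) simp
    from G.borel_measurable_nn_integral_fst[OF this]
    have "(\<lambda>W. \<integral>\<^sup>+z. indicator B (W, m W + \<sigma> *\<^sub>R z) \<partial>?G) \<in> borel_measurable borel"
      by (simp add: shift cong: measurable_cong_sets)
    then show ?thesis
      unfolding matrix_law_def by (subst nn_integral_density) auto
  qed
  also have "\<dots> = (\<integral>\<^sup>+W. \<integral>\<^sup>+y. ennreal (statistic_density S a b s (W, y)) * indicator B (W, y) \<partial>lborel \<partial>lborel)"
  proof (rule nn_integral_cong)
    fix W :: "real^'n^'n"
    have P: "Pair W \<in> measurable borel (borel :: ((real^'n^'n) \<times> (real^'n)) measure)"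
      by (intro borel_measurable_continuous_onI continuous_intros)
    have sect: "Pair W -` B \<in> sets borel"
      using measurable_sets[OF P B] by simp
    have secti: "indicator B (W, y) = (indicator (Pair W -` B) y :: ennreal)" for y by (simp add: indicator_def)
    define F where "F y = ennreal (statistic_density S a b s (W, y)) * indicator B (W, y)" for y
    have "(\<lambda>y. statistic_density S a b s (W, y)) \<in> borel_measurable borel"
      by (rule measurable_compose[OF P measurable_statistic_density])
    then have F[measurable]: "F \<in> borel_measurable borel"
      unfolding F_def secti using sect by measurable
    have "(\<integral>\<^sup>+y. F y \<partial>lborel) = (\<integral>\<^sup>+y. F y \<partial>density (distr lborel borel (\<lambda>z. m W + \<sigma> *\<^sub>R z)) (\<lambda>_. ennreal (\<bar>\<sigma>\<bar> ^ DIM(real^'n))))"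
      using \<sigma> by (subst lborel_affine[of \<sigma> "m W"]) auto
    also have "\<dots> = (\<integral>\<^sup>+z. ennreal (\<sigma> ^ CARD('n)) * F (m W + \<sigma> *\<^sub>R z) \<partial>lborel)"
      using \<sigma> by (subst nn_integral_density) (auto simp: nn_integral_distr)
    also have "\<dots> = (\<integral>\<^sup>+z. ennreal (matrix_density a b W) * (ennreal (gaussian_density z) * indicator B (W, m W + \<sigma> *\<^sub>R z)) \<partial>lborel)"
    proof (rule nn_integral_cong)
      fix z :: "real^'n"
      have "\<sigma> * normal_density c \<sigma> (c + \<sigma> * x) = std_normal_density x" for c x
        using \<sigma> by (simp add: normal_density_def real_sqrt_mult power_mult_distrib)
      then have "\<sigma> ^ CARD('n) * (\<Prod>l\<in>UNIV. normal_density (m W $ l) \<sigma> ((m W + \<sigma> *\<^sub>R z) $ l)) = gaussian_density z"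
        unfolding gaussian_density_vec by (simp flip: prod.distrib prod_constant)
      then have "\<sigma> ^ CARD('n) * statistic_density S a b s (W, m W + \<sigma> *\<^sub>R z) = matrix_density a b W * gaussian_density z"
        by (simp add: statistic_density_def shifted_mean_eq[OF S, symmetric] m_def \<sigma>_def[symmetric] mult_ac)
      then have "ennreal (\<sigma> ^ CARD('n)) * ennreal (statistic_density S a b s (W, m W + \<sigma> *\<^sub>R z)) = ennreal (matrix_density a b W) * ennreal (gaussian_density z)"
        using \<sigma> by (simp add: ennreal_mult[symmetric] statistic_density_nonneg prod_nonneg)
      then show "ennreal (\<sigma> ^ CARD('n)) * F (m W + \<sigma> *\<^sub>R z) = ennreal (matrix_density a b W) * (ennreal (gaussian_density z) * indicator B (W, m W + \<sigma> *\<^sub>R z))"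
        unfolding F_def mult.assoc[symmetric] by (simp only:)
    qed
    also have "\<dots> = ennreal (matrix_density a b W) * (\<integral>\<^sup>+z. indicator B (W, m W + \<sigma> *\<^sub>R z) \<partial>?G)"
    proof -
      have ind: "(\<lambda>z. indicator B (W, m W + \<sigma> *\<^sub>R z) :: ennreal) \<in> borel_measurable borel"
      proof -
        have "(\<lambda>z. m W + \<sigma> *\<^sub>R z) \<in> measurable borel borel"
          by (intro borel_measurable_continuous_onI continuous_intros)
        then show ?thesis
          unfolding secti by (rule measurable_compose) (use sect in simp)
      qed
      have gd: "(\<lambda>z::real^'n. ennreal (gaussian_density z)) \<in> borel_measurable borel" by measurable
      show ?thesis
        unfolding std_gaussian_def using ind gd
        by (subst nn_integral_cmult) (auto simp: nn_integral_density)
    qed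
    finally show "ennreal (matrix_density a b W) * (\<integral>\<^sup>+z. indicator B (W, m W + \<sigma> *\<^sub>R z) \<partial>?G) =
       (\<integral>\<^sup>+y. ennreal (statistic_density S a b s (W, y)) * indicator B (W, y) \<partial>lborel)"
      by (simp add: F_def)
  qed
  also have "\<dots> = (\<integral>\<^sup>+t. ennreal (statistic_density S a b s t) * indicator B t \<partial>(lborel \<Otimes>\<^sub>M lborel))"
    using B by (subst lborel.nn_integral_fst[symmetric]) (auto simp: lborel_prod)
  also have "\<dots> = emeasure (density lborel (\<lambda>t. ennreal (statistic_density S a b s t))) B"
    using B by (subst emeasure_density) (auto simp: lborel_prod)
  finally show "emeasure (statistic_law S e a b s) B = emeasure (density lborel (\<lambda>t. ennreal (statistic_density S a b s t))) B" .
qed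

text \<open>Gradient in r of the log density. For each sample the term along S^-1 r comes from the
  noise variance, and the term along \<open>k l\<close> from the regression mean.\<close>

definition score :: "real^'n^'n \<Rightarrow> real^'n \<Rightarrow> (real^'n^'n) \<times> (real^'n) \<Rightarrow> real^'n" where
  "score S r t = (let v = noise_variance S r; k = (\<lambda>l. matrix_inv (matrix_sqrt S) *v column l (fst t)) in
     \<Sum>l\<in>UNIV. (1 / v - (snd t $ l - r \<bullet> k l)\<^sup>2 / v\<^sup>2) *\<^sub>R (matrix_inv S *v r) + ((snd t $ l - r \<bullet> k l) / v) *\<^sub>R k l)"

lemma noise_variance_has_derivative:
  fixes S :: "real^'n^'n"
  assumes S: "positive_definite S"
  shows "(noise_variance S has_derivative (\<lambda>h. - 2 * ((matrix_inv S *v r) \<bullet> h))) (at r)"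
proof -
  have lin: "bounded_linear ((*v) (matrix_inv S))" by (rule matrix_vector_mul_bounded_linear)
  have "((\<lambda>s. 1 - s \<bullet> (matrix_inv S *v s)) has_derivative (\<lambda>h. - (r \<bullet> (matrix_inv S *v h) + h \<bullet> (matrix_inv S *v r)))) (at r)"
    by (auto intro!: derivative_eq_intros bounded_linear.has_derivative[OF lin])
  moreover have "- (r \<bullet> (matrix_inv S *v h) + h \<bullet> (matrix_inv S *v r)) = - 2 * ((matrix_inv S *v r) \<bullet> h)" for h
    by (simp add: matrix_inv_self_adjoint[OF S, of r h] inner_commute)
  ultimately show ?thesis by (simp add: noise_variance_eq[OF S, abs_def])
qed

lemma open_noise_variance_pos:
  assumes "positive_definite S"
  shows "open {s. 0 < noise_variance S s}"
proof -
  have "continuous_on UNIV (noise_variance S)"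
    by (intro continuous_at_imp_continuous_on ballI has_derivative_continuous[OF noise_variance_has_derivative[OF assms]])
  then show ?thesis by (intro open_Collect_less continuous_on_const) auto
qed

lemma log_density_has_derivative:
  fixes S :: "real^'n^'n"
  assumes S: "positive_definite S" and v: "0 < noise_variance S r" and W: "0 < matrix_density a b (fst t)"
  shows "((\<lambda>s. ln (statistic_density S a b s t)) has_derivative (\<lambda>h. score S r t \<bullet> h)) (at r)"
proof -
  let ?v = "noise_variance S" and ?q = "matrix_inv S *v r"
  define k where "k l = matrix_inv (matrix_sqrt S) *v column l (fst t)" for l
  let ?L = "\<lambda>s. ln (matrix_density a b (fst t)) + (\<Sum>l\<in>UNIV. - (ln (2 * pi) + ln (?v s)) / 2 - (snd t $ l - s \<bullet> k l)\<^sup>2 / (2 * ?v s))"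
  have summand: "((\<lambda>s. - (ln (2 * pi) + ln (?v s)) / 2 - (snd t $ l - s \<bullet> k l)\<^sup>2 / (2 * ?v s)) has_derivative
     (\<lambda>h. ((1 / ?v r - (snd t $ l - r \<bullet> k l)\<^sup>2 / (?v r)\<^sup>2) *\<^sub>R ?q + ((snd t $ l - r \<bullet> k l) / ?v r) *\<^sub>R k l) \<bullet> h)) (at r)" for l
  proof -
    define c where "c = snd t $ l"
    have "((\<lambda>s. - (ln (2 * pi) + ln (?v s)) / 2 - (c - s \<bullet> k l)\<^sup>2 / (2 * ?v s)) has_derivative
      (\<lambda>h. - (- 2 * (?q \<bullet> h) / ?v r) / 2 - (2 * (c - r \<bullet> k l) * - (h \<bullet> k l) * (2 * ?v r) - (c - r \<bullet> k l)\<^sup>2 * (2 * (- 2 * (?q \<bullet> h)))) / ((2 * ?v r) * (2 * ?v r)))) (at r)"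
      using v by (auto intro!: derivative_eq_intros noise_variance_has_derivative[OF S] simp: field_simps power2_eq_square)
    moreover have "- (- 2 * (?q \<bullet> h) / ?v r) / 2 - (2 * (c - r \<bullet> k l) * - (h \<bullet> k l) * (2 * ?v r) - (c - r \<bullet> k l)\<^sup>2 * (2 * (- 2 * (?q \<bullet> h)))) / ((2 * ?v r) * (2 * ?v r)) =
       ((1 / ?v r - (c - r \<bullet> k l)\<^sup>2 / (?v r)\<^sup>2) *\<^sub>R ?q + ((c - r \<bullet> k l) / ?v r) *\<^sub>R k l) \<bullet> h" for h
      unfolding inner_add_left inner_scaleR_left inner_commute[of h "k l"]
      using v by (simp add: field_simps power2_eq_square)
    ultimately show ?thesis by (simp add: c_def)
  qed
  have "(?L has_derivative (\<lambda>h. 0 + (\<Sum>l\<in>UNIV. ((1 / ?v r - (snd t $ l - r \<bullet> k l)\<^sup>2 / (?v r)\<^sup>2) *\<^sub>R ?q + ((snd t $ l - r \<bullet> k l) / ?v r) *\<^sub>R k l) \<bullet> h))) (at r)"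
    by (intro has_derivative_add has_derivative_const has_derivative_sum summand)
  then have L: "(?L has_derivative (\<lambda>h. score S r t \<bullet> h)) (at r)"
    by (simp add: score_def k_def Let_def inner_sum_left)
  show ?thesis
  \<comment> \<open>The closed form of the log density holds where the noise variance is positive,
    an open set containing r; that suffices for a derivative at r.\<close>
  proof (rule has_derivative_transform_within_open[OF L open_noise_variance_pos[OF S]])
    fix s assume "s \<in> {s. 0 < ?v s}"
    then have s: "0 < ?v s" by simp
    have nd: "ln (normal_density c (sqrt (?v s)) x) = - (ln (2 * pi) + ln (?v s)) / 2 - (x - c)\<^sup>2 / (2 * ?v s)" for c x
      using s by (simp add: normal_density_def ln_mult ln_div ln_sqrt field_simps)
    have "ln (statistic_density S a b s t) = ln (matrix_density a b (fst t)) + (\<Sum>l\<in>UNIV. ln (normal_density (s \<bullet> k l) (sqrt (?v s)) (snd t $ l)))"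
    proof -
      have p: "0 < normal_density (s \<bullet> k l) (sqrt (?v s)) (snd t $ l)" for l
        using s by (intro normal_density_pos) simp
      have "ln (statistic_density S a b s t) = ln (matrix_density a b (fst t)) + ln (\<Prod>l\<in>UNIV. normal_density (s \<bullet> k l) (sqrt (?v s)) (snd t $ l))"
        unfolding statistic_density_def k_def[symmetric] using W p by (intro ln_mult_pos prod_pos) auto
      also have "ln (\<Prod>l\<in>UNIV. normal_density (s \<bullet> k l) (sqrt (?v s)) (snd t $ l)) = (\<Sum>l\<in>UNIV. ln (normal_density (s \<bullet> k l) (sqrt (?v s)) (snd t $ l)))"
      proof (rule ln_prod)
        show "normal_density (s \<bullet> k l) (sqrt (?v s)) (snd t $ l) \<noteq> 0" for l using p[of l] by linarith
      qed simp
      finally show ?thesis .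
    qed
    then show "?L s = ln (statistic_density S a b s t)" by (simp add: nd)
  qed (use v in simp)
qed

lemma matrix_law_product_integrable:
  fixes p q p' q' :: "'n::finite"
  assumes "0 < b"
  shows "integrable (matrix_law a b) (\<lambda>W. W $ p $ q * W $ p' $ q')" "integrable (matrix_law a b) (\<lambda>W. W $ p $ q)"
proof -
  interpret prob_space "matrix_law a b :: (real^'n^'n) measure" by (rule prob_space_matrix_law[OF assms])
  have sq: "integrable (matrix_law a b) (\<lambda>W. (W $ p $ q)\<^sup>2)" for p q :: 'n
    using matrix_law_entry(1)[OF assms _ integrable_entry_density[of a b p q 2]] by simp
  have m: "(\<lambda>W. W $ p $ q) \<in> borel_measurable (matrix_law a b)" for p q :: 'n by measurable
  show "integrable (matrix_law a b) (\<lambda>W. W $ p $ q)" by (rule square_integrable_imp_integrable[OF m sq])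
  show "integrable (matrix_law a b) (\<lambda>W. W $ p $ q * W $ p' $ q')"
    by (rule integrable_mult_if_square_integrable[OF m m sq sq])
qed

text \<open>With K = R^-1 W the mean of K times its transpose is R^-1 (t I) R^-1 = t S^-1, where t
  is \<open>column_moment\<close>.\<close>

lemma transformed_column_moments:
  fixes S :: "real^'n^'n"
  assumes b: "0 < b" and a: "1 \<le> a" and S: "positive_definite S"
  defines "K \<equiv> \<lambda>(W::real^'n^'n) i l. (matrix_inv (matrix_sqrt S) *v column l W) $ i"
  shows "integrable (matrix_law a b) (\<lambda>W. K W i l)" "integrable (matrix_law a b) (\<lambda>W. K W i l * K W j m)"
    "(\<Sum>l\<in>UNIV. \<integral>W. K W i l * K W j l \<partial>matrix_law a b) = column_moment TYPE('n) a b * matrix_inv S $ i $ j"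
proof -
  let ?R = "matrix_inv (matrix_sqrt S)" and ?t = "column_moment TYPE('n) a b"
  have K: "K W i l = (\<Sum>p\<in>UNIV. ?R $ i $ p * W $ p $ l)" for W i l
    by (simp add: K_def matrix_vector_mult_def column_def)
  have KK: "K W i l * K W j m = (\<Sum>p\<in>UNIV. \<Sum>p'\<in>UNIV. ?R $ i $ p * ?R $ j $ p' * (W $ p $ l * W $ p' $ m))" for W i j l m
    by (simp add: K sum_product mult_ac)
  note I = matrix_law_product_integrable[OF b, of a]
  show "integrable (matrix_law a b) (\<lambda>W. K W i l)" unfolding K by (simp add: I(2))
  show KKi: "integrable (matrix_law a b) (\<lambda>W. K W i l * K W j m)" for i j l m unfolding KK by (simp add: I(1))
  have "(\<Sum>l\<in>UNIV. \<integral>W. K W i l * K W j l \<partial>matrix_law a b) = (\<integral>W. (\<Sum>l\<in>UNIV. K W i l * K W j l) \<partial>matrix_law a b)"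
    using KKi by simp
  also have "(\<lambda>W. \<Sum>l\<in>UNIV. K W i l * K W j l) =
     (\<lambda>W. \<Sum>p\<in>UNIV. \<Sum>p'\<in>UNIV. ?R $ i $ p * ?R $ j $ p' * (\<Sum>l\<in>UNIV. W $ p $ l * W $ p' $ l))"
  proof
    fix W
    have "(\<Sum>l\<in>UNIV. K W i l * K W j l) = (\<Sum>l\<in>UNIV. \<Sum>p\<in>UNIV. \<Sum>p'\<in>UNIV. ?R $ i $ p * ?R $ j $ p' * (W $ p $ l * W $ p' $ l))"
      by (simp only: KK)
    also have "\<dots> = (\<Sum>p\<in>UNIV. \<Sum>p'\<in>UNIV. \<Sum>l\<in>UNIV. ?R $ i $ p * ?R $ j $ p' * (W $ p $ l * W $ p' $ l))"
      by (subst sum.swap) (intro sum.cong refl sum.swap)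
    finally show "(\<Sum>l\<in>UNIV. K W i l * K W j l) = (\<Sum>p\<in>UNIV. \<Sum>p'\<in>UNIV. ?R $ i $ p * ?R $ j $ p' * (\<Sum>l\<in>UNIV. W $ p $ l * W $ p' $ l))"
      by (simp only: sum_distrib_left)
  qed
  also have "(\<integral>W. (\<Sum>p\<in>UNIV. \<Sum>p'\<in>UNIV. ?R $ i $ p * ?R $ j $ p' * (\<Sum>l\<in>UNIV. W $ p $ l * W $ p' $ l)) \<partial>matrix_law a b) =
     (\<Sum>p\<in>UNIV. \<Sum>p'\<in>UNIV. ?R $ i $ p * ?R $ j $ p' * (if p = p' then ?t else 0))"
  proof (rule has_bochner_integral_integral_eq)
    show "has_bochner_integral (matrix_law a b) (\<lambda>W. \<Sum>p\<in>UNIV. \<Sum>p'\<in>UNIV. ?R $ i $ p * ?R $ j $ p' * (\<Sum>l\<in>UNIV. W $ p $ l * W $ p' $ l))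
       (\<Sum>p\<in>UNIV. \<Sum>p'\<in>UNIV. ?R $ i $ p * ?R $ j $ p' * (if p = p' then ?t else 0))"
      by (rule has_bochner_integral_sum, rule has_bochner_integral_sum, rule has_bochner_integral_mult_right, rule matrix_law_second_moment[OF b a])
  qed
  also have "\<dots> = ?t * (\<Sum>p\<in>UNIV. ?R $ i $ p * ?R $ j $ p)"
    by (simp add: if_distrib sum_distrib_left mult_ac cong: if_cong)
  also have "(\<Sum>p\<in>UNIV. ?R $ i $ p * ?R $ j $ p) = matrix_inv S $ i $ j"
  proof -
    have sym: "?R $ p $ j = ?R $ j $ p" for p
    proof -
      have "axis p 1 \<bullet> (?R *v axis j 1) = (?R *v axis p 1) \<bullet> axis j 1"
        by (rule matrix_sqrt_inv_self_adjoint[OF S])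
      then show ?thesis by (simp add: inner_axis inner_axis' matrix_vector_mult_basis column_def)
    qed
    have "matrix_inv S $ i $ j = (matrix_inv S *v axis j 1) $ i"
      by (simp add: matrix_vector_mult_basis column_def)
    also have "\<dots> = (?R *v (?R *v axis j 1)) $ i" by (simp only: matrix_inv_eq_sqrt[OF S])
    also have "\<dots> = (\<Sum>p\<in>UNIV. ?R $ i $ p * ?R $ p $ j)"
      by (subst matrix_vector_mult_basis) (simp add: column_def matrix_vector_mult_def)
    finally show ?thesis by (simp add: sym)
  qed
  finally show "(\<Sum>l\<in>UNIV. \<integral>W. K W i l * K W j l \<partial>matrix_law a b) = ?t * matrix_inv S $ i $ j" .
qed

text \<open>Pulled back along \<open>shift_map\<close> the residuals become \<sigma> z, so the score
  is a sum of terms 1 - z_l^2 and z_l K_l. Products of scores then factor into moments of W and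
  moments of z.\<close>

lemma has_fisher_information_statistic:
  fixes e :: "nat \<Rightarrow> 'n::finite" and S :: "real^'n^'n"
  assumes e: "bij_betw e {1..CARD('n)} UNIV" and b: "0 < b" and a: "1 \<le> a" and S: "positive_definite S"
    and v: "0 < noise_variance S r"
  shows "has_fisher_information {s. 0 < noise_variance S s} (\<lambda>s. statistic_law S e a b s) r
     (fisher_matrix S r (column_moment TYPE('n) a b))"
proof -
  let ?\<nu> = "matrix_law a b :: (real^'n^'n) measure" and ?G = "std_gaussian :: (real^'n) measure"
  let ?t = "column_moment TYPE('n) a b" and ?q = "matrix_inv S *v r" and ?v = "noise_variance S r"
  define \<sigma> where "\<sigma> = sqrt ?v"
  have \<sigma>: "0 < \<sigma>" "\<sigma>\<^sup>2 = ?v" using v by (simp_all add: \<sigma>_def)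
  define K where "K W i l = (matrix_inv (matrix_sqrt S) *v column l W) $ i" for W :: "real^'n^'n" and i l
  interpret N: prob_space ?\<nu> by (rule prob_space_matrix_law[OF b])
  note pm = has_bochner_integral_pair_mult[OF N.prob_space_axioms prob_space_std_gaussian[where 'a="real^'n"]]
  note K_moments = transformed_column_moments[OF b a S, folded K_def]
  have score_meas[measurable]: "(\<lambda>t. score S r t $ i) \<in> borel_measurable borel" for i
    unfolding score_def Let_def matrix_vector_mult_def inner_vec_def column_def by measurable
  have sh: "shift_map S r \<in> measurable (?\<nu> \<Otimes>\<^sub>M ?G) borel"
    by (subst measurable_cong_sets[OF sets_matrix_law_pair refl]) (rule measurable_shift_map)
  have score_shift: "score S r (shift_map S r (W, z)) $ i = (\<Sum>l\<in>UNIV. (?q $ i / ?v) * (1 - (z $ l)\<^sup>2) + (1 / \<sigma>) * (K W i l * z $ l))" for W z i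
  proof -
    have res: "snd (shift_map S r (W, z)) $ l - r \<bullet> (matrix_inv (matrix_sqrt S) *v column l W) = \<sigma> * z $ l" for l
      by (simp add: shift_map_def shifted_mean_eq[OF S] \<sigma>_def)
    have 1: "1 / ?v - (\<sigma> * x)\<^sup>2 / ?v\<^sup>2 = (1 - x\<^sup>2) / ?v" for x
    proof -
      have "(\<sigma> * x)\<^sup>2 = ?v * x\<^sup>2" by (simp only: power_mult_distrib \<sigma>(2))
      then show ?thesis using v by (simp add: field_simps power2_eq_square)
    qed
    have 2: "\<sigma> * x / ?v = x / \<sigma>" for x
      using \<sigma>(1) by (simp add: \<sigma>(2)[symmetric] power2_eq_square)
    have f: "fst (shift_map S r (W, z)) = W" by (simp add: shift_map_def)
    show ?thesis
      unfolding score_def Let_def f res 1 2 by (simp add: K_def mult_ac)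
  qed
  have main: "has_bochner_integral (?\<nu> \<Otimes>\<^sub>M ?G) (\<lambda>x. score S r (shift_map S r x) $ i * score S r (shift_map S r x) $ j)
     (fisher_matrix S r ?t $ i $ j)" for i j
  proof -
    let ?c = "\<lambda>i. ?q $ i / ?v"
    have one: "has_bochner_integral ?\<nu> (\<lambda>_. 1::real) 1"
      by (simp add: has_bochner_integral_iff N.prob_space[simplified])
    have A1: "has_bochner_integral (?\<nu> \<Otimes>\<^sub>M ?G) (\<lambda>(W, z). 1 * ((1 - (z $ l)\<^sup>2) * (1 - (z $ m)\<^sup>2))) (1 * (if l = m then 2 else 0))" for l m
      by (intro pm one std_gaussian_moments)
    \<comment> \<open>The mixed terms between mean and variance scores are odd in the noise and
      vanish.\<close>
    have A2: "has_bochner_integral (?\<nu> \<Otimes>\<^sub>M ?G) (\<lambda>(W, z). K W i m * (z $ m * (1 - (z $ l)\<^sup>2))) ((\<integral>W. K W i m \<partial>?\<nu>) * 0)" for i l m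
      by (intro pm has_bochner_integral_integrable K_moments(1) std_gaussian_moments)
    have A3: "has_bochner_integral (?\<nu> \<Otimes>\<^sub>M ?G) (\<lambda>(W, z). (K W i l * K W j m) * (z $ l * z $ m)) ((\<integral>W. K W i l * K W j m \<partial>?\<nu>) * (if l = m then 1 else 0))" for i j l m
      by (intro pm has_bochner_integral_integrable K_moments(2) std_gaussian_moments)
    let ?F = "\<lambda>l m p. ?c i * ?c j * (case p of (W, z) \<Rightarrow> 1 * ((1 - (z $ l)\<^sup>2) * (1 - (z $ m)\<^sup>2))) +
        (?c i / \<sigma>) * (case p of (W, z) \<Rightarrow> K W j m * (z $ m * (1 - (z $ l)\<^sup>2))) +
        (?c j / \<sigma>) * (case p of (W, z) \<Rightarrow> K W i l * (z $ l * (1 - (z $ m)\<^sup>2))) +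
        (1 / ?v) * (case p of (W, z) \<Rightarrow> (K W i l * K W j m) * (z $ l * z $ m))"
    have F: "has_bochner_integral (?\<nu> \<Otimes>\<^sub>M ?G) (?F l m)
       (?c i * ?c j * (1 * (if l = m then 2 else 0)) + (?c i / \<sigma>) * ((\<integral>W. K W j m \<partial>?\<nu>) * 0) +
        (?c j / \<sigma>) * ((\<integral>W. K W i l \<partial>?\<nu>) * 0) + (1 / ?v) * ((\<integral>W. K W i l * K W j m \<partial>?\<nu>) * (if l = m then 1 else 0)))" for l m
      by (intro has_bochner_integral_add has_bochner_integral_mult_right A1 A2 A3)
    have "has_bochner_integral (?\<nu> \<Otimes>\<^sub>M ?G) (\<lambda>p. \<Sum>l\<in>UNIV. \<Sum>m\<in>UNIV. ?F l m p)
       (\<Sum>l\<in>UNIV. \<Sum>m\<in>UNIV. (?c i * ?c j * (1 * (if l = m then 2 else 0)) + (?c i / \<sigma>) * ((\<integral>W. K W j m \<partial>?\<nu>) * 0) +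
        (?c j / \<sigma>) * ((\<integral>W. K W i l \<partial>?\<nu>) * 0) + (1 / ?v) * ((\<integral>W. K W i l * K W j m \<partial>?\<nu>) * (if l = m then 1 else 0))))"
      by (rule has_bochner_integral_sum, rule has_bochner_integral_sum, rule F)
    moreover have "(\<Sum>l\<in>UNIV. \<Sum>m\<in>UNIV. ?F l m p) = score S r (shift_map S r p) $ i * score S r (shift_map S r p) $ j" for p
    proof -
      obtain W z where p: "p = (W, z)" by (cases p)
      have "?F l m (W, z) = (?c i * (1 - (z $ l)\<^sup>2) + (1 / \<sigma>) * (K W i l * z $ l)) * (?c j * (1 - (z $ m)\<^sup>2) + (1 / \<sigma>) * (K W j m * z $ m))" for l m
      proof -
        have "(x1 + (1 / \<sigma>) * y1) * (x2 + (1 / \<sigma>) * y2) = x1 * x2 + x1 * y2 / \<sigma> + x2 * y1 / \<sigma> + (1 / ?v) * (y1 * y2)" for x1 x2 y1 y2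
          using \<sigma>(1) by (simp add: \<sigma>(2)[symmetric] power2_eq_square field_simps)
        then show ?thesis by (simp add: mult_ac)
      qed
      then show ?thesis unfolding p score_shift by (simp only: sum_product)
    qed
    moreover have "(\<Sum>l\<in>UNIV. \<Sum>m\<in>UNIV. (?c i * ?c j * (1 * (if l = m then 2 else 0)) + (?c i / \<sigma>) * ((\<integral>W. K W j m \<partial>?\<nu>) * 0) +
        (?c j / \<sigma>) * ((\<integral>W. K W i l \<partial>?\<nu>) * 0) + (1 / ?v) * ((\<integral>W. K W i l * K W j m \<partial>?\<nu>) * (if l = m then 1 else 0)))) =
       fisher_matrix S r ?t $ i $ j"
    proof -
      have "(\<Sum>l\<in>UNIV. \<Sum>m\<in>UNIV. (?c i * ?c j * (1 * (if l = m then 2 else 0)) + (?c i / \<sigma>) * ((\<integral>W. K W j m \<partial>?\<nu>) * 0) +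
        (?c j / \<sigma>) * ((\<integral>W. K W i l \<partial>?\<nu>) * 0) + (1 / ?v) * ((\<integral>W. K W i l * K W j m \<partial>?\<nu>) * (if l = m then 1 else 0)))) =
        (\<Sum>l\<in>(UNIV::'n set). \<Sum>m\<in>UNIV. if l = m then 2 * (?c i * ?c j) + (1 / ?v) * (\<integral>W. K W i l * K W j l \<partial>?\<nu>) else 0)"
        by (intro sum.cong refl) auto
      also have "\<dots> = (\<Sum>l\<in>(UNIV::'n set). 2 * (?c i * ?c j) + (1 / ?v) * (\<integral>W. K W i l * K W j l \<partial>?\<nu>))" by simp
      also have "\<dots> = real CARD('n) * (2 * (?c i * ?c j)) + (1 / ?v) * (?t * matrix_inv S $ i $ j)"
        by (simp only: sum.distrib sum_distrib_left[symmetric] K_moments(3)) simp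
      also have "\<dots> = fisher_matrix S r ?t $ i $ j"
        by (simp add: fisher_matrix_def power2_eq_square)
      finally show ?thesis .
    qed
    ultimately show ?thesis by (simp only:)
  qed
  have law: "statistic_law S e a b r = distr (?\<nu> \<Otimes>\<^sub>M ?G) borel (shift_map S r)"
    by (rule statistic_law_eq[OF e b S])
  show ?thesis
    unfolding has_fisher_information_def
  proof (intro exI conjI ballI allI)
    fix s assume "s \<in> {s. 0 < noise_variance S s}"
    then have "0 < noise_variance S s" by simp
    then show "statistic_law S e a b s = density lborel (\<lambda>t. ennreal (statistic_density S a b s t))"
      by (rule statistic_law_density[OF e b S])
    show "statistic_density S a b s \<in> borel_measurable borel" by (rule measurable_statistic_density)
    show "0 \<le> statistic_density S a b s t" for t by (rule statistic_density_nonneg)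
  next
    show "AE t in statistic_law S e a b r. ((\<lambda>s. ln (statistic_density S a b s t)) has_derivative (\<lambda>h. score S r t \<bullet> h)) (at r)"
      unfolding statistic_law_density[OF e b S v]
    proof (subst AE_density, measurable, intro AE_I2 impI)
      fix t :: "(real^'n^'n) \<times> (real^'n)"
      assume "0 < ennreal (statistic_density S a b r t)"
      \<comment> \<open>The support of the law does not vary with the parameter: its condition
        concerns the matrix alone, and there the log density is differentiable.\<close>
      then have "matrix_density a b (fst t) \<noteq> 0" by (auto simp: statistic_density_def)
      then have "0 < matrix_density a b (fst t)" using matrix_density_nonneg[of a b "fst t"] by linarith
      then show "((\<lambda>s. ln (statistic_density S a b s t)) has_derivative (\<lambda>h. score S r t \<bullet> h)) (at r)"
        by (rule log_density_has_derivative[OF S v])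
    qed
    fix i j
    have m: "(\<lambda>t. score S r t $ i * score S r t $ j) \<in> borel_measurable borel" by measurable
    show "integrable (statistic_law S e a b r) (\<lambda>t. score S r t $ i * score S r t $ j)"
      unfolding law using main[of i j] by (subst integrable_distr_eq[OF sh m]) (simp add: has_bochner_integral_iff)
    show "fisher_matrix S r ?t $ i $ j = (\<integral>t. score S r t $ i * score S r t $ j \<partial>statistic_law S e a b r)"
      unfolding law using main[of i j] by (subst integral_distr[OF sh m]) (simp add: has_bochner_integral_iff)
  qed
qed

section \<open>Asymptotics of the parameters\<close>

text \<open>The entropy is -log p plus ((1 - p) / p) (-ln (1 - p)) / ln 2, and ln x \<le> x - 1 at x
  = 1 / (1 - p) keeps the second term between 0 and 1 / ln 2.\<close>

lemma geom_entropy_bounds: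
  assumes "0 < p" "p < 1"
  shows "- log 2 p \<le> geom_entropy p" "geom_entropy p \<le> - log 2 p + 1 / ln 2"
proof -
  have eq: "geom_entropy p = - log 2 p + (1 - p) / p * (- ln (1 - p)) / ln 2"
    using assms by (simp add: geom_entropy_def binary_entropy_def log_def field_simps)
  have "0 \<le> - ln (1 - p)" using assms by simp
  then have "0 \<le> (1 - p) / p * (- ln (1 - p)) / ln 2"
    using assms by (intro divide_nonneg_pos mult_nonneg_nonneg) auto
  then show "- log 2 p \<le> geom_entropy p" unfolding eq by linarith
  have "- ln (1 - p) = ln (1 / (1 - p))" using assms by (simp add: ln_div)
  also have "\<dots> \<le> 1 / (1 - p) - 1" using assms by (intro ln_le_minus_one) auto
  also have "\<dots> = p / (1 - p)" using assms by (simp add: field_simps)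
  finally have "(1 - p) / p * (- ln (1 - p)) \<le> (1 - p) / p * (p / (1 - p))"
    using assms by (intro mult_left_mono) auto
  then have "(1 - p) / p * (- ln (1 - p)) / ln 2 \<le> 1 / ln 2"
    using assms by (intro divide_right_mono) auto
  then show "geom_entropy p \<le> - log 2 p + 1 / ln 2" unfolding eq by linarith
qed

text \<open>The intermediate value theorem between 2^(-y), where the entropy is at least y, and 1/2,
  where it is at most 1 + 1 / ln 2; this is the origin of the assumed bound on y.\<close>

lemma geom_entropy_inv:
  assumes "1 + 1 / ln 2 \<le> y"
  shows "0 < geom_entropy_inv y" "geom_entropy_inv y < 1" "geom_entropy (geom_entropy_inv y) = y"
proof -
  define p where "p = 2 powr (- y)"
  have "1 \<le> y" using assms by (smt (verit) ln_2_less_1 divide_pos_pos ln_gt_zero)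
  then have "2 powr (- y) \<le> 2 powr (- 1)" by (intro powr_mono) auto
  then have p: "0 < p" "p \<le> 1/2" by (auto simp: p_def powr_minus)
  have hi: "y \<le> geom_entropy p" using geom_entropy_bounds(1)[of p] p by (simp add: p_def log_powr)
  have "log 2 (1/2) = (- 1::real)" by (simp add: log_divide)
  then have lo: "geom_entropy (1/2) \<le> y" using geom_entropy_bounds(2)[of "1/2"] assms by simp
  have "continuous_on {p..1/2} geom_entropy"
    unfolding geom_entropy_def binary_entropy_def log_def using p by (intro continuous_intros) auto
  then obtain x where x: "p \<le> x" "x \<le> 1/2" "geom_entropy x = y"
    using IVT2'[of geom_entropy "1/2" y p] lo hi p by auto
  then have "y \<in> geom_entropy ` {0<..<1}" using p by (intro image_eqI[of _ _ x]) auto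
  then have "geom_entropy_inv y \<in> {0<..<1}" "geom_entropy (geom_entropy_inv y) = y"
    unfolding geom_entropy_inv_def by (rule inv_into_into, rule f_inv_into_f)
  then show "0 < geom_entropy_inv y" "geom_entropy_inv y < 1" "geom_entropy (geom_entropy_inv y) = y" by auto
qed

lemma filterlim_large_budgets: "filterlim (\<lambda>k. k) at_top (large_budgets d)"
  unfolding large_budgets_def by (rule filterlim_mono[OF filterlim_ident]) auto

lemma eventually_large_budgets: "eventually (\<lambda>k. k \<in> budgets d) (large_budgets d)"
  unfolding large_budgets_def by (simp add: eventually_inf_principal)

text \<open>Put s = sqrt (k + 1) - 1, so that k = s^2 + 2 s. An index gets s^2 / d bits and an entry
  2 s / d^2, hence the d indices use s^2 and the d^2 entries use 2 s.\<close>

lemma budget_identities: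
  assumes d: "1 \<le> d" and k: "k \<in> budgets d"
  shows "real (entry_bits_nat d k) = entry_bits d k" "1 \<le> entry_bits_nat d k"
    "index_bits d k = (real (entry_bits_nat d k))\<^sup>2 * real d ^ 3 / 4"
    "real d * index_bits d k + (real d)\<^sup>2 * real (entry_bits_nat d k) = k"
    "k = real d * index_bits d k + 2 * sqrt (real d * index_bits d k)"
proof -
  have k0: "0 < k" using k by (simp add: budgets_def)
  obtain n :: nat where n: "1 \<le> n" "entry_bits d k = real n" using k by (auto simp: budgets_def)
  show n1: "real (entry_bits_nat d k) = entry_bits d k" "1 \<le> entry_bits_nat d k"
    using n by (simp_all add: entry_bits_nat_def)
  define s where "s = sqrt (k + 1) - 1"
  have s0: "0 \<le> s" using k0 by (simp add: s_def)
  have sk: "k = s\<^sup>2 + 2 * s" using k0 by (simp add: s_def power2_eq_square algebra_simps)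
  have ib: "index_bits d k = s\<^sup>2 / real d" by (simp add: index_bits_def s_def)
  have "entry_bits d k = sqrt ((2 * s / (real d)\<^sup>2)\<^sup>2)"
    using d by (simp add: entry_bits_def ib power_divide power_mult_distrib power2_eq_square power3_eq_cube mult_ac)
  then have eb: "entry_bits d k = 2 * s / (real d)\<^sup>2" using s0 by simp
  show "index_bits d k = (real (entry_bits_nat d k))\<^sup>2 * real d ^ 3 / 4"
    unfolding n1(1) eb ib using d by (simp add: field_simps power2_eq_square power3_eq_cube)
  show "real d * index_bits d k + (real d)\<^sup>2 * real (entry_bits_nat d k) = k"
    unfolding n1(1) eb ib using d sk by simp
  show "k = real d * index_bits d k + 2 * sqrt (real d * index_bits d k)"
    unfolding ib using d sk s0 by simp
qed

lemma index_bits_tendsto: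
  assumes d: "1 \<le> d"
  shows "filterlim (index_bits d) at_top (large_budgets d)"
    "filterlim (entry_bits_nat d) at_top (large_budgets d)"
proof -
  have d0: "0 < real d" using d by simp
  have "filterlim (index_bits d) at_top at_top"
    unfolding index_bits_def[abs_def] using d0 by real_asymp
  then show "filterlim (index_bits d) at_top (large_budgets d)"
    by (rule filterlim_compose) (rule filterlim_large_budgets)
  have "filterlim (entry_bits d) at_top at_top"
    unfolding entry_bits_def[abs_def] index_bits_def[abs_def] using d0 by real_asymp
  then have "filterlim (entry_bits d) at_top (large_budgets d)"
    by (rule filterlim_compose) (rule filterlim_large_budgets)
  then have "filterlim (\<lambda>k. real (entry_bits_nat d k)) at_top (large_budgets d)"
    by (rule filterlim_cong[THEN iffD1, rotated -1])
       (use budget_identities(1)[OF d] in \<open>auto intro: eventually_mono[OF eventually_large_budgets]\<close>)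
  then show "filterlim (entry_bits_nat d) at_top (large_budgets d)"
    by (simp add: filterlim_sequentially_iff_filterlim_real)
qed

lemma bulk_power_bounds:
  assumes "0 < b"
  shows "0 < (1 - 2 * Q b) ^ m" "(1 - 2 * Q b) ^ m \<le> 1"
  using Q_less_half[OF assms] Q_pos[of b] by (auto intro!: power_le_one)

text \<open>Here p is the probability of hitting a stopping set. The entropy bounds place it between
  2^(-k_l) and e 2^(-k_l), since 2^(1 / ln 2) = e, so p tends to 0 and the threshold to
  infinity.\<close>

lemma threshold_properties:
  assumes d: "1 \<le> d" and b: "0 < b"
  defines "F \<equiv> large_budgets d" and "D \<equiv> 2 * (1 - 2 * Q b) ^ (d - 1)" and "p \<equiv> (\<lambda>k. geom_entropy_inv (index_bits d k))"
  shows threshold_Q: "eventually (\<lambda>k. Q (threshold d b k) * D = p k \<and> 0 < p k \<and> geom_entropy (p k) = index_bits d k \<and>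
      2 powr (- index_bits d k) \<le> p k \<and> p k \<le> exp 1 * 2 powr (- index_bits d k)) F"
    and threshold_tendsto: "filterlim (threshold d b) at_top F"
    and expected_bits_threshold: "eventually (\<lambda>k. expected_bits d (threshold d b k) b (entry_bits_nat d k) = k) F"
proof -
  have D: "0 < D" "D \<le> 2" using bulk_power_bounds[OF b, of "d - 1"] by (auto simp: D_def)
  note ib = index_bits_tendsto(1)[OF d, folded F_def]
  have pp: "eventually (\<lambda>k. 0 < p k \<and> geom_entropy (p k) = index_bits d k \<and>
      2 powr (- index_bits d k) \<le> p k \<and> p k \<le> exp 1 * 2 powr (- index_bits d k)) F"
  proof -
    have "eventually (\<lambda>k. 1 + 1 / ln 2 \<le> index_bits d k) F"
      using ib by (simp add: filterlim_at_top)
    then show ?thesis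
    proof eventually_elim
      case (elim k)
      note g = geom_entropy_inv[OF elim, folded p_def]
      have p: "0 < p k" "p k < 1" "geom_entropy (p k) = index_bits d k"
        using g by (auto simp: p_def)
      have "- log 2 (p k) \<le> index_bits d k" "index_bits d k \<le> - log 2 (p k) + 1 / ln 2"
        using geom_entropy_bounds[OF p(1,2)] p(3) by auto
      then have 1: "- index_bits d k \<le> log 2 (p k)" and 2: "log 2 (p k) \<le> 1 / ln 2 + - index_bits d k" by auto
      have pl: "p k = 2 powr (log 2 (p k))" using p(1) by simp
      have "2 powr (- index_bits d k) \<le> p k"
        by (subst pl) (intro powr_mono 1, simp)
      moreover have "p k \<le> 2 powr (1 / ln 2 + - index_bits d k)"
        by (subst pl) (intro powr_mono 2, simp)
      moreover have "2 powr (1 / ln 2 + - index_bits d k) = exp 1 * 2 powr (- index_bits d k)"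
        by (subst powr_add) (simp add: powr_def)
      ultimately show ?case using p by simp
    qed
  qed
  have lim0: "((\<lambda>k. exp 1 * 2 powr (- index_bits d k)) \<longlongrightarrow> 0) F"
  proof -
    have "((\<lambda>x::real. exp 1 * 2 powr (- x)) \<longlongrightarrow> 0) at_top" by real_asymp
    then show ?thesis by (rule filterlim_compose[OF _ ib])
  qed
  have small: "eventually (\<lambda>k. p k < c) F" if "0 < c" for c
    using order_tendstoD(2)[OF lim0 that] pp by eventually_elim linarith
  \<comment> \<open>\<open>Q_inv\<close> inverts \<open>Q\<close> at values in (0, 1), so p must
    first drop below D.\<close>
  have QD: "eventually (\<lambda>k. Q (threshold d b k) = p k / D) F"
    using small[OF D(1)] pp
  proof eventually_elim
    case (elim k)
    have "0 < p k / D" "p k / D < 1" using elim D by auto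
    then show ?case unfolding threshold_def using Q_Q_inv by (simp add: p_def D_def)
  qed
  show "eventually (\<lambda>k. Q (threshold d b k) * D = p k \<and> 0 < p k \<and> geom_entropy (p k) = index_bits d k \<and>
      2 powr (- index_bits d k) \<le> p k \<and> p k \<le> exp 1 * 2 powr (- index_bits d k)) F"
    using QD pp by eventually_elim (use D in auto)
  show "filterlim (threshold d b) at_top F"
    unfolding filterlim_at_top
  proof
    fix Z
    have "0 < Q Z * D" using Q_pos[of Z] D by simp
    from small[OF this] QD show "eventually (\<lambda>k. Z \<le> threshold d b k) F"
    proof eventually_elim
      case (elim k)
      then have "Q (threshold d b k) < Q Z" using D by (simp add: divide_less_eq)
      then show ?case using Q_antimono[of "threshold d b k" Z] by linarith
    qed
  qed
  show "eventually (\<lambda>k. expected_bits d (threshold d b k) b (entry_bits_nat d k) = k) F"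
    using QD pp eventually_large_budgets[of d, folded F_def]
  proof eventually_elim
    case (elim k)
    have "2 * Q (threshold d b k) * (1 - 2 * Q b) ^ (d - 1) = Q (threshold d b k) * D" by (simp add: D_def)
    also have "\<dots> = p k" using elim D by simp
    finally show ?case
      using elim budget_identities(4)[OF d, of k] by (simp add: expected_bits_def)
  qed
qed

lemma ln_std_normal_density: "ln (std_normal_density x) = - ln (2 * pi) / 2 - x\<^sup>2 / 2"
  by (simp add: std_normal_density_def ln_mult ln_div ln_sqrt field_simps)

text \<open>The Mills bounds give ln Q(a) = -a^2 / 2 up to O(ln a), and ln Q(a) is -k_l ln 2 up to a
  constant. The upper bound for a in terms of k_l yields the first claim, as k_l is quadratic in n;
  the upper bound for k_l in terms of a yields the second.\<close>

lemma threshold_growth: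
  assumes d: "1 \<le> d" and b: "0 < b"
  defines "F \<equiv> large_budgets d" and "a \<equiv> threshold d b"
  shows "((\<lambda>k. a k / 2 ^ entry_bits_nat d k) \<longlongrightarrow> 0) F"
    and "\<exists>U. (U \<longlongrightarrow> real d / (2 * ln 2)) F \<and> eventually (\<lambda>k. k / (a k - real d * b)\<^sup>2 \<le> U k) F"
proof -
  define D where "D = 2 * (1 - 2 * Q b) ^ (d - 1)"
  have D: "0 < D" "D \<le> 2" using bulk_power_bounds[OF b, of "d - 1"] by (auto simp: D_def)
  have d0: "0 < real d" using d by simp
  note aQ = threshold_Q[OF d b, folded F_def a_def D_def]
  note at = threshold_tendsto[OF d b, folded F_def a_def]
  have a_ge: "eventually (\<lambda>k. c \<le> a k) F" for c using at by (simp add: filterlim_at_top)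
  \<comment> \<open>The three constants stem from the normal density, the factor e in the bound for
    p, and the bulk factor in p = Q(a) D. \<open>G\<close> then bounds k_l as a function of the
    threshold.\<close>
  define C where "C = ln (2 * pi) / 2 + 1 - ln D"
  define G where "G x = (x\<^sup>2 / 2 + ln (1 + x\<^sup>2) + C) / ln 2" for x
  have bounds: "eventually (\<lambda>k. index_bits d k \<le> G (a k) \<and> (a k)\<^sup>2 \<le> 2 * ln 2 * index_bits d k + 2 * ln 2) F"
    using aQ a_ge[of 1]
  proof eventually_elim
    case (elim k)
    define p where "p = geom_entropy_inv (index_bits d k)"
    define x where "x = a k"
    have x1: "1 \<le> x" using elim by (simp add: x_def)
    have p: "Q x = p / D" "0 < p" "2 powr (- index_bits d k) \<le> p" "p \<le> exp 1 * 2 powr (- index_bits d k)"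
      using elim D by (auto simp: p_def x_def field_simps)
    have lp: "- index_bits d k * ln 2 \<le> ln p" "ln p \<le> 1 - index_bits d k * ln 2"
    proof -
      have "ln (2 powr (- index_bits d k)) \<le> ln p" using p by (subst ln_le_cancel_iff) auto
      then show "- index_bits d k * ln 2 \<le> ln p" by (simp add: ln_powr)
      have "ln p \<le> ln (exp 1 * 2 powr (- index_bits d k))" using p by (subst ln_le_cancel_iff) auto
      then show "ln p \<le> 1 - index_bits d k * ln 2" by (simp add: ln_mult ln_powr)
    qed
    have lQ: "ln (Q x) = ln p - ln D" using p D by (simp add: ln_div)
    have phi: "0 < std_normal_density x" by (rule normal_density_pos) simp
    have "std_normal_density x / (1 + x\<^sup>2) \<le> Q x"
    proof -
      have "1 * std_normal_density x \<le> x * std_normal_density x" using x1 phi by (intro mult_right_mono) auto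
      then have "std_normal_density x \<le> (1 + x\<^sup>2) * Q x" using Q_lower[OF x1] by simp
      moreover have "0 < 1 + x\<^sup>2" by (simp add: add_pos_nonneg)
      ultimately show ?thesis by (simp add: pos_divide_le_eq mult.commute)
    qed
    then have "ln (std_normal_density x / (1 + x\<^sup>2)) \<le> ln (Q x)"
      using phi Q_pos[of x] by (subst ln_le_cancel_iff) (auto simp: add_pos_nonneg)
    moreover have "ln (std_normal_density x / (1 + x\<^sup>2)) = ln (std_normal_density x) - ln (1 + x\<^sup>2)"
      using phi by (intro ln_divide_pos) (auto simp: add_pos_nonneg)
    ultimately have "index_bits d k * ln 2 \<le> x\<^sup>2 / 2 + ln (1 + x\<^sup>2) + C"
      using lQ lp by (simp add: ln_std_normal_density C_def)
    then have 1: "index_bits d k \<le> G x" by (simp add: G_def pos_le_divide_eq)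
    have "Q x \<le> std_normal_density x"
    proof -
      have "1 * Q x \<le> x * Q x" using x1 Q_pos[of x] by (intro mult_right_mono) auto
      then show ?thesis using Q_upper[OF x1] by simp
    qed
    then have "ln (Q x) \<le> ln (std_normal_density x)"
      using phi Q_pos[of x] by (subst ln_le_cancel_iff) auto
    moreover have "0 \<le> ln (2 * pi)" using pi_gt3 by (intro ln_ge_zero) auto
    moreover have "ln D \<le> ln 2" using D by (subst ln_le_cancel_iff) auto
    ultimately have "x\<^sup>2 \<le> 2 * ln 2 * index_bits d k + 2 * ln 2"
    proof -
      assume *: "ln (Q x) \<le> ln (std_normal_density x)" "0 \<le> ln (2 * pi)" "ln D \<le> ln 2"
      have "- (index_bits d k * ln 2) \<le> ln p" using lp by simp
      then have "x\<^sup>2 \<le> 2 * (ln 2 + index_bits d k * ln 2)"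
      proof -
        \<comment> \<open>A linear consequence of the preceding inequalities, with X = x^2, I = k_l
          ln 2, L = ln 2, A = ln Q(x), B = ln p and E = ln D.\<close>
        have "X \<le> 2 * (L + I)" if "- I \<le> B" "A \<le> - c / 2 - X / 2" "0 \<le> c" "E \<le> L" "A = B - E" for A B c E I L X :: real
          using that by (smt (verit) field_sum_of_halves)
        from this[OF _ *(1)[unfolded ln_std_normal_density] *(2,3) lQ] show "- (index_bits d k * ln 2) \<le> ln p \<Longrightarrow> ?thesis" .
      qed
      then show ?thesis by (simp add: algebra_simps)
    qed
    then show ?case using 1 by (simp add: x_def)
  qed
  show "((\<lambda>k. a k / 2 ^ entry_bits_nat d k) \<longlongrightarrow> 0) F"
  proof (rule tendsto_sandwich)
    let ?h = "\<lambda>n::nat. sqrt (2 * ln 2 * ((real n)\<^sup>2 * real d ^ 3 / 4) + 2 * ln 2) / 2 ^ n"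
    show "eventually (\<lambda>k. 0 \<le> a k / 2 ^ entry_bits_nat d k) F"
      using a_ge[of 0] by eventually_elim simp
    show "eventually (\<lambda>k. a k / 2 ^ entry_bits_nat d k \<le> ?h (entry_bits_nat d k)) F"
      using bounds eventually_large_budgets[of d, folded F_def]
    proof eventually_elim
      case (elim k)
      then have "(a k)\<^sup>2 \<le> 2 * ln 2 * ((real (entry_bits_nat d k))\<^sup>2 * real d ^ 3 / 4) + 2 * ln 2"
        using budget_identities(3)[OF d, of k] by simp
      then have "a k \<le> sqrt (2 * ln 2 * ((real (entry_bits_nat d k))\<^sup>2 * real d ^ 3 / 4) + 2 * ln 2)"
        by (rule real_le_rsqrt)
      then show ?case by (rule divide_right_mono) simp
    qed
    have "?h \<longlonglongrightarrow> 0" using d0 by real_asymp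
    then show "((\<lambda>k. ?h (entry_bits_nat d k)) \<longlongrightarrow> 0) F"
      by (rule filterlim_compose) (use index_bits_tendsto(2)[OF d] in \<open>simp add: F_def\<close>)
  qed simp
  show "\<exists>U. (U \<longlongrightarrow> real d / (2 * ln 2)) F \<and> eventually (\<lambda>k. k / (a k - real d * b)\<^sup>2 \<le> U k) F"
  proof (intro exI conjI)
    \<comment> \<open>Since k = d k_l + 2 sqrt (d k_l) increases with k_l, \<open>G\<close> may be
      put in place of k_l.\<close>
    let ?U = "\<lambda>x. (real d * G x + 2 * sqrt (real d * G x)) / (x - real d * b)\<^sup>2"
    have "(?U \<longlongrightarrow> real d * inverse (ln 2) / 2) at_top"
      unfolding G_def using d0 by real_asymp
    also have "real d * inverse (ln 2) / 2 = real d / (2 * ln 2)" by (simp add: field_simps)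
    finally show "((\<lambda>k. ?U (a k)) \<longlongrightarrow> real d / (2 * ln 2)) F" by (rule filterlim_compose[OF _ at])
    show "eventually (\<lambda>k. k / (a k - real d * b)\<^sup>2 \<le> ?U (a k)) F"
      using bounds eventually_large_budgets[of d, folded F_def]
    proof eventually_elim
      case (elim k)
      have "real d * index_bits d k \<le> real d * G (a k)" using elim d0 by (intro mult_left_mono) auto
      then have "k \<le> real d * G (a k) + 2 * sqrt (real d * G (a k))"
        using budget_identities(5)[OF d, of k] elim by (smt (verit) real_sqrt_le_mono)
      then show ?case by (rule divide_right_mono) simp
    qed
  qed
qed

text \<open>With c = sqrt 3 * a the densities at c and a differ by the factor exp (-a^2), which
  beats the rational factors left by the Mills bounds. This is why overshooting is
  negligible.\<close>

lemma tail_ratio_tendsto: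
  "((\<lambda>a. (sqrt 3 * a * std_normal_density (sqrt 3 * a) + Q (sqrt 3 * a)) / Q a) \<longlongrightarrow> 0) at_top"
proof (rule tendsto_sandwich)
  let ?h = "\<lambda>a. (sqrt 3 * a + 1 / (sqrt 3 * a)) * ((1 + a\<^sup>2) / a) * exp (- a\<^sup>2)"
  show "eventually (\<lambda>a. 0 \<le> (sqrt 3 * a * std_normal_density (sqrt 3 * a) + Q (sqrt 3 * a)) / Q a) at_top"
    using eventually_ge_at_top[of 0] 

  proof eventually_elim
    case (elim a)
    then have "0 \<le> sqrt 3 * a * std_normal_density (sqrt 3 * a)" by simp
    then show ?case using Q_pos[of "sqrt 3 * a"] Q_pos[of a] by (intro divide_nonneg_pos) auto
  qed
  show "eventually (\<lambda>a. (sqrt 3 * a * std_normal_density (sqrt 3 * a) + Q (sqrt 3 * a)) / Q a \<le> ?h a) at_top"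
    using eventually_ge_at_top[of 1]
  proof eventually_elim
    case (elim a)
    have a: "0 < a" using elim by simp
    define c where "c = sqrt 3 * a"
    have "1 \<le> sqrt 3" by (rule real_le_rsqrt) simp
    then have c: "1 \<le> c" using elim mult_mono[of 1 "sqrt 3" 1 a] by (simp add: c_def)
    have phi: "0 < std_normal_density a" by (rule normal_density_pos) simp
    have "c\<^sup>2 = 3 * a\<^sup>2" by (simp add: c_def power_mult_distrib)
    then have ratio: "std_normal_density c = exp (- a\<^sup>2) * std_normal_density a"
      by (simp add: std_normal_density_def exp_add[symmetric])
    have "Q c \<le> std_normal_density c / c" using Q_upper[OF c] c by (simp add: pos_le_divide_eq mult.commute)
    then have "c * std_normal_density c + Q c \<le> (c + 1 / c) * std_normal_density c" by (simp add: distrib_right)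
    moreover have "std_normal_density a \<le> (1 + a\<^sup>2) / a * Q a"
      using Q_lower[OF elim] a by (simp add: pos_le_divide_eq mult.commute)
    then have "(c + 1 / c) * (exp (- a\<^sup>2) * std_normal_density a) \<le> (c + 1 / c) * (exp (- a\<^sup>2) * ((1 + a\<^sup>2) / a * Q a))"
      using c by (intro mult_left_mono) auto
    ultimately have "c * std_normal_density c + Q c \<le> (c + 1 / c) * ((1 + a\<^sup>2) / a) * exp (- a\<^sup>2) * Q a"
      by (simp add: ratio mult_ac)
    then show ?case using Q_pos[of a] by (simp add: pos_divide_le_eq flip: c_def)
  qed
  show "((\<lambda>a. ?h a) \<longlongrightarrow> 0) at_top" by real_asymp
qed simp

lemma quant_error_nonneg: "0 < a \<Longrightarrow> 0 \<le> quant_error d a b n"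
  unfolding quant_error_def
  by (intro add_nonneg_nonneg mult_nonneg_nonneg divide_nonneg_pos Q_pos less_imp_le[OF Q_pos]) auto

lemma error_terms_tendsto:
  assumes a: "filterlim a at_top F" and n: "filterlim n sequentially F" and an: "((\<lambda>k. a k / 2 ^ n k) \<longlongrightarrow> 0) F"
  shows quant_error_tendsto: "((\<lambda>k. quant_error d (a k) b (n k)) \<longlongrightarrow> 0) F"
    and gain_gap_tendsto: "((\<lambda>k. gain_gap d (a k) b (n k)) \<longlongrightarrow> 0) F"
proof -
  have step: "((\<lambda>k. step_error (a k) (n k)) \<longlongrightarrow> 0) F"
  proof (rule Lim_transform_eventually)
    show "((\<lambda>k. 2 * (sqrt 3 - 1) * (a k / 2 ^ n k)) \<longlongrightarrow> 0) F"
      using tendsto_mult_right_zero[OF an] by simp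
    have "eventually (\<lambda>k. 1 \<le> n k) F" using n by (simp add: filterlim_at_top)
    \<comment> \<open>Half of the 2^n cells serve each sign, hence the factor 2 once n is at least
      1.\<close>
    then show "eventually (\<lambda>k. 2 * (sqrt 3 - 1) * (a k / 2 ^ n k) = step_error (a k) (n k)) F"
    proof eventually_elim
      case (elim k)
      then obtain m where "n k = Suc m" by (cases "n k") auto
      then show ?case by (simp add: step_error_def field_simps)
    qed
  qed
  have p2: "((\<lambda>k. 2 * b / 2 ^ n k) \<longlongrightarrow> 0) F"
  proof -
    have "(\<lambda>n. 2 * b * (1 / 2) ^ n) \<longlonglongrightarrow> 0"
      by (intro tendsto_mult_right_zero LIMSEQ_realpow_zero) auto
    then have "(\<lambda>n. 2 * b / 2 ^ n) \<longlonglongrightarrow> 0" by (simp add: power_one_over)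
    then show ?thesis by (rule filterlim_compose[OF _ n])
  qed
  note tail = filterlim_compose[OF tail_ratio_tendsto a]
  have "((\<lambda>k. quant_error d (a k) b (n k)) \<longlongrightarrow> (real d)\<^sup>2 * 0\<^sup>2 + real d * (2 * 0\<^sup>2 + 2 * 0)) F"
    unfolding quant_error_def by (intro tendsto_intros step p2 tail)
  then show "((\<lambda>k. quant_error d (a k) b (n k)) \<longlongrightarrow> 0) F" by simp
  have i: "((\<lambda>k. inverse (a k)) \<longlongrightarrow> 0) F" by (rule tendsto_inverse_0_at_top[OF a])
  have expand: "(D * (2 + 2 * (q * x) * h + h\<^sup>2) + 2 * D * b * (s * x) + (D * b)\<^sup>2) / x\<^sup>2 =
      D * (2 * (inverse x)\<^sup>2 + 2 * q * inverse x * h + h\<^sup>2 * (inverse x)\<^sup>2) + 2 * D * b * s * inverse x + (D * b)\<^sup>2 * (inverse x)\<^sup>2"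
    if "x \<noteq> 0" for D q x h s :: real
    using that by (simp add: field_simps power2_eq_square)
  have lim: "((\<lambda>k. real d * (2 * (inverse (a k))\<^sup>2 + 2 * sqrt 3 * inverse (a k) * step_error (a k) (n k) + (step_error (a k) (n k))\<^sup>2 * (inverse (a k))\<^sup>2) +
     2 * real d * b * sqrt (1 + 2 * real d) * inverse (a k) + (real d * b)\<^sup>2 * (inverse (a k))\<^sup>2) \<longlongrightarrow>
     real d * (2 * 0\<^sup>2 + 2 * sqrt 3 * 0 * 0 + 0\<^sup>2 * 0\<^sup>2) + 2 * real d * b * sqrt (1 + 2 * real d) * 0 + (real d * b)\<^sup>2 * 0\<^sup>2) F"
    by (intro tendsto_intros step i)
  have eq: "eventually (\<lambda>k. real d * (2 * (inverse (a k))\<^sup>2 + 2 * sqrt 3 * inverse (a k) * step_error (a k) (n k) + (step_error (a k) (n k))\<^sup>2 * (inverse (a k))\<^sup>2) +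
     2 * real d * b * sqrt (1 + 2 * real d) * inverse (a k) + (real d * b)\<^sup>2 * (inverse (a k))\<^sup>2 = gain_gap d (a k) b (n k)) F"
  proof -
    have "eventually (\<lambda>k. 1 \<le> a k) F" using a by (simp add: filterlim_at_top)
    then show ?thesis
      proof eventually_elim
      case (elim k)
      then have "a k \<noteq> 0" by simp
      then show ?case unfolding gain_gap_def by (rule expand[symmetric])
    qed
  qed
  show "((\<lambda>k. gain_gap d (a k) b (n k)) \<longlongrightarrow> 0) F"
    using Lim_transform_eventually[OF lim eq] by simp
qed

text \<open>Off-diagonal entries contribute a constant independent of a, so the moment lies between
  a^2 and a^2 plus a constant.\<close>

lemma column_moment_tendsto:
  assumes a: "filterlim a at_top F" and b: "0 < b"
  shows "((\<lambda>k. column_moment TYPE('n::finite) (a k) b / (a k)\<^sup>2) \<longlongrightarrow> 1) F"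
    "eventually (\<lambda>k. 0 < column_moment TYPE('n) (a k) b) F"
proof -
  define c where "c = (real CARD('n) - 1) * ((\<integral>x. indicator {x. \<bar>x\<bar> < b} x * std_normal_density x * x\<^sup>2 \<partial>lborel) / (1 - 2 * Q b))"
  have c: "0 \<le> c"
    unfolding c_def using Q_less_half[OF b] by (intro mult_nonneg_nonneg divide_nonneg_nonneg integral_nonneg_AE) auto
  have bd: "eventually (\<lambda>k. 1 \<le> a k \<and> (a k)\<^sup>2 \<le> column_moment TYPE('n) (a k) b \<and> column_moment TYPE('n) (a k) b \<le> (a k)\<^sup>2 + (2 + c)) F"
  proof -
    have "eventually (\<lambda>k. 1 \<le> a k) F" using a by (simp add: filterlim_at_top)
    then show ?thesis
    proof eventually_elim
      case (elim k)
      show ?case using diag_second_moment_bounds[OF elim] c elim unfolding column_moment_def c_def[symmetric] by linarith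
    qed
  qed
  show "((\<lambda>k. column_moment TYPE('n) (a k) b / (a k)\<^sup>2) \<longlongrightarrow> 1) F"
  proof (rule tendsto_sandwich)
    show "eventually (\<lambda>k. 1 \<le> column_moment TYPE('n) (a k) b / (a k)\<^sup>2) F"
      using bd by eventually_elim (simp add: pos_le_divide_eq)
    show "eventually (\<lambda>k. column_moment TYPE('n) (a k) b / (a k)\<^sup>2 \<le> ((a k)\<^sup>2 + (2 + c)) / (a k)\<^sup>2) F"
      using bd by eventually_elim (intro divide_right_mono, auto)
    have "((\<lambda>x::real. (x\<^sup>2 + (2 + c)) / x\<^sup>2) \<longlongrightarrow> 1) at_top" by real_asymp
    then show "((\<lambda>k. ((a k)\<^sup>2 + (2 + c)) / (a k)\<^sup>2) \<longlongrightarrow> 1) F" by (rule filterlim_compose[OF _ a])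
  qed simp
  show "eventually (\<lambda>k. 0 < column_moment TYPE('n) (a k) b) F"
    using bd
  proof eventually_elim
    case (elim k)
    have "0 < (a k)\<^sup>2" using elim by (intro zero_less_power) auto
    then show ?case using elim by linarith
  qed
qed

section \<open>The estimator on the original space, and the efficiency limit\<close>

lemma estimator_law:
  fixes e :: "nat \<Rightarrow> 'n::finite" and S :: "real^'n^'n" and Xs :: "nat \<Rightarrow> 'w \<Rightarrow> real^'n"
    and a b :: real and n :: nat and \<theta> :: "'n \<Rightarrow> 'n \<Rightarrow> nat \<Rightarrow> real"
  assumes M: "prob_space M" and e: "bij_betw e {1..CARD('n)} UNIV" and b: "0 < b" and S: "positive_definite S"
    and indep: "prob_space.indep_vars M (\<lambda>_. borel) (\<lambda>i \<omega>. (Xs i \<omega>, Ys i \<omega>)) {1..}"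
    and law: "\<And>i. 1 \<le> i \<Longrightarrow> distr M borel (\<lambda>\<omega>. (Xs i \<omega>, Ys i \<omega>)) = pair_law S r"
  defines "V \<equiv> \<lambda>\<omega>. stopping_estimator S e a b n \<theta> (\<lambda>i. Xs i \<omega>) (\<lambda>i. Ys i \<omega>)"
  shows "V \<in> borel_measurable M"
    "distr M borel V = distr (matrix_law a b \<Otimes>\<^sub>M std_gaussian) borel (\<lambda>x. estimator_map S a b n \<theta> (shift_map S r x))"
proof -
  let ?T = "\<lambda>\<omega>. stopping_statistic S e a b (\<lambda>i. Xs i \<omega>) (\<lambda>i. Ys i \<omega>)"
  note T = law_of_stopping_statistic[OF M e indep law]
  have V: "V = (\<lambda>\<omega>. estimator_map S a b n \<theta> (?T \<omega>))"
    by (simp add: V_def stopping_estimator_eq)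
  show "V \<in> borel_measurable M" unfolding V by (rule measurable_compose[OF T(1) measurable_estimator_map])
  have sh: "shift_map S r \<in> measurable (matrix_law a b \<Otimes>\<^sub>M std_gaussian) borel"
    by (subst measurable_cong_sets[OF sets_matrix_law_pair refl]) (rule measurable_shift_map)
  have "distr M borel V = distr (distr M borel ?T) borel (estimator_map S a b n \<theta>)"
    unfolding V by (rule distr_distr[OF measurable_estimator_map T(1), unfolded o_def, symmetric])
  also have "\<dots> = distr (distr (matrix_law a b \<Otimes>\<^sub>M std_gaussian) borel (shift_map S r)) borel (estimator_map S a b n \<theta>)"
    by (simp only: T(2) statistic_law_eq[OF e b S])
  also have "\<dots> = distr (matrix_law a b \<Otimes>\<^sub>M std_gaussian) borel (\<lambda>x. estimator_map S a b n \<theta> (shift_map S r x))"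
    by (subst distr_distr[OF measurable_estimator_map sh]) (simp add: o_def)
  finally show "distr M borel V = distr (matrix_law a b \<Otimes>\<^sub>M std_gaussian) borel (\<lambda>x. estimator_map S a b n \<theta> (shift_map S r x))" .
qed

text \<open>The rank-one correction in the inverse has coefficient \<beta> / (\<alpha> + const),
  which tends to 0 because \<alpha> grows like t. So information from the noise variance does not
  affect the limit.\<close>

lemma fisher_quadratic_form_tendsto:
  fixes S :: "real^'n^'n"
  assumes S: "positive_definite S" and v: "0 < noise_variance S r" and a: "filterlim a at_top F"
    and t: "((\<lambda>k. t k / (a k)\<^sup>2) \<longlongrightarrow> 1) F" and tpos: "eventually (\<lambda>k. 0 < t k) F"
  shows "((\<lambda>k. (a k)\<^sup>2 * (x \<bullet> (matrix_inv (fisher_matrix S r (t k)) *v x))) \<longlongrightarrow> noise_variance S r * (x \<bullet> (S *v x))) F"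
proof -
  let ?v = "noise_variance S r"
  define \<beta> where "\<beta> = 2 * real CARD('n) / ?v\<^sup>2"
  have apos: "eventually (\<lambda>k. 0 < a k) F"
    using a by (auto simp: filterlim_at_top_dense)
  have a2: "filterlim (\<lambda>k. (a k)\<^sup>2) at_top F"
    using filterlim_compose[OF _ a, of "\<lambda>x::real. x\<^sup>2" at_top] by (simp add: filterlim_pow_at_top filterlim_ident)
  have t1: "filterlim (\<lambda>k. t k / (a k)\<^sup>2 * (a k)\<^sup>2) at_top F"
    by (rule filterlim_tendsto_pos_mult_at_top[OF t _ a2]) simp
  have t2: "eventually (\<lambda>k. t k / (a k)\<^sup>2 * (a k)\<^sup>2 = t k) F"
    using apos by eventually_elim simp
  have tt: "filterlim t at_top F"
    by (rule iffD1[OF filterlim_cong[OF refl refl t2] t1])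
  have "filterlim (\<lambda>k. 1 / ?v * t k) at_top F"
    using v by (intro filterlim_tendsto_pos_mult_at_top[OF tendsto_const _ tt]) simp
  then have "filterlim (\<lambda>k. \<beta> * (1 - ?v) + 1 / ?v * t k) at_top F"
    by (rule filterlim_tendsto_add_at_top[OF tendsto_const])
  then have "((\<lambda>k. inverse (\<beta> * (1 - ?v) + 1 / ?v * t k)) \<longlongrightarrow> 0) F"
    by (rule tendsto_inverse_0_at_top)
  then have g: "((\<lambda>k. \<beta> * inverse (\<beta> * (1 - ?v) + 1 / ?v * t k)) \<longlongrightarrow> \<beta> * 0) F"
    by (intro tendsto_intros)
  have ti: "((\<lambda>k. ?v * inverse (t k / (a k)\<^sup>2)) \<longlongrightarrow> ?v * inverse 1) F"
    by (intro tendsto_intros t) simp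
  have lim: "((\<lambda>k. ?v * inverse (t k / (a k)\<^sup>2) * (x \<bullet> (S *v x) - \<beta> * inverse (\<beta> * (1 - ?v) + 1 / ?v * t k) * (r \<bullet> x)\<^sup>2)) \<longlongrightarrow>
     ?v * inverse 1 * (x \<bullet> (S *v x) - \<beta> * 0 * (r \<bullet> x)\<^sup>2)) F"
    by (intro tendsto_mult tendsto_diff tendsto_const ti g)
  have eq: "eventually (\<lambda>k. ?v * inverse (t k / (a k)\<^sup>2) * (x \<bullet> (S *v x) - \<beta> * inverse (\<beta> * (1 - ?v) + 1 / ?v * t k) * (r \<bullet> x)\<^sup>2) =
     (a k)\<^sup>2 * (x \<bullet> (matrix_inv (fisher_matrix S r (t k)) *v x))) F"
    using tpos
  proof eventually_elim
    case (elim k)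
    show ?case
      unfolding fisher_matrix_inverse(2)[OF S v elim] \<beta>_def[symmetric]
      by (simp add: divide_inverse add.commute mult_ac)
  qed
  show ?thesis using Lim_transform_eventually[OF lim eq] by simp
qed

theorem theorem4:
  fixes M :: "'w measure"
    and X :: "'w \<Rightarrow> real^'n" and Y :: "'w \<Rightarrow> real"
    and Xs :: "nat \<Rightarrow> 'w \<Rightarrow> real^'n" and Ys :: "nat \<Rightarrow> 'w \<Rightarrow> real"
    and S :: "real^'n^'n" and \<rho> :: "real^'n"
    and e :: "nat \<Rightarrow> 'n" and b0 :: real
    and \<theta> :: "nat \<Rightarrow> 'n \<Rightarrow> 'n \<Rightarrow> nat \<Rightarrow> real"
  defines "d \<equiv> CARD('n)"
  defines "a \<equiv> threshold d b0"
  defines "n \<equiv> entry_bits_nat d"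
  defines "est \<equiv> (\<lambda>k \<omega>. stopping_estimator S e (a k) b0 (n k) (\<theta> (n k))
                          (\<lambda>i. Xs i \<omega>) (\<lambda>i. Ys i \<omega>))"
  assumes "prob_space M"
    and "gaussian_vector M (\<lambda>\<omega>. (X \<omega>, Y \<omega>))"
    and "distributed M lborel Y std_normal_density"
    and "multivariate_normal M X 0 S"
    and "invertible S" and "\<And>l. S $ l $ l = 1"
    and "\<rho> = (\<chi> l. \<integral>\<omega>. Y \<omega> * X \<omega> $ l \<partial>M)"
    and "prob_space.indep_vars M (\<lambda>_. borel) (\<lambda>i \<omega>. (Xs i \<omega>, Ys i \<omega>)) {1..}"
    and "\<And>i. 1 \<le> i \<Longrightarrow>
           distr M borel (\<lambda>\<omega>. (Xs i \<omega>, Ys i \<omega>)) = distr M borel (\<lambda>\<omega>. (X \<omega>, Y \<omega>))"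
    and "bij_betw e {1..d} UNIV"
    and "0 < b0"
    and "\<And>m i l j. 0 \<le> \<theta> m i l j \<and> \<theta> m i l j \<le> 1"
  shows "(\<exists>\<epsilon>. (\<epsilon> \<longlongrightarrow> 0) (large_budgets d) \<and>
            (\<forall>\<^sub>F k in large_budgets d.
               expected_bits d (a k) b0 (n k) = k \<and>
               integrable M (\<lambda>\<omega>. (norm (est k \<omega> - \<rho>))\<^sup>2) \<and>
               (\<integral>\<omega>. (norm (est k \<omega> - \<rho>))\<^sup>2 \<partial>M)
                 \<le> 1 / k * ((real d)\<^sup>2 / (2 * ln 2) * (MIN l. 1 - (\<rho> $ l)\<^sup>2) + \<epsilon> k)))
       \<and> (0 < noise_variance S \<rho> \<longrightarrow>
            asymptotically_efficient (large_budgets d) M {s. 0 < noise_variance S s}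
              (\<lambda>k. statistic_law S e (a k) b0) est \<rho>)"
proof -
  define F where "F = large_budgets d"
  let ?u = "norm (matrix_inv (matrix_sqrt S) *v \<rho>)" and ?v = "noise_variance S \<rho>"
  note M = \<open>prob_space M\<close>
  interpret prob_space M by (rule M)
  have S: "positive_definite S" and v0: "0 \<le> ?v" and XY: "distr M borel (\<lambda>\<omega>. (X \<omega>, Y \<omega>)) = pair_law S \<rho>"
    using joint_gaussian_law[OF assms(5-9,11)] by auto
  have d1: "1 \<le> d" by (simp add: d_def Suc_le_eq)
  note e = \<open>bij_betw e {1..d} UNIV\<close>[unfolded d_def]
  note b0 = \<open>0 < b0\<close>
  have law: "distr M borel (\<lambda>\<omega>. (Xs i \<omega>, Ys i \<omega>)) = pair_law S \<rho>" if "1 \<le> i" for i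
    using assms(13)[OF that] XY by simp
  note est_law = estimator_law[OF M e b0 S assms(12) law]
  have est_meas: "est k \<in> borel_measurable M" for k unfolding est_def by (rule est_law(1))
  have est_distr: "distr M borel (est k) = distr (matrix_law (a k) b0 \<Otimes>\<^sub>M std_gaussian) borel
      (\<lambda>x. estimator_map S (a k) b0 (n k) (\<theta> (n k)) (shift_map S \<rho> x))" for k
    unfolding est_def by (rule est_law(2))
  note at = threshold_tendsto[OF d1 b0, folded F_def a_def]
  note nt = index_bits_tendsto(2)[OF d1, folded F_def n_def]
  note qe = quant_error_tendsto[OF at nt threshold_growth(1)[OF d1 b0, folded F_def a_def n_def], of d b0]
  note gg = gain_gap_tendsto[OF at nt threshold_growth(1)[OF d1 b0, folded F_def a_def n_def], of d b0]
  have qs: "eventually (\<lambda>k. quantized_sampling S (a k) b0 (\<theta> (n k)) \<and> 1 \<le> a k) F"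
  proof -
    have "eventually (\<lambda>k. 1 \<le> a k) F" "eventually (\<lambda>k. real d * b0 + 1 \<le> a k) F"
      using at by (auto simp: filterlim_at_top)
    then show ?thesis
    proof eventually_elim
      case (elim k)
      then show ?case using S b0 assms(16) by (auto simp: quantized_sampling_def d_def)
    qed
  qed
  define B where "B k = real d * (?u\<^sup>2 * quant_error d (a k) b0 (n k) + ?v)" for k
  \<comment> \<open>The centre c is left free: c = \<rho> serves the error bound and c = 0 the
    square integrability demanded by efficiency.\<close>
  have mse: "eventually (\<lambda>k. integrable M (\<lambda>\<omega>. (norm (est k \<omega> - c))\<^sup>2) \<and>
      (\<integral>\<omega>. (norm (est k \<omega> - \<rho>))\<^sup>2 \<partial>M) \<le> B k / (a k - real d * b0)\<^sup>2) F" for c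
    using qs
  proof eventually_elim
    case (elim k)
    then interpret quantized_sampling S "a k" b0 "n k" "\<theta> (n k)" by blast
    show ?case
      using estimator_square_integrable[OF M est_meas est_distr v0] estimator_mse[OF M est_meas est_distr v0 assms(10)]
      by (simp add: B_def d_def)
  qed
  have part1: "\<exists>\<epsilon>. (\<epsilon> \<longlongrightarrow> 0) F \<and> (\<forall>\<^sub>F k in F. expected_bits d (a k) b0 (n k) = k \<and>
               integrable M (\<lambda>\<omega>. (norm (est k \<omega> - \<rho>))\<^sup>2) \<and>
               (\<integral>\<omega>. (norm (est k \<omega> - \<rho>))\<^sup>2 \<partial>M)
                 \<le> 1 / k * ((real d)\<^sup>2 / (2 * ln 2) * (MIN l. 1 - (\<rho> $ l)\<^sup>2) + \<epsilon> k))"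
  proof -
    obtain U where U: "(U \<longlongrightarrow> real d / (2 * ln 2)) F" and kU: "eventually (\<lambda>k. k / (a k - real d * b0)\<^sup>2 \<le> U k) F"
      using threshold_growth(2)[OF d1 b0] unfolding F_def a_def by blast
    let ?c = "(real d)\<^sup>2 / (2 * ln 2)"
    \<comment> \<open>The o(1) term is chosen with the noise variance in place of the minimum; B
      tends to d \<sigma>^2 and U to d / (2 ln 2), so it vanishes. The passage to the minimum is
      then \<open>vmin\<close>.\<close>
    have "((\<lambda>k. B k * U k - ?c * ?v) \<longlongrightarrow> real d * (?u\<^sup>2 * 0 + ?v) * (real d / (2 * ln 2)) - ?c * ?v) F"
      unfolding B_def by (intro tendsto_intros qe U)
    then have eps: "((\<lambda>k. B k * U k - ?c * ?v) \<longlongrightarrow> 0) F" by (simp add: power2_eq_square)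
    have vmin: "?v \<le> (MIN l. 1 - (\<rho> $ l)\<^sup>2)"
      using noise_variance_le[OF S assms(10)] by (intro Min.boundedI) auto
    show ?thesis
    proof (intro exI conjI)
      show "((\<lambda>k. B k * U k - ?c * ?v) \<longlongrightarrow> 0) F" by (rule eps)
      show "\<forall>\<^sub>F k in F. expected_bits d (a k) b0 (n k) = k \<and>
               integrable M (\<lambda>\<omega>. (norm (est k \<omega> - \<rho>))\<^sup>2) \<and>
               (\<integral>\<omega>. (norm (est k \<omega> - \<rho>))\<^sup>2 \<partial>M)
                 \<le> 1 / k * (?c * (MIN l. 1 - (\<rho> $ l)\<^sup>2) + (B k * U k - ?c * ?v))"
        using expected_bits_threshold[OF d1 b0, folded F_def a_def n_def] mse[of \<rho>] kU qs eventually_large_budgets[of d, folded F_def]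
      proof eventually_elim
        case (elim k)
        have k0: "0 < k" using elim by (simp add: budgets_def)
        have "0 \<le> B k"
          unfolding B_def using quant_error_nonneg[of "a k" d b0 "n k"] elim v0
          by (intro mult_nonneg_nonneg add_nonneg_nonneg) auto
        then have "B k * (k / (a k - real d * b0)\<^sup>2) \<le> B k * U k" using elim by (intro mult_left_mono) auto
        moreover have "?c * ?v \<le> ?c * (MIN l. 1 - (\<rho> $ l)\<^sup>2)" using vmin by (intro mult_left_mono) auto
        ultimately have "B k / (a k - real d * b0)\<^sup>2 * k \<le> ?c * (MIN l. 1 - (\<rho> $ l)\<^sup>2) + (B k * U k - ?c * ?v)"
          by simp
        then have "B k / (a k - real d * b0)\<^sup>2 \<le> 1 / k * (?c * (MIN l. 1 - (\<rho> $ l)\<^sup>2) + (B k * U k - ?c * ?v))"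
          using k0 by (simp add: pos_le_divide_eq)
        then show ?case using elim by auto
      qed
    qed
  qed
  have part2: "asymptotically_efficient F M {s. 0 < noise_variance S s} (\<lambda>k. statistic_law S e (a k) b0) est \<rho>"
    if v: "0 < ?v"
  proof -
    have inv_lim: "((\<lambda>k. 1 / (a k - real d * b0)\<^sup>2) \<longlongrightarrow> 0) F"
    proof -
      have "((\<lambda>x. 1 / (x - real d * b0)\<^sup>2) \<longlongrightarrow> 0) at_top" by real_asymp
      then show ?thesis by (rule filterlim_compose[OF _ at])
    qed
    have ratio_lim: "((\<lambda>k. (a k)\<^sup>2 / (a k - real d * b0)\<^sup>2) \<longlongrightarrow> 1) F"
    proof -
      have "((\<lambda>x. x\<^sup>2 / (x - real d * b0)\<^sup>2) \<longlongrightarrow> 1) at_top" by real_asymp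
      then show ?thesis by (rule filterlim_compose[OF _ at])
    qed
    have integ: "eventually (\<lambda>k. est k \<in> borel_measurable M \<and> integrable M (\<lambda>\<omega>. (norm (est k \<omega>))\<^sup>2)) F"
      using mse[of 0] by eventually_elim (simp add: est_meas)
    have mean: "((\<lambda>k. \<integral>\<omega>. est k \<omega> \<partial>M) \<longlongrightarrow> \<rho>) F"
    proof (rule vec_tendstoI)
      fix i
      let ?x = "(norm (matrix_sqrt S *v axis i 1))\<^sup>2"
      have "((\<lambda>k. ?u\<^sup>2 * quant_error d (a k) b0 (n k) * ?x * (1 / (a k - real d * b0)\<^sup>2)) \<longlongrightarrow> ?u\<^sup>2 * 0 * ?x * 0) F"
        by (intro tendsto_mult tendsto_const qe inv_lim)
      then have up: "((\<lambda>k. ?u\<^sup>2 * quant_error d (a k) b0 (n k) * ?x * (1 / (a k - real d * b0)\<^sup>2)) \<longlongrightarrow> 0) F" by simp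
      have "((\<lambda>k. ((\<integral>\<omega>. est k \<omega> \<partial>M) $ i - \<rho> $ i)\<^sup>2) \<longlongrightarrow> 0) F"
      proof (rule tendsto_sandwich[OF _ _ tendsto_const up])
        show "eventually (\<lambda>k. ((\<integral>\<omega>. est k \<omega> \<partial>M) $ i - \<rho> $ i)\<^sup>2 \<le> ?u\<^sup>2 * quant_error d (a k) b0 (n k) * ?x * (1 / (a k - real d * b0)\<^sup>2)) F"
          using qs
        proof eventually_elim
          case (elim k)
          then interpret quantized_sampling S "a k" b0 "n k" "\<theta> (n k)" by blast
          show ?case using estimator_bias[OF M est_meas est_distr v0, of i] by (simp add: d_def)
        qed
      qed simp
      then have "((\<lambda>k. sqrt (((\<integral>\<omega>. est k \<omega> \<partial>M) $ i - \<rho> $ i)\<^sup>2)) \<longlongrightarrow> sqrt 0) F"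
        by (rule tendsto_real_sqrt)
      then have "((\<lambda>k. (\<integral>\<omega>. est k \<omega> \<partial>M) $ i - \<rho> $ i) \<longlongrightarrow> 0) F"
        by (simp add: tendsto_rabs_zero_iff)
      then show "((\<lambda>k. (\<integral>\<omega>. est k \<omega> \<partial>M) $ i) \<longlongrightarrow> \<rho> $ i) F" by (rule Lim_null[THEN iffD2])
    qed
    let ?t = "\<lambda>k. column_moment TYPE('n) (a k) b0"
    note t = column_moment_tendsto[OF at b0, where 'n='n]
    have fisher: "eventually (\<lambda>k. has_fisher_information {s. 0 < noise_variance S s} (\<lambda>s. statistic_law S e (a k) b0 s) \<rho> (fisher_matrix S \<rho> (?t k)) \<and>
       invertible (fisher_matrix S \<rho> (?t k))) F"
      using qs t(2)
    proof eventually_elim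
      case (elim k)
      then show ?case
        using has_fisher_information_statistic[OF e b0 _ S v, of "a k"] fisher_matrix_inverse(1)[OF S v] by blast
    qed
    have ratio: "((\<lambda>k. (x \<bullet> (covariance_matrix M (est k) *v x)) / (x \<bullet> (matrix_inv (fisher_matrix S \<rho> (?t k)) *v x))) \<longlongrightarrow> 1) F"
      if x: "x \<noteq> 0" for x
    proof -
      let ?x = "(norm (matrix_sqrt S *v x))\<^sup>2"
      have xSx: "x \<bullet> (S *v x) = ?x" by (simp add: norm_matrix_sqrt[OF S])
      have xpos: "0 < ?x"
      proof -
        have "matrix_sqrt S *v x \<noteq> 0" using matrix_sqrt_inv(2)[OF S, of x] x by auto
        then show ?thesis by simp
      qed
      have low: "((\<lambda>k. ?v * (?x * (1 - gain_gap d (a k) b0 (n k)))) \<longlongrightarrow> ?v * (?x * (1 - 0))) F"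
        by (intro tendsto_intros gg)
      have "((\<lambda>k. (?u\<^sup>2 * quant_error d (a k) b0 (n k) + ?v) * ?x * ((a k)\<^sup>2 / (a k - real d * b0)\<^sup>2)) \<longlongrightarrow> (?u\<^sup>2 * 0 + ?v) * ?x * 1) F"
        by (intro tendsto_mult tendsto_add tendsto_const qe ratio_lim)
      then have up: "((\<lambda>k. (?u\<^sup>2 * quant_error d (a k) b0 (n k) + ?v) * ?x * ((a k)\<^sup>2 / (a k - real d * b0)\<^sup>2)) \<longlongrightarrow> ?v * (?x * (1 - 0))) F"
        by simp
      \<comment> \<open>Squeeze: the lower bound loses \<open>gain_gap\<close>, the upper one pays
        \<open>quant_error\<close> and the factor a^2 / (a - d b)^2, and all three corrections
        disappear in the limit.\<close>
      have num: "((\<lambda>k. (a k)\<^sup>2 * (x \<bullet> (covariance_matrix M (est k) *v x))) \<longlongrightarrow> ?v * (?x * (1 - 0))) F"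
      proof (rule tendsto_sandwich[OF _ _ low up])
        show "eventually (\<lambda>k. ?v * (?x * (1 - gain_gap d (a k) b0 (n k))) \<le> (a k)\<^sup>2 * (x \<bullet> (covariance_matrix M (est k) *v x))) F"
          using qs
        proof eventually_elim
          case (elim k)
          then interpret quantized_sampling S "a k" b0 "n k" "\<theta> (n k)" by blast
          have "(a k)\<^sup>2 * (?v * (?x * (1 - gain_gap d (a k) b0 (n k)) / (a k)\<^sup>2)) \<le> (a k)\<^sup>2 * (x \<bullet> (covariance_matrix M (est k) *v x))"
            using estimator_covariance(1)[OF M est_meas est_distr v0, of x] by (intro mult_left_mono) (auto simp: d_def)
          then show ?case using elim by simp
        qed
        show "eventually (\<lambda>k. (a k)\<^sup>2 * (x \<bullet> (covariance_matrix M (est k) *v x)) \<le>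
            (?u\<^sup>2 * quant_error d (a k) b0 (n k) + ?v) * ?x * ((a k)\<^sup>2 / (a k - real d * b0)\<^sup>2)) F"
          using qs
        proof eventually_elim
          case (elim k)
          then interpret quantized_sampling S "a k" b0 "n k" "\<theta> (n k)" by blast
          have "(a k)\<^sup>2 * (x \<bullet> (covariance_matrix M (est k) *v x)) \<le> (a k)\<^sup>2 * ((?u\<^sup>2 * quant_error d (a k) b0 (n k) + ?v) * ?x / (a k - real d * b0)\<^sup>2)"
            using estimator_covariance(2)[OF M est_meas est_distr v0, of x] by (intro mult_left_mono) (auto simp: d_def)
          then show ?case by (simp add: mult_ac)
        qed
      qed
      have den: "((\<lambda>k. (a k)\<^sup>2 * (x \<bullet> (matrix_inv (fisher_matrix S \<rho> (?t k)) *v x))) \<longlongrightarrow> ?v * ?x) F"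
        using fisher_quadratic_form_tendsto[OF S v at t, of x] by (simp only: xSx)
      have lim: "((\<lambda>k. ((a k)\<^sup>2 * (x \<bullet> (covariance_matrix M (est k) *v x))) / ((a k)\<^sup>2 * (x \<bullet> (matrix_inv (fisher_matrix S \<rho> (?t k)) *v x)))) \<longlongrightarrow>
         ?v * (?x * (1 - 0)) / (?v * ?x)) F"
        using v xpos by (intro tendsto_divide num den) auto
      \<comment> \<open>The factors a^2 cancel, a being at least 1.\<close>
      have eq: "eventually (\<lambda>k. ((a k)\<^sup>2 * (x \<bullet> (covariance_matrix M (est k) *v x))) / ((a k)\<^sup>2 * (x \<bullet> (matrix_inv (fisher_matrix S \<rho> (?t k)) *v x))) =
         (x \<bullet> (covariance_matrix M (est k) *v x)) / (x \<bullet> (matrix_inv (fisher_matrix S \<rho> (?t k)) *v x))) F"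
        using qs by eventually_elim auto
      have "?v * (?x * (1 - 0)) / (?v * ?x) = 1" using v xpos by simp
      then show ?thesis using Lim_transform_eventually[OF lim eq] by simp
    qed
    show ?thesis
      unfolding asymptotically_efficient_def
      by (intro conjI integ mean exI[of _ "\<lambda>k. fisher_matrix S \<rho> (?t k)"] allI impI fisher ratio)
  qed
  show ?thesis
    using part1 part2 unfolding F_def by blast
qed

end
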